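(* Let $n\in\mathbb N$, $p\ge2$, $\theta\in\mathbb R$, and consider the Heisenberg group $\mathbb H^n$ with $Q=2n+2$. (1) For the Korányi norm $\rho(z,t)=(|z|^4+t^2)^{1/4}$, \[ c(\rho,p,\theta)\ge\begin{cases}\left|\frac{Q-p\theta}{p}\right|^p\left|\frac{Q-2}{Q}\right|^p & \text{if } p\theta\in\left[\left(1-\sqrt{\tfrac32}\right)Q,\left(1+\sqrt{\tfrac32}\right)Q\right],\\[1ex] \left(\frac32\right)^{p/2}\frac{\left(3p\theta(p\theta-2Q)\right)^{p/4}}{|p\theta-Q|^{p/2}}\left|\frac{Q-2}{p}\right|^p & \text{otherwise.}\end{cases} \] (2) For the Carnot–Carathéodory norm $\delta_{cc}$, \[ c(\delta_{cc},p,\theta)\ge\begin{cases}\left(\frac{Q-2}{Q}\right)^p\left|\frac{Q-p\theta}{p}\right|^p & \text{if } \theta\ge0 \text{ and } Q\ge\frac{4p\theta}{12-\pi^2},\\[1ex] \frac{1}{\|g\|_\infty^{p/2}}\left|\frac{Q-p\theta}{p}\right|^p & \text{otherwise,}\end{cases} \] where $g:[-2\pi,2\pi]\to(0,\infty)$ is \[ g(\nu)=2\left(\frac{Q}{Q-2}\right)^2\frac{1-\cos\nu}{\nu^2}+\left(\frac{2p\theta}{Q-2}\right)^2\left(\frac{\nu-\sin\nu}{\nu^2}\right)^2-\frac{4p\theta Q}{(Q-2)^2}\,\frac{\nu-\sin\nu}{\nu^2}\,\frac{1-\cos\nu}{\nu} \] (extended continuously at $\nu=0$), and $\|g\|_\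infty=\sup_{[-2\pi,2\pi]}g$.
   Context: The Heisenberg group $\mathbb H^n$ is $\mathbb R^{2n}\times\mathbb R$ with coordinates $(z,t)$, $z=(z_1,\dots,z_{2n})$, group law $(z,t)\circ(\eta,\tau)=(z+\eta,t+\tau+\tfrac12\langle Bz,\eta\rangle)$ where $B=\mathrm{diag}\left(\begin{pmatrix}0&4\\-4&0\end{pmatrix},\dots,\begin{pmatrix}0&4\\-4&0\end{pmatrix}\right)$, dilations $\delta_\gamma(z,t)=(\gamma z,\gamma^2t)$, homogeneous dimension $Q=2n+2$. Horizontal vector fields: $X_{2i-1}=\partial_{z_{2i-1}}+2z_{2i}\partial_t$, $X_{2i}=\partial_{z_{2i}}-2z_{2i-1}\partial_t$, $i=1,\dots,n$; $\nabla_{\mathbb H}u=(X_1u,\dots,X_{2n}u)$ with Euclidean norm. $\delta_{cc}(z,t)$ is the Carnot–Carathéodory distance from $(z,t)$ to the origin: the infimum of $\int_0^1|h(s)|\,ds$ over absolutely continuous curves $\gamma:[0,1]\to\mathbb H^n$ from $0$ to $(z,t)$ with $\gamma'(s)=\sum_i h_i(s)X_i(\gamma(s))$ a.e. For a positive homogeneous function $d$ (continuous, $d(\delta_\lambda(z,t))=\lambda d(z,t)$, $d>0$ off the origin), $p\ge2$, $\theta\in\mathbb R$, \[ c(d,p,\theta)=\sup\Big\{c\ge0:\int_{\mathbb H^n}\frac{|\nabla_{\mathbb H}u|^p}{d^{p(\theta-1)}}dz\,dt\ge c\int_{\mathbb H^n}\frac{|u|^p}{d^{p\theta}}dz\,dt\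 \ \forall u\in C_c^\infty(\mathbb H^n\setminus\{0\})\Big\}. \] *)

theory Defs
  imports "HOL-Analysis.Analysis"
begin

text \<open>Points of the Heisenberg group H^n are represented as ((x,y),t) with
  x,y in R^n, where z_{2i-1} = x_i and z_{2i} = y_i; the index type 'n has n = CARD('n) elements.\<close>

type_synonym 'n heis = "((real^'n) \<times> (real^'n)) \<times> real"

definition hdim :: "'n::finite itself \<Rightarrow> real" where
  "hdim _ = 2 * real CARD('n) + 2"

definition ddir :: "('a::real_normed_vector \<Rightarrow> real) \<Rightarrow> 'a \<Rightarrow> 'a \<Rightarrow> real" where
  "ddir u P v = frechet_derivative u (at P) v"

definition Xodd :: "'n::finite \<Rightarrow> ('n heis \<Rightarrow> real) \<Rightarrow> 'n heis \<Rightarrow> real" where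
  "Xodd i u P = ddir u P ((axis i 1, 0), 0) + 2 * (snd (fst P) $ i) * ddir u P ((0, 0), 1)"

definition Xeven :: "'n::finite \<Rightarrow> ('n heis \<Rightarrow> real) \<Rightarrow> 'n heis \<Rightarrow> real" where
  "Xeven i u P = ddir u P ((0, axis i 1), 0) - 2 * (fst (fst P) $ i) * ddir u P ((0, 0), 1)"

definition hgrad_norm :: "('n::finite heis \<Rightarrow> real) \<Rightarrow> 'n heis \<Rightarrow> real" where
  "hgrad_norm u P = sqrt (\<Sum>i\<in>UNIV. (Xodd i u P)\<^sup>2 + (Xeven i u P)\<^sup>2)"

fun iter_dd :: "'a::real_normed_vector list \<Rightarrow> ('a \<Rightarrow> real) \<Rightarrow> 'a \<Rightarrow> real" where
  "iter_dd [] u = u"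
| "iter_dd (v # vs) u = (\<lambda>P. ddir (iter_dd vs u) P v)"

definition smooth_fun :: "('a::real_normed_vector \<Rightarrow> real) \<Rightarrow> bool" where
  "smooth_fun u \<longleftrightarrow> (\<forall>vs P. iter_dd vs u differentiable (at P))"

definition Cc_inf_punct :: "('a::real_normed_vector \<Rightarrow> real) set" where
  "Cc_inf_punct = {u. smooth_fun u \<and> compact (closure {P. u P \<noteq> 0}) \<and> 0 \<notin> closure {P. u P \<noteq> 0}}"

definition hardy_const :: "('n::finite heis \<Rightarrow> real) \<Rightarrow> real \<Rightarrow> real \<Rightarrow> ereal" where
  "hardy_const d p \<theta> = Sup (ereal ` {c. c \<ge> 0 \<and> (\<forall>u \<in> Cc_inf_punct.
      (\<integral>\<^sup>+ P. ennreal (hgrad_norm u P powr p / d P powr (p * (\<theta> - 1))) \<partial>lborel)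
        \<ge> ennreal c * (\<integral>\<^sup>+ P. ennreal (\<bar>u P\<bar> powr p / d P powr (p * \<theta>)) \<partial>lborel))})"

definition koranyi :: "'n::finite heis \<Rightarrow> real" where
  "koranyi P = ((norm (fst P))^4 + (snd P)^2) powr (1/4)"

definition abs_cont_on :: "real \<Rightarrow> real \<Rightarrow> (real \<Rightarrow> 'a::metric_space) \<Rightarrow> bool" where
  "abs_cont_on a b \<gamma> \<longleftrightarrow> (\<forall>\<epsilon>>0. \<exists>\<delta>>0. \<forall>(m::nat) (l::nat\<Rightarrow>real) r.
     (\<forall>i<m. a \<le> l i \<and> l i \<le> r i \<and> r i \<le> b) \<and>
     (\<forall>i<m. \<forall>j<m. i \<noteq> j \<longrightarrow> r i \<le> l j \<or> r j \<le> l i) \<and>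
     (\<Sum>i<m. r i - l i) < \<delta> \<longrightarrow> (\<Sum>i<m. dist (\<gamma> (l i)) (\<gamma> (r i))) < \<epsilon>)"

text \<open>gamma is a horizontal curve with controls h: gamma' = sum_i h_i X_i(gamma) a.e. on [0,1],
  where h = (a,b) with a_i = h_{2i-1}, b_i = h_{2i}.\<close>
definition horizontal_with :: "(real \<Rightarrow> 'n::finite heis) \<Rightarrow> (real \<Rightarrow> (real^'n) \<times> (real^'n)) \<Rightarrow> bool" where
  "horizontal_with \<gamma> h \<longleftrightarrow> abs_cont_on 0 1 \<gamma> \<and>
     (AE s in lborel. s \<in> {0..1} \<longrightarrow>
        (\<gamma> has_vector_derivative
          ((fst (h s), snd (h s)),
           2 * (\<Sum>i\<in>UNIV. fst (h s) $ i * snd (fst (\<gamma> s)) $ i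
                          - snd (h s) $ i * fst (fst (\<gamma> s)) $ i))) (at s within {0..1}))"

definition cc_dist :: "'n::finite heis \<Rightarrow> real" where
  "cc_dist P = enn2real (INF (\<gamma>, h) \<in> {(\<gamma>, h). \<gamma> 0 = 0 \<and> \<gamma> 1 = P \<and> horizontal_with \<gamma> h}.
       \<integral>\<^sup>+ s. ennreal (norm (h s)) * indicator {0..1} s \<partial>lborel)"

definition g_raw :: "real \<Rightarrow> real \<Rightarrow> real \<Rightarrow> real \<Rightarrow> real" where
  "g_raw Q p \<theta> \<nu> = 2 * (Q / (Q - 2))^2 * ((1 - cos \<nu>) / \<nu>^2)
     + (2 * p * \<theta> / (Q - 2))^2 * ((\<nu> - sin \<nu>) / \<nu>^2)^2
     - 4 * p * \<theta> * Q / (Q - 2)^2 * ((\<nu> - sin \<nu>) / \<nu>^2) * ((1 - cos \<nu>) / \<nu>)"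

definition g_fun :: "real \<Rightarrow> real \<Rightarrow> real \<Rightarrow> real \<Rightarrow> real" where
  "g_fun Q p \<theta> \<nu> = (if \<nu> = 0 then Lim (at 0) (g_raw Q p \<theta>) else g_raw Q p \<theta> \<nu>)"

definition g_sup :: "real \<Rightarrow> real \<Rightarrow> real \<Rightarrow> real" where
  "g_sup Q p \<theta> = (SUP \<nu> \<in> {-2*pi..2*pi}. g_fun Q p \<theta> \<nu>)"

end

(*
  Write z = (x, y), m = |z|^2 and J(x, y) = (y, -x). Off the axis z = 0 both norms have the form
  d^2 = m phi(t/m) with a C^2 profile phi >= 1. The dilation field z . grad_z + 2 t d/dt has divergence Q;
  multiplied by d^(-p theta) it has divergence (Q - p theta) d^(-p theta). Since d/dt is a sum of
  commutators of the X_i, its vertical part can be traded for a horizontal one, which gives the field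
  F = d^(-p theta) z - J grad_H (2 t d^(-p theta)) / (4n) with the same divergence. Testing with
  |u|^p, cut off near the axis (which has codimension 2n >= 2), and Young's inequality yield the Hardy
  inequality with constant (|Q - p theta| / (p M))^p, where M is the supremum of |F| d^(p theta - 1).

  For the Koranyi norm phi(tau) = sqrt (1 + tau^2), and M^2 is the maximum of a cubic on [0,1].
  For the Carnot-Caratheodory distance phi(mu(x)) = (x / sin x)^2 with
  mu(x) = (x - sin x cos x) / (sin x)^2, and |F|^2 d^(2 p theta - 2) = g(2x). That the distance has
  this form follows from an explicit geodesic and from the matching lower bound
  x cot x |z|^2 + x t <= L^2, valid for |x| < pi and every horizontal curve of length L from 0 to (z,t).
*)
theory Submission
  imports Defs "HOL-Real_Asymp.Real_Asymp"
begin

section \<open>Absolutely continuous curves\<close>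

text \<open>The bounds x cot x |z|^2 + x t, taken over |x| < pi, form a Legendre-type transform: x
  cot x has derivative \<open>- mu x\<close>, so for given tau = t/|z|^2 the best bound sits where
  mu x = tau, which is also the parameter of the geodesic ending at (z,t). For the same reason the
  profile has derivative x, and |F| becomes an explicit function of x. The bound itself is a
  calibration by kappa cot (kappa s) |z|^2 + kappa t. This function is singular at s = 0, while
  curves are merely absolutely continuous and no measurability is stated for their controls. The
  calibration is therefore discretised: the curve is sampled at equal steps of length, the weights
  satisfy a difference version of the Riccati equation exactly, and only increments of the curve
  enter. The fundamental theorem of calculus for absolutely continuous curves serves to estimate
  these increments. The cut-off is forced by the form of F: its coefficients are powers of |z| times
  functions of t/|z|^2, singular on the axis, and both norms are described by their profile only off
  the axis.\<close>

lemma abs_cont_on_finite_family: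
  fixes f :: "real \<Rightarrow> 'a::metric_space"
  assumes ac: "abs_cont_on a b f" and "e > 0"
  shows "\<exists>d>0. \<forall>I l r. finite (I::'i set) \<and> (\<forall>i\<in>I. a \<le> l i \<and> l i \<le> r i \<and> r i \<le> b) \<and>
        (\<forall>i\<in>I. \<forall>j\<in>I. i \<noteq> j \<longrightarrow> r i \<le> l j \<or> r j \<le> l i) \<and>
        (\<Sum>i\<in>I. r i - l i) < d \<longrightarrow> (\<Sum>i\<in>I. dist (f (l i)) (f (r i))) < e"
proof -
  obtain d where d: "d > 0" and
    *: "\<And>(m::nat) (l::nat\<Rightarrow>real) r.
     (\<forall>i<m. a \<le> l i \<and> l i \<le> r i \<and> r i \<le> b) \<and>
     (\<forall>i<m. \<forall>j<m. i \<noteq> j \<longrightarrow> r i \<le> l j \<or> r j \<le> l i) \<and>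
     (\<Sum>i<m. r i - l i) < d \<longrightarrow> (\<Sum>i<m. dist (f (l i)) (f (r i))) < e"
    using ac[unfolded abs_cont_on_def, THEN spec, THEN mp, OF \<open>e > 0\<close>] by blast
  show ?thesis
  proof (intro exI conjI allI impI, rule d)
    fix I :: "'i set" and l r
    assume "finite I \<and> (\<forall>i\<in>I. a \<le> l i \<and> l i \<le> r i \<and> r i \<le> b) \<and>
        (\<forall>i\<in>I. \<forall>j\<in>I. i \<noteq> j \<longrightarrow> r i \<le> l j \<or> r j \<le> l i) \<and> (\<Sum>i\<in>I. r i - l i) < d"
    then have fin: "finite I" and 1: "\<And>i. i \<in> I \<Longrightarrow> a \<le> l i \<and> l i \<le> r i \<and> r i \<le> b"
      and 2: "\<And>i j. \<lbrakk>i \<in> I; j \<in> I; i \<noteq> j\<rbrakk> \<Longrightarrow> r i \<le> l j \<or> r j \<le> l i"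
      and 3: "(\<Sum>i\<in>I. r i - l i) < d" by auto
    obtain h where h: "bij_betw h {..<card I} I"
      using ex_bij_betw_nat_finite[OF fin] by (auto simp: atLeast0LessThan)
    have hI: "h i \<in> I" if "i < card I" for i
      using h that by (auto simp: bij_betw_def)
    have inj: "i \<noteq> j \<Longrightarrow> h i \<noteq> h j" if "i < card I" "j < card I" for i j
      using h that by (auto simp: bij_betw_def inj_on_def)
    have s1: "(\<Sum>i<card I. r (h i) - l (h i)) = (\<Sum>i\<in>I. r i - l i)"
      using sum.reindex_bij_betw[OF h] by fast
    have s2: "(\<Sum>i<card I. dist (f (l (h i))) (f (r (h i)))) = (\<Sum>i\<in>I. dist (f (l i)) (f (r i)))"
      using sum.reindex_bij_betw[OF h, of "\<lambda>i. dist (f (l i)) (f (r i))"] by fast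
    have "(\<Sum>i<card I. dist (f (l (h i))) (f (r (h i)))) < e"
      using *[of "card I" "l \<circ> h" "r \<circ> h"] 1 2 3 hI inj s1 by auto
    then show "(\<Sum>i\<in>I. dist (f (l i)) (f (r i))) < e" unfolding s2 .
  qed
qed

text \<open>Tags outside the exceptional null set are handled by differentiability, tags inside it by
  absolute continuity: a fine division has small total length over them.\<close>

lemma abs_cont_on_has_integral:
  fixes f :: "real \<Rightarrow> 'a::banach"
  assumes ac: "abs_cont_on a b f" and ab: "a \<le> b" and N: "negligible N"
    and der: "\<And>s. s \<in> {a..b} - N \<Longrightarrow> (f has_vector_derivative f' s) (at s within {a..b})"
    and zero: "\<And>s. s \<in> N \<Longrightarrow> f' s = 0"
  shows "(f' has_integral (f b - f a)) {a..b}"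
proof (cases "a = b")
  case True then show ?thesis by auto
next
  case False
  then have ab: "a < b" using ab by auto
  show ?thesis
  unfolding has_integral_factor_content box_real[symmetric]
  proof (intro allI impI)
  fix e :: real
  assume "e > 0"
  then have "\<forall>x. \<exists>d>0. x \<in> {a..b} - N \<longrightarrow>
         (\<forall>y\<in>{a..b}. norm (y-x) < d \<longrightarrow> norm (f y - f x - (y-x) *\<^sub>R f' x) \<le> e/2 * norm (y-x))"
    using der[unfolded has_vector_derivative_def has_derivative_within_alt]
    by (metis half_gt_zero)
  then obtain d where d: "\<And>x. 0 < d x"
                 "\<And>x y. \<lbrakk>x \<in> {a..b} - N; y \<in> {a..b}; norm (y-x) < d x\<rbrakk>
                        \<Longrightarrow> norm (f y - f x - (y-x) *\<^sub>R f' x) \<le> e/2 * norm (y-x)"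
    by metis
  have "e/2 * (b - a) > 0"
    using \<open>e > 0\<close> ab by simp
  \<comment> \<open>Half of the admissible error e (b - a) is reserved for the tags in
    \<open>N\<close>. The intervals of a tagged division are indexed by tag-interval pairs, hence
    the set-indexed form of absolute continuity.\<close>
  from abs_cont_on_finite_family[OF ac this, where 'i = "real \<times> real set"]
  obtain \<eta> where \<eta>: "\<eta> > 0"
    "\<forall>I l r. finite I \<and> (\<forall>i\<in>I. a \<le> l i \<and> l i \<le> r i \<and> r i \<le> b) \<and>
        (\<forall>i\<in>I. \<forall>j\<in>I. i \<noteq> j \<longrightarrow> r i \<le> l j \<or> r j \<le> l i) \<and>
        (\<Sum>i\<in>I. r i - l i) < \<eta> \<longrightarrow> (\<Sum>i\<in>(I::(real \<times> real set) set). dist (f (l i)) (f (r i))) < e/2 * (b-a)"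
    by (elim exE conjE) (rule that)
  have Nl: "N \<in> sets lebesgue" "emeasure lebesgue N = 0"
    using N negligible_iff_null_sets[of N] by (auto simp: null_sets_def)
  obtain U where U: "open U" "N \<subseteq> U" "U - N \<in> lmeasurable" "emeasure lebesgue (U - N) < ennreal \<eta>"
    using sets_lebesgue_outer_open[OF Nl(1) \<eta>(1)] by metis
  have UL: "U \<in> lmeasurable"
    using U(3) fmeasurable.Un[of "U - N" _ N] N U(2) negligible_iff_measure
    by (metis Diff_partition Un_commute fmeasurable.Un)
  have muU: "measure lebesgue U < \<eta>"
  proof -
    have "measure lebesgue U = measure lebesgue (U - N)"
      using N UL by (simp add: measure_Diff_null_set negligible_iff_null_sets fmeasurableD)
    also have "\<dots> < \<eta>"
      using U(3,4) by (metis emeasure_eq_measure2 ennreal_leI not_less)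
    finally show ?thesis .
  qed
  \<comment> \<open>At tags in \<open>N\<close> the gauge is one and the same open set of measure
    below \<open>\<eta>\<close>, so all intervals tagged there have total length below
    \<open>\<eta>\<close>, however many there are.\<close>
  define g where "g x = (if x \<in> N then U else ball x (d x))" for x
  show "\<exists>d. gauge d \<and> (\<forall>p. p tagged_division_of (cbox a b) \<and> d fine p \<longrightarrow>
    norm ((\<Sum>(x, k)\<in>p. measure lborel k *\<^sub>R f' x) - (f b - f a)) \<le> e * measure lborel (cbox a b))"
  proof (intro exI conjI allI impI)
    show "gauge g" using d(1) U unfolding gauge_def g_def by auto
    fix p assume "p tagged_division_of cbox a b \<and> g fine p"
    then have p: "p tagged_division_of cbox a b" and fine: "g fine p" by auto
    have finp: "finite p" using p by blast
    have ivl: "K = {Inf K..Sup K} \<and> Inf K \<le> Sup K \<and> a \<le> Inf K \<and> Sup K \<le> b \<and> x \<in> K \<and> measure lborel K = Sup K - Inf K"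
      if xK: "(x, K) \<in> p" for x K
    proof -
      have "x \<in> K" "K \<subseteq> cbox a b" using tagged_division_ofD(2,3)[OF p that] by auto
      moreover obtain u v where "K = cbox u v" using tagged_division_ofD(4)[OF p xK] by auto
      ultimately show ?thesis by auto
    qed
    \<comment> \<open>Degenerate intervals are left out: disjoint interiors say nothing about their
      position, so \<open>sep\<close> could fail for them. Their contribution vanishes anyway, both
      the length and the increment of f being 0.\<close>
    define p2 where "p2 = {xk \<in> p. fst xk \<in> N \<and> Inf (snd xk) < Sup (snd xk)}"
    have p2p: "p2 \<subseteq> p" and finp2: "finite p2" using finp by (auto simp: p2_def)
    have tp2: "p2 tagged_partial_division_of cbox a b"
      using p p2p tagged_partial_division_subset by (auto simp: tagged_division_of_def)
    have sep: "Sup (snd i) \<le> Inf (snd j) \<or> Sup (snd j) \<le> Inf (snd i)"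
      if i: "i \<in> p2" and j: "j \<in> p2" and ne: "i \<noteq> j" for i j
    proof (rule ccontr)
      assume c: "\<not> ?thesis"
      obtain x K y L where ij: "i = (x,K)" "j = (y,L)" by (metis surj_pair)
      have "interior K \<inter> interior L = {}"
        using tp2 i j ne ij unfolding tagged_partial_division_of_def by auto
      moreover have "interior K = {Inf K<..<Sup K}" "interior L = {Inf L<..<Sup L}"
        using ivl i j ij p2p by (metis in_mono interior_atLeastAtMost_real)+
      moreover have "Inf K < Sup K" "Inf L < Sup L" using i j ij by (auto simp: p2_def)
      ultimately have "{max (Inf K) (Inf L)<..<min (Sup K) (Sup L)} = {}"
        by auto
      then have "\<not> max (Inf K) (Inf L) < min (Sup K) (Sup L)"
        using dense by fastforce
      then show False using c ij \<open>Inf K < Sup K\<close> \<open>Inf L < Sup L\<close> by (auto simp: max_def min_def split: if_splits)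
    qed
    have small: "(\<Sum>i\<in>p2. Sup (snd i) - Inf (snd i)) < \<eta>"
    proof -
      have div: "snd ` p2 division_of \<Union>(snd ` p2)"
        using partial_division_of_tagged_division[OF tp2] .
      have leb: "measure lebesgue {l..r} = measure lborel {l..r}" for l r :: real
        by simp
      have inj: "inj_on snd p2"
      proof (rule inj_onI, rule ccontr)
        fix i j assume "i \<in> p2" "j \<in> p2" "snd i = snd j" "i \<noteq> j"
        then show False using sep[of i j] unfolding p2_def by auto
      qed
      have "(\<Sum>i\<in>p2. Sup (snd i) - Inf (snd i)) = (\<Sum>i\<in>p2. measure lebesgue (snd i))"
      proof (rule sum.cong[OF refl])
        fix i assume "i \<in> p2"
        then have "(fst i, snd i) \<in> p" using p2p by auto
        from ivl[OF this] have "snd i = {Inf (snd i)..Sup (snd i)}" "Inf (snd i) \<le> Sup (snd i)" by auto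
        then have "measure lebesgue (snd i) = measure lborel {Inf (snd i)..Sup (snd i)}"
          by (metis leb)
        then show "Sup (snd i) - Inf (snd i) = measure lebesgue (snd i)"
          using \<open>Inf (snd i) \<le> Sup (snd i)\<close> by simp
      qed
      also have "\<dots> = (\<Sum>k\<in>snd ` p2. measure lebesgue k)"
        by (simp add: sum.reindex[OF inj])
      also have "\<dots> = measure lebesgue (\<Union>(snd ` p2))"
        by (rule content_division[OF div])
      also have "\<dots> \<le> measure lebesgue U"
      proof (rule measure_mono_fmeasurable)
        show "\<Union>(snd ` p2) \<subseteq> U"
          using fine unfolding fine_def g_def p2_def by force
        show "\<Union>(snd ` p2) \<in> sets lebesgue"
          using lmeasurable_division[OF div] by auto
      qed (rule UL)
      finally show ?thesis using muU by simp
    qed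
    have bad: "(\<Sum>i\<in>p2. dist (f (Inf (snd i))) (f (Sup (snd i)))) < e/2 * (b-a)"
    proof (rule \<eta>(2)[rule_format], intro conjI ballI impI)
      fix i assume "i \<in> p2"
      then have "(fst i, snd i) \<in> p" using p2p by auto
      from ivl[OF this] show "a \<le> Inf (snd i)" "Inf (snd i) \<le> Sup (snd i)" "Sup (snd i) \<le> b" by auto
    qed (use finp2 sep small in auto)
    have ba: "b - a = (\<Sum>(x,K)\<in>p. Sup K - Inf K)" "f b - f a = (\<Sum>(x,K)\<in>p. f(Sup K) - f(Inf K))"
      using additive_tagged_division_1[OF less_imp_le[OF ab] p[unfolded box_real], of "\<lambda>x. x"]
        additive_tagged_division_1[OF less_imp_le[OF ab] p[unfolded box_real], of f] by auto
    define T where "T i = norm (measure lborel (snd i) *\<^sub>R f' (fst i) - (f (Sup (snd i)) - f (Inf (snd i))))" for i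
    have T1: "T i \<le> e/2 * (Sup (snd i) - Inf (snd i))" if "i \<in> p - p2" for i
    proof -
      obtain x K where i: "i = (x,K)" by (metis surj_pair)
      have xK: "(x,K) \<in> p" using that i by auto
      define u v where "u = Inf K" and "v = Sup K"
      have iv: "K = {u..v}" "u \<le> v" "a \<le> u" "v \<le> b" "x \<in> K" "measure lborel K = v - u"
        using ivl[OF xK, folded u_def v_def] by blast+
      show ?thesis
      proof (cases "x \<in> N")
        case True
        then have "v = u" using that i iv(2) xK unfolding p2_def u_def v_def by force
        then show ?thesis using zero[OF True] i unfolding T_def u_def v_def by auto
      next
        case False
        have K: "K \<subseteq> ball x (d x)" using fineD[OF fine xK] False unfolding g_def by auto
        have "u \<in> K" "v \<in> K" "x \<in> {a..b} - N" "u \<le> x" "x \<le> v" "u \<in> {a..b}" "v \<in> {a..b}"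
          using iv False by auto
        then have 1: "norm (f u - f x - (u-x) *\<^sub>R f' x) \<le> e/2 * norm (u-x)"
          "norm (f v - f x - (v-x) *\<^sub>R f' x) \<le> e/2 * norm (v-x)"
          using K by (intro d(2); force simp: dist_real_def)+
        have "measure lborel K *\<^sub>R f' x - (f v - f u) =
            (f u - f x - (u-x) *\<^sub>R f' x) - (f v - f x - (v-x) *\<^sub>R f' x)"
          unfolding iv(6) by (simp add: algebra_simps)
        then have "norm (measure lborel K *\<^sub>R f' x - (f v - f u)) \<le> e/2 * norm (u-x) + e/2 * norm (v-x)"
          by (simp only:) (rule order_trans[OF norm_triangle_ineq4 add_mono[OF 1]])
        also have "\<dots> = e/2 * (v - u)" using \<open>u \<le> x\<close> \<open>x \<le> v\<close> by (simp add: field_simps)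
        finally show ?thesis by (simp add: T_def i u_def v_def)
      qed
    qed
    have T2: "T i = dist (f (Inf (snd i))) (f (Sup (snd i)))" if "i \<in> p2" for i
      using that zero unfolding T_def p2_def by (auto simp: dist_norm)
    have "norm ((\<Sum>(x, k)\<in>p. measure lborel k *\<^sub>R f' x) - (f b - f a)) = norm (\<Sum>i\<in>p. measure lborel (snd i) *\<^sub>R f' (fst i) - (f (Sup (snd i)) - f (Inf (snd i))))"
      unfolding ba(2) by (simp add: sum_subtractf split_def)
    also have "\<dots> \<le> (\<Sum>i\<in>p. T i)" unfolding T_def by (rule norm_sum)
    also have "\<dots> = (\<Sum>i\<in>p2. T i) + (\<Sum>i\<in>p-p2. T i)"
      using sum.subset_diff[OF p2p finp, of T] by simp
    also have "\<dots> \<le> e/2 * (b-a) + (\<Sum>i\<in>p-p2. e/2 * (Sup (snd i) - Inf (snd i)))"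
      using bad T2 T1 by (intro add_mono sum_mono) auto
    also have "(\<Sum>i\<in>p-p2. e/2 * (Sup (snd i) - Inf (snd i))) \<le> (\<Sum>i\<in>p. e/2 * (Sup (snd i) - Inf (snd i)))"
      using \<open>e > 0\<close> finp ivl by (intro sum_mono2) auto
    also have "\<dots> = e/2 * (b - a)" unfolding ba(1) by (simp add: sum_distrib_left split_def)
    finally show "norm ((\<Sum>(x, k)\<in>p. measure lborel k *\<^sub>R f' x) - (f b - f a)) \<le> e * measure lborel (cbox a b)"
      using ab by simp
  qed
  qed
qed

lemma abs_cont_on_subinterval:
  "abs_cont_on a b f \<Longrightarrow> a \<le> u \<Longrightarrow> v \<le> b \<Longrightarrow> abs_cont_on u v f"
  unfolding abs_cont_on_def by (elim all_forward imp_forward ex_forward conj_forward) auto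

lemma abs_cont_on_Lipschitz_image:
  assumes ac: "abs_cont_on a b f" and L: "\<And>x y. dist (F x) (F y) \<le> C * dist x y"
  shows "abs_cont_on a b (\<lambda>s. F (f s))"
  unfolding abs_cont_on_def
proof (intro allI impI)
  fix e :: real assume "e > 0"
  define C' where "C' = max C 1"
  have L': "dist (F x) (F y) \<le> C' * dist x y" for x y
    using L[of x y] by (smt (verit) C'_def mult_right_mono zero_le_dist)
  have C': "C' > 0" unfolding C'_def by auto
  have "e / C' > 0" using C' \<open>e > 0\<close> by simp
  then obtain d where d: "d > 0" and
    *: "\<And>(m::nat) (l::nat\<Rightarrow>real) r.
     (\<forall>i<m. a \<le> l i \<and> l i \<le> r i \<and> r i \<le> b) \<and>
     (\<forall>i<m. \<forall>j<m. i \<noteq> j \<longrightarrow> r i \<le> l j \<or> r j \<le> l i) \<and>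
     (\<Sum>i<m. r i - l i) < d \<longrightarrow> (\<Sum>i<m. dist (f (l i)) (f (r i))) < e / C'"
    using ac[unfolded abs_cont_on_def, THEN spec, THEN mp, OF \<open>e / C' > 0\<close>] by blast
  show "\<exists>\<delta>>0. \<forall>(m::nat) (l::nat\<Rightarrow>real) r.
     (\<forall>i<m. a \<le> l i \<and> l i \<le> r i \<and> r i \<le> b) \<and>
     (\<forall>i<m. \<forall>j<m. i \<noteq> j \<longrightarrow> r i \<le> l j \<or> r j \<le> l i) \<and>
     (\<Sum>i<m. r i - l i) < \<delta> \<longrightarrow> (\<Sum>i<m. dist (F (f (l i))) (F (f (r i)))) < e"
  proof (intro exI conjI allI impI, rule d)
    fix m and l r :: "nat \<Rightarrow> real"
    assume "(\<forall>i<m. a \<le> l i \<and> l i \<le> r i \<and> r i \<le> b) \<and>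
     (\<forall>i<m. \<forall>j<m. i \<noteq> j \<longrightarrow> r i \<le> l j \<or> r j \<le> l i) \<and> (\<Sum>i<m. r i - l i) < d"
    then have "(\<Sum>i<m. dist (f (l i)) (f (r i))) < e / C'" using * by blast
    then have "C' * (\<Sum>i<m. dist (f (l i)) (f (r i))) < e" using C' by (simp add: field_simps)
    moreover have "(\<Sum>i<m. dist (F (f (l i))) (F (f (r i)))) \<le> C' * (\<Sum>i<m. dist (f (l i)) (f (r i)))"
      unfolding sum_distrib_left by (intro sum_mono L')
    ultimately show "(\<Sum>i<m. dist (F (f (l i))) (F (f (r i)))) < e" by simp
  qed
qed

lemma Lipschitz_imp_abs_cont_on:
  assumes "\<And>x y. x \<in> {a..b} \<Longrightarrow> y \<in> {a..b} \<Longrightarrow> dist (f x) (f y) \<le> C * \<bar>x - y\<bar>"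
  shows "abs_cont_on a b f"
  unfolding abs_cont_on_def
proof (intro allI impI)
  fix e :: real assume "e > 0"
  define C' where "C' = max C 1"
  have C': "C' > 0" unfolding C'_def by auto
  have L': "dist (f x) (f y) \<le> C' * (y - x)" if "a \<le> x \<and> x \<le> y \<and> y \<le> b" for x y
    using assms[of x y] that by (smt (verit) C'_def mult_right_mono atLeastAtMost_iff)
  show "\<exists>\<delta>>0. \<forall>(m::nat) (l::nat\<Rightarrow>real) r.
     (\<forall>i<m. a \<le> l i \<and> l i \<le> r i \<and> r i \<le> b) \<and>
     (\<forall>i<m. \<forall>j<m. i \<noteq> j \<longrightarrow> r i \<le> l j \<or> r j \<le> l i) \<and>
     (\<Sum>i<m. r i - l i) < \<delta> \<longrightarrow> (\<Sum>i<m. dist (f (l i)) (f (r i))) < e"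
  proof (intro exI conjI allI impI)
    show "e / C' > 0" using C' \<open>e > 0\<close> by simp
    fix m and l r :: "nat \<Rightarrow> real"
    assume *: "(\<forall>i<m. a \<le> l i \<and> l i \<le> r i \<and> r i \<le> b) \<and>
     (\<forall>i<m. \<forall>j<m. i \<noteq> j \<longrightarrow> r i \<le> l j \<or> r j \<le> l i) \<and> (\<Sum>i<m. r i - l i) < e / C'"
    have "(\<Sum>i<m. dist (f (l i)) (f (r i))) \<le> C' * (\<Sum>i<m. r i - l i)"
      unfolding sum_distrib_left using * by (intro sum_mono L') auto
    also have "\<dots> < e" using * C' by (simp add: field_simps)
    finally show "(\<Sum>i<m. dist (f (l i)) (f (r i))) < e" .
  qed
qed

text \<open>A mean value inequality with an exceptional null set. The derivative may be chosen as 0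
  on that set without changing its integral, which is the increment of f.\<close>

lemma abs_cont_on_norm_diff_le:
  fixes f :: "real \<Rightarrow> 'a::banach"
  assumes ac: "abs_cont_on a b f" and uv: "a \<le> u" "u \<le> v" "v \<le> b" and N: "negligible N"
    and der: "\<And>s. s \<in> {u..v} - N \<Longrightarrow> \<exists>D. (f has_vector_derivative D) (at s within {a..b}) \<and> norm D \<le> g s"
    and g: "g integrable_on {u..v}" "\<And>s. g s \<ge> 0"
  shows "norm (f v - f u) \<le> integral {u..v} g"
proof -
  obtain D where D: "\<And>s. s \<in> {u..v} - N \<Longrightarrow> (f has_vector_derivative D s) (at s within {a..b}) \<and> norm (D s) \<le> g s"
    using der by metis
  define f' where "f' s = (if s \<in> N then 0 else D s)" for s
  have 1: "(f' has_integral (f v - f u)) {u..v}"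
  proof (rule abs_cont_on_has_integral[OF abs_cont_on_subinterval[OF ac] _ N])
    fix s assume s: "s \<in> {u..v} - N"
    then have "(f has_vector_derivative f' s) (at s within {a..b})" using D by (auto simp: f'_def)
    then show "(f has_vector_derivative f' s) (at s within {u..v})"
      by (rule has_vector_derivative_within_subset) (use uv in auto)
  qed (use uv in \<open>auto simp: f'_def\<close>)
  have "norm (integral {u..v} f') \<le> integral {u..v} g"
    by (rule integral_norm_bound_integral) (use 1 g D in \<open>auto simp: f'_def\<close>)
  then show ?thesis using 1 by (simp add: integral_unique)
qed

section \<open>The profile of the Carnot-Caratheodory distance\<close>

definition cotk :: "real \<Rightarrow> real" where
  "cotk x = (if x = 0 then 1 else x * cos x / sin x)"

text \<open>The ratio t/|z|^2 at the endpoint of the circular geodesic from the origin whose tangent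
  turns through the angle 2x. At x = 0 division by zero yields 0, the right value for a straight
  segment.\<close>

definition mu :: "real \<Rightarrow> real" where
  "mu x = (x - sin x * cos x) / (sin x)\<^sup>2"

definition dmu :: "real \<Rightarrow> real" where
  "dmu x = (if x = 0 then 2/3 else 2 * (sin x - x * cos x) / (sin x)^3)"

lemma mu_0 [simp]: "mu 0 = 0" by (simp add: mu_def)

lemma mu_minus: "mu (- x) = - mu x" by (simp add: mu_def diff_divide_distrib)

lemma sin_neq_0: "\<bar>x\<bar> < pi \<Longrightarrow> x \<noteq> 0 \<Longrightarrow> sin x \<noteq> 0"
  using sin_gt_zero[of x] sin_gt_zero[of "-x"] by (cases "x > 0") auto

lemma x_cos_less_sin:
  assumes "0 < x" "x < pi" shows "x * cos x < sin x"
proof -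
  have "sin 0 - 0 * cos 0 < sin x - x * cos x"
  proof (rule DERIV_pos_imp_increasing_open[where f = "\<lambda>x. sin x - x * cos x"])
    fix y assume "0 < y" "y < x"
    then have "y * sin y > 0" using assms by (intro mult_pos_pos sin_gt_zero) auto
    then show "\<exists>d. ((\<lambda>x. sin x - x * cos x) has_real_derivative d) (at y) \<and> 0 < d"
      by (intro exI[of _ "y * sin y"]) (auto intro!: derivative_eq_intros)
  qed (use assms in \<open>auto intro!: continuous_intros\<close>)
  then show ?thesis by simp
qed

lemma dmu_minus: "dmu (- x) = dmu x"
  by (simp add: dmu_def power3_eq_cube diff_divide_distrib)

lemma dmu_pos: assumes "\<bar>x\<bar> < pi" shows "dmu x > 0"
proof -
  have "dmu x > 0" if "0 < x" "x < pi" for x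
    using x_cos_less_sin[OF that] sin_gt_zero[OF that] that by (simp add: dmu_def)
  then have "dmu \<bar>x\<bar> > 0" if "x \<noteq> 0" using assms that by simp
  then show ?thesis
    by (cases "x = 0") (auto simp: abs_if dmu_minus dmu_def[of 0] split: if_splits)
qed

lemma DERIV_mu: assumes "\<bar>x\<bar> < pi" shows "DERIV mu x :> dmu x"
proof (cases "x = 0")
  case True
  have "((\<lambda>h::real. (h - sin h * cos h) / (sin h)\<^sup>2 / h) \<longlongrightarrow> 2/3) (at 0)"
    by real_asymp
  then show ?thesis
    unfolding True DERIV_def by (simp add: mu_def dmu_def)
next
  case False
  have s: "sin x \<noteq> 0" using sin_neq_0 assms False by auto
  have c2: "cos x * cos x = 1 - sin x * sin x"
    using sin_cos_squared_add3[of x] by (simp add: algebra_simps)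
  have "DERIV (\<lambda>x. (x - sin x * cos x) / (sin x)\<^sup>2) x :>
      ((1 - (cos x * cos x - sin x * sin x)) * (sin x)\<^sup>2 - (x - sin x * cos x) * (2 * sin x * cos x)) / ((sin x)\<^sup>2 * (sin x)\<^sup>2)"
    using s by (auto intro!: derivative_eq_intros)
  also have "((1 - (cos x * cos x - sin x * sin x)) * (sin x)\<^sup>2 - (x - sin x * cos x) * (2 * sin x * cos x))
      = 2 * sin x * (sin x - x * cos x)"
    unfolding power2_eq_square using c2 by algebra
  also have "\<dots> / ((sin x)\<^sup>2 * (sin x)\<^sup>2) = dmu x"
    using s False by (simp add: dmu_def power2_eq_square power3_eq_cube)
  finally show ?thesis by (simp add: mu_def[abs_def])
qed

lemma isCont_dmu: assumes "\<bar>x\<bar> < pi" shows "isCont dmu x"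
proof (cases "x = 0")
  case True
  have "((\<lambda>h::real. 2 * (sin h - h * cos h) / (sin h)^3) \<longlongrightarrow> 2/3) (at 0)"
    by real_asymp
  then have "(dmu \<longlongrightarrow> 2/3) (at 0)"
    by (rule Lim_transform_eventually) (auto simp: dmu_def eventually_at_filter)
  then show ?thesis unfolding True isCont_def by (simp add: dmu_def)
next
  case False
  have s: "sin x \<noteq> 0" using sin_neq_0 assms False by auto
  have "isCont (\<lambda>x. 2 * (sin x - x * cos x) / (sin x)^3) x"
    using s by (auto intro!: continuous_intros)
  moreover have ev: "eventually (\<lambda>x. 2 * (sin x - x * cos x) / (sin x)^3 = dmu x) (nhds x)"
    using t1_space_nhds[OF False] by eventually_elim (simp add: dmu_def)
  ultimately show ?thesis by (simp only: isCont_cong[OF ev])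
qed

lemma mu_strict_mono: assumes "- pi < x" "x < y" "y < pi" shows "mu x < mu y"
proof (rule DERIV_pos_imp_increasing[OF assms(2)])
  fix z assume "x \<le> z" "z \<le> y"
  then have "\<bar>z\<bar> < pi" using assms by auto
  then show "\<exists>d. DERIV mu z :> d \<and> 0 < d" using DERIV_mu dmu_pos by blast
qed

lemma mu_inj: assumes "\<bar>x\<bar> < pi" "\<bar>y\<bar> < pi" "mu x = mu y" shows "x = y"
  using assms mu_strict_mono[of x y] mu_strict_mono[of y x]
  by (cases x y rule: linorder_cases) (auto simp: abs_less_iff)

lemma mu_surj_pos:
  assumes "\<tau> \<ge> 0" shows "\<exists>x. \<bar>x\<bar> < pi \<and> mu x = \<tau>"
proof -
  \<comment> \<open>Near pi the function \<open>mu\<close> behaves like a multiple of 1/sin^2. At pi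
    - y the numerator is at least 1 and the sine at most y, so \<open>mu\<close> is at least 1/y^2
    \<ge> 1/y = \<tau> + 1, which leaves room for the intermediate value theorem.\<close>
  define y where "y = 1 / (\<tau> + 1)"
  have y: "0 < y" "y \<le> 1" using assms by (auto simp: y_def)
  have pi1: "1 \<le> pi / 2" "pi > 2" using pi_gt3 by auto
  have cs: "cos (pi - y) \<le> 0" using y pi1 by (simp add: cos_ge_zero)
  have s: "0 < sin (pi - y)" "sin (pi - y) \<le> y" using y pi1 sin_x_le_x[of y] sin_gt_zero[of y] by auto
  have "\<tau> \<le> 1 / y" using y assms by (simp add: y_def)
  also have "\<dots> \<le> 1 / y\<^sup>2" using y by (simp add: field_simps power2_eq_square)
  also have "\<dots> \<le> 1 / (sin (pi - y))\<^sup>2"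
    using s y by (intro divide_left_mono power_mono) auto
  also have "\<dots> \<le> mu (pi - y)"
    unfolding mu_def
  proof (rule divide_right_mono)
    have "sin (pi - y) * cos (pi - y) \<le> 0" using cs s by (simp add: mult_nonneg_nonpos)
    then show "1 \<le> pi - y - sin (pi - y) * cos (pi - y)" using y pi1 by linarith
  qed simp
  finally have "\<tau> \<le> mu (pi - y)" .
  moreover have "isCont mu x" if "0 \<le> x \<and> x \<le> pi - y" for x
    using DERIV_isCont[OF DERIV_mu, of x] that y by auto
  ultimately have "\<exists>x\<ge>0. x \<le> pi - y \<and> mu x = \<tau>"
    using assms y pi1 by (intro IVT) auto
  then show ?thesis using y by force
qed

lemma mu_surj: "\<exists>x. \<bar>x\<bar> < pi \<and> mu x = \<tau>"
proof (cases "\<tau> \<ge> 0")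
  case False
  then obtain x where "\<bar>x\<bar> < pi" "mu x = - \<tau>" using mu_surj_pos[of "-\<tau>"] by auto
  then show ?thesis by (intro exI[of _ "-x"]) (simp add: mu_minus)
qed (rule mu_surj_pos)

definition mu_inv :: "real \<Rightarrow> real" where
  "mu_inv \<tau> = (SOME x. \<bar>x\<bar> < pi \<and> mu x = \<tau>)"

lemma mu_inv: "\<bar>mu_inv \<tau>\<bar> < pi" "mu (mu_inv \<tau>) = \<tau>"
  using someI_ex[OF mu_surj] unfolding mu_inv_def by auto

lemma mu_inv_mu: "\<bar>x\<bar> < pi \<Longrightarrow> mu_inv (mu x) = x"
  using mu_inj mu_inv by blast

lemma isCont_mu_inv: "isCont mu_inv \<tau>"
proof -
  define x d where "x = mu_inv \<tau>" and "d = (pi - \<bar>mu_inv \<tau>\<bar>) / 2"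
  have x: "\<bar>x\<bar> < pi" "d > 0" using mu_inv(1)[of \<tau>] by (auto simp: x_def d_def)
  have z: "\<bar>z\<bar> < pi" if "\<bar>z - x\<bar> \<le> d" for z
    using that x unfolding d_def x_def[symmetric] by (auto simp: abs_if field_simps split: if_splits)
  have "isCont mu_inv (mu x)"
    by (rule isCont_inverse_function[OF x(2)]) (use z mu_inv_mu DERIV_isCont[OF DERIV_mu] in auto)
  then show ?thesis by (simp add: x_def mu_inv)
qed

lemma DERIV_mu_inv: "DERIV mu_inv \<tau> :> 1 / dmu (mu_inv \<tau>)"
proof -
  have "DERIV mu_inv \<tau> :> inverse (dmu (mu_inv \<tau>))"
    by (rule DERIV_inverse_function[where a = "\<tau> - 1" and b = "\<tau> + 1" and f = mu])
      (use DERIV_mu mu_inv dmu_pos[OF mu_inv(1), of \<tau>] isCont_mu_inv in auto)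
  then show ?thesis by (simp add: inverse_eq_divide)
qed

lemma isCont_dmu_inv: "isCont (\<lambda>\<tau>. 1 / dmu (mu_inv \<tau>)) \<tau>"
proof -
  have "isCont (\<lambda>\<tau>. dmu (mu_inv \<tau>)) \<tau>"
    by (rule isCont_o2[OF isCont_mu_inv isCont_dmu]) (rule mu_inv)
  then show ?thesis
    using dmu_pos[OF mu_inv(1), of \<tau>] by (intro continuous_intros) auto
qed

text \<open>This relation makes x cot x + x \<tau> stationary in x exactly where mu x = \<tau>; it
  ties the lower bound for lengths to the geodesics.\<close>

lemma DERIV_cotk: assumes "\<bar>x\<bar> < pi" shows "DERIV cotk x :> - mu x"
proof (cases "x = 0")
  case True
  have "((\<lambda>h::real. (h * cos h / sin h - 1) / h) \<longlongrightarrow> 0) (at 0)"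
    by real_asymp
  then have "((\<lambda>h. (cotk (0 + h) - cotk 0) / h) \<longlongrightarrow> 0) (at 0)"
    by (rule Lim_transform_eventually) (auto simp: cotk_def eventually_at_filter)
  then show ?thesis unfolding True DERIV_def by simp
next
  case False
  have s: "sin x \<noteq> 0" using sin_neq_0 assms False by auto
  have c2: "cos x * cos x = 1 - sin x * sin x"
    using sin_cos_squared_add3[of x] by (simp add: algebra_simps)
  have "DERIV (\<lambda>x. x * cos x / sin x) x :> ((cos x - x * sin x) * sin x - x * cos x * cos x) / (sin x * sin x)"
    using s by (auto intro!: derivative_eq_intros)
  also have "((cos x - x * sin x) * sin x - x * cos x * cos x) = - (x - sin x * cos x)"
    using c2 by algebra
  finally have "DERIV (\<lambda>x. x * cos x / sin x) x :> - mu x"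
    by (simp add: mu_def power2_eq_square minus_divide_left)
  then show ?thesis
  proof (rule DERIV_cong_ev[THEN iffD1, rotated 3])
    show "eventually (\<lambda>x. x * cos x / sin x = cotk x) (nhds x)"
      using t1_space_nhds[OF False] by eventually_elim (simp add: cotk_def)
  qed simp_all
qed

text \<open>The maximum of x cot x + x \<tau> over |x| < pi, attained at mu x = \<tau> because
  \<open>mu\<close> is increasing. By the envelope principle the derivative in \<tau> is the
  maximiser itself: the terms that contain the derivative of \<open>mu_inv\<close> cancel.\<close>

definition cc_prof :: "real \<Rightarrow> real" where
  "cc_prof \<tau> = cotk (mu_inv \<tau>) + mu_inv \<tau> * \<tau>"

lemma DERIV_cc_prof: "DERIV cc_prof \<tau> :> mu_inv \<tau>"
proof -
  have "DERIV (\<lambda>\<tau>. cotk (mu_inv \<tau>)) \<tau> :> - \<tau> * (1 / dmu (mu_inv \<tau>))"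
    using DERIV_chain2[OF DERIV_cotk[OF mu_inv(1)] DERIV_mu_inv, of \<tau>] by (simp add: mu_inv)
  from DERIV_add[OF this DERIV_mult[OF DERIV_mu_inv DERIV_ident, of \<tau>]]
  show ?thesis unfolding cc_prof_def[abs_def] by simp
qed

definition xsin :: "real \<Rightarrow> real" where
  "xsin x = (if x = 0 then 1 else x / sin x)"

lemma cotk_add_mu: assumes "\<bar>x\<bar> < pi" shows "cotk x + x * mu x = (xsin x)\<^sup>2"
proof (cases "x = 0")
  case False
  have s: "sin x \<noteq> 0" using sin_neq_0 assms False by auto
  then show ?thesis using False
    by (simp add: cotk_def mu_def xsin_def field_simps power2_eq_square)
qed (simp add: cotk_def xsin_def)

lemma cc_prof_eq: "cc_prof \<tau> = (xsin (mu_inv \<tau>))\<^sup>2"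
  using cotk_add_mu[OF mu_inv(1), of \<tau>] by (simp add: cc_prof_def mu_inv)

lemma xsin_ge_1: assumes "\<bar>x\<bar> < pi" shows "xsin x \<ge> 1"
proof -
  have "1 \<le> y / sin y" if "0 < y" "y < pi" for y :: real
    using sin_x_le_x[of y] sin_gt_zero[OF that] that by (simp add: field_simps)
  from this[of "\<bar>x\<bar>"] assms show ?thesis by (auto simp: xsin_def abs_if split: if_splits)
qed

lemma cc_prof_ge_1: "cc_prof \<tau> \<ge> 1"
  unfolding cc_prof_eq using xsin_ge_1[OF mu_inv(1)] by (simp add: one_le_power)

lemma abs_diff_sin_le: "\<bar>x - sin x\<bar> \<le> x\<^sup>2 / 2" for x :: real
  using Maclaurin_sin_bound[of x 2]
  by (simp add: numeral_2_eq_2 sin_coeff_def abs_minus_commute)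

text \<open>In the parameter x the claim is |x - sin x cos x| \<le> x^2, that is, |y - sin y| \<le>
  y^2/2 at y = 2x. It bounds the squared distance from below by |t|, also close to the axis where
  |z|^2 is no help.\<close>

lemma cc_prof_ge_abs: "\<bar>\<tau>\<bar> \<le> cc_prof \<tau>"
proof -
  define x where "x = mu_inv \<tau>"
  have x: "\<bar>x\<bar> < pi" "\<tau> = mu x" by (simp_all add: x_def mu_inv)
  show ?thesis
  proof (cases "x = 0")
    case True then show ?thesis using x cc_prof_ge_1[of \<tau>] by simp
  next
    case False
    have s: "sin x \<noteq> 0" using sin_neq_0 x False by auto
    have "\<bar>x - sin x * cos x\<bar> = \<bar>2 * x - sin (2 * x)\<bar> / 2" by (simp add: sin_double abs_if)
    also have "\<dots> \<le> x\<^sup>2" using abs_diff_sin_le[of "2 * x"] by (simp add: power2_eq_square)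
    finally have "\<bar>x - sin x * cos x\<bar> / (sin x)\<^sup>2 \<le> x\<^sup>2 / (sin x)\<^sup>2" by (intro divide_right_mono) auto
    then show ?thesis unfolding cc_prof_eq x_def[symmetric] using False
      by (simp add: x(2) mu_def xsin_def power_divide)
  qed
qed

lemma cotk_le_1: assumes "\<bar>x\<bar> < pi" shows "cotk x \<le> 1"
proof -
  have "y * cos y / sin y \<le> 1" if "0 < y" "y < pi" for y :: real
    using x_cos_less_sin[OF that] sin_gt_zero[OF that] by (simp add: field_simps)
  from this[of "\<bar>x\<bar>"] assms show ?thesis by (auto simp: cotk_def abs_if split: if_splits)
qed

lemma cc_prof_le: "cc_prof \<tau> \<le> 1 + 4 * \<bar>\<tau>\<bar>"
proof -
  have "mu_inv \<tau> * \<tau> \<le> \<bar>mu_inv \<tau>\<bar> * \<bar>\<tau>\<bar>" by (metis abs_ge_self abs_mult)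
  also have "\<dots> \<le> 4 * \<bar>\<tau>\<bar>" using mu_inv(1)[of \<tau>] pi_less_4 by (intro mult_right_mono) auto
  finally show ?thesis using cotk_le_1[OF mu_inv(1), of \<tau>] by (simp add: cc_prof_def)
qed

section \<open>Lower bound for the length of horizontal curves\<close>

text \<open>The complex structure behind the group law: the horizontal vector at (z,t) with
  z-component h has t-component 2 (h . J z).\<close>

definition symJ :: "'a::real_inner \<times> 'a \<Rightarrow> 'a \<times> 'a" where
  "symJ z = (snd z, - fst z)"

lemma inner_symJ_self [simp]: "z \<bullet> symJ z = 0" "symJ z \<bullet> z = 0"
  by (simp_all add: symJ_def inner_prod_def inner_commute)

lemma norm_symJ [simp]: "norm (symJ z) = norm z"
  by (simp add: symJ_def norm_prod_def add.commute)

lemma symJ_symJ [simp]: "symJ (symJ z) = - z"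
  by (simp add: symJ_def prod_eq_iff)

lemma inner_symJ_symJ [simp]: "symJ z \<bullet> symJ w = z \<bullet> w"
  by (simp add: symJ_def inner_prod_def add.commute)

lemma symJ_zero [simp]: "symJ 0 = 0"
  by (simp add: symJ_def prod_eq_iff)

lemma symJ_diff: "symJ (x - y) = symJ x - symJ y"
  by (simp add: symJ_def prod_eq_iff)

lemma bounded_linear_symJ: "bounded_linear symJ"
proof (rule bounded_linear_intro[where K = 1])
  show "symJ (x + y) = symJ x + symJ y" for x y :: "'a \<times> 'a" by (simp add: symJ_def prod_eq_iff)
  show "symJ (r *\<^sub>R x) = r *\<^sub>R symJ x" for r and x :: "'a \<times> 'a" by (simp add: symJ_def prod_eq_iff)
qed simp

lemma symJ_linear:
  "symJ (x + y) = symJ x + symJ y" "symJ (r *\<^sub>R x) = r *\<^sub>R symJ x"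
  by (simp_all add: symJ_def prod_eq_iff)

lemma symJ_sum_components:
  fixes h z :: "(real^'n) \<times> (real^'n)"
  shows "(\<Sum>i\<in>UNIV. fst h $ i * snd z $ i - snd h $ i * fst z $ i) = h \<bullet> symJ z"
  by (simp add: symJ_def inner_prod_def inner_vec_def sum_subtractf sum_negf)

lemma horizontal_with_symJ:
  "horizontal_with \<gamma> h \<longleftrightarrow> abs_cont_on 0 1 \<gamma> \<and>
     (AE s in lborel. s \<in> {0..1} \<longrightarrow>
        (\<gamma> has_vector_derivative (h s, 2 * (h s \<bullet> symJ (fst (\<gamma> s))))) (at s within {0..1}))"
  unfolding horizontal_with_def symJ_sum_components by simp

text \<open>All that the length estimate needs to know about a horizontal curve, with the
  differential equation replaced by increments. \<open>len\<close> is the length travelled so far.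
  To first order t grows by 2 (dz . J z), and the error is quadratic in the length because z itself
  moves by no more than the length.\<close>

lemma horizontal_increments:
  fixes \<gamma> :: "real \<Rightarrow> 'n::finite heis"
  assumes hor: "horizontal_with \<gamma> h"
    and L: "(\<integral>\<^sup>+ s. ennreal (norm (h s)) * indicator {0..1} s \<partial>lborel) = ennreal L" "L \<ge> 0"
  obtains len :: "real \<Rightarrow> real" where "continuous_on {0..1} len" "len 0 = 0" "len 1 = L"
    "\<And>u v. 0 \<le> u \<Longrightarrow> u \<le> v \<Longrightarrow> v \<le> 1 \<Longrightarrow> len u \<le> len v \<and> norm (fst (\<gamma> v) - fst (\<gamma> u)) \<le> len v - len u \<and>
       \<bar>snd (\<gamma> v) - snd (\<gamma> u) - 2 * ((fst (\<gamma> v) - fst (\<gamma> u)) \<bullet> symJ (fst (\<gamma> u)))\<bar> \<le> 2 * (len v - len u)\<^sup>2"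
proof -
  have ac: "abs_cont_on 0 1 \<gamma>" and
    ae: "AE s in lborel. s \<in> {0..1} \<longrightarrow>
        (\<gamma> has_vector_derivative (h s, 2 * (h s \<bullet> symJ (fst (\<gamma> s))))) (at s within {0..1})"
    using hor by (simp_all add: horizontal_with_symJ)
  from ae[unfolded eventually_ae_filter] obtain N where N: "N \<in> null_sets lborel"
    and sub: "{s \<in> space lborel. \<not> (s \<in> {0..1} \<longrightarrow>
      (\<gamma> has_vector_derivative (h s, 2 * (h s \<bullet> symJ (fst (\<gamma> s))))) (at s within {0..1}))} \<subseteq> N"
    by (elim bexE) (rule that)
  have der: "(\<gamma> has_vector_derivative (h s, 2 * (h s \<bullet> symJ (fst (\<gamma> s))))) (at s within {0..1})"
    if "s \<in> {0..1} - N" for s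
  proof (rule ccontr)
    assume "\<not> ?thesis"
    then have "s \<in> N" using that by (intro subsetD[OF sub]) simp
    then show False using that by simp
  qed
  have negN: "negligible N"
    using null_sets_completionI[OF N] by (simp only: negligible_iff_null_sets)
  \<comment> \<open>With the value 0 on the null set, \<open>D\<close> is Henstock-Kurzweil
    integrable with the increment of the curve as its integral. This yields the measurability of the
    speed \<open>k\<close>, which \<open>horizontal_with\<close> does not provide for h.\<close>
  define D where "D s = (if s \<in> N then 0 else (h s, 2 * (h s \<bullet> symJ (fst (\<gamma> s)))))" for s
  define k where "k s = norm (fst (D s))" for s
  have derD: "(\<gamma> has_vector_derivative D s) (at s within {0..1})" if "s \<in> {0..1} - N" for s
  proof -
    have "D s = (h s, 2 * (h s \<bullet> symJ (fst (\<gamma> s))))" using that by (simp add: D_def)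
    then show ?thesis using der[OF that] by (simp only:)
  qed
  have "D s = 0" if "s \<in> N" for s using that by (simp add: D_def)
  then have D_int: "(D has_integral (\<gamma> 1 - \<gamma> 0)) {0..1}"
    by (intro abs_cont_on_has_integral[OF ac _ negN derD]) simp_all
  have "(\<lambda>s. fst (D s)) integrable_on {0..1}"
    using D_int integrable_linear[OF _ bounded_linear_fst, of D "{0..1}"] by (auto simp: o_def)
  then have "(\<lambda>s. fst (D s)) \<in> borel_measurable (lebesgue_on {0..1})"
    by (rule integrable_imp_measurable)
  then have meas: "k \<in> borel_measurable (lebesgue_on {0..1})"
    unfolding k_def by measurable
  have nn: "(\<integral>\<^sup>+ s. ennreal (k s) \<partial>lebesgue_on {0..1}) = ennreal L"
  proof -
    have "(\<integral>\<^sup>+ s. ennreal (k s) \<partial>lebesgue_on {0..1}) = (\<integral>\<^sup>+ s. ennreal (k s) * indicator {0..1} s \<partial>lebesgue)"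
      by (subst nn_integral_restrict_space) auto
    also have "\<dots> = (\<integral>\<^sup>+ s. ennreal (k s) * indicator {0..1} s \<partial>lborel)"
      by (rule nn_integral_completion)
    also have "\<dots> = (\<integral>\<^sup>+ s. ennreal (norm (h s)) * indicator {0..1} s \<partial>lborel)"
      by (rule nn_integral_cong_AE) (use AE_not_in[OF N] in eventually_elim, simp add: k_def D_def)
    finally show ?thesis using L by simp
  qed
  have kint: "integrable (lebesgue_on {0..1}) k"
    using meas nn by (intro integrableI_nonneg) (auto simp: k_def)
  have kon: "k integrable_on {0..1}"
    using kint by (rule integrable_on_lebesgue_on) simp
  have kL: "integral {0..1} k = L"
  proof -
    have "integral\<^sup>L (lebesgue_on {0..1}) k = L"
      using meas nn L by (intro integral_eq_nn_integral[THEN trans]) (auto simp: k_def)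
    then show ?thesis using lebesgue_integral_eq_integral[OF kint] by simp
  qed
  have ksub: "k integrable_on {u..v}" if "0 \<le> u" "v \<le> 1" for u v
    using integrable_subinterval_real[OF kon] that by auto
  define len where "len s = integral {0..s} k" for s
  have inc: "integral {u..v} k = len v - len u" if "0 \<le> u" "u \<le> v" "v \<le> 1" for u v
    using Henstock_Kurzweil_Integration.integral_combine[of 0 u v k] ksub[of 0 v] that by (simp add: len_def)
  have knn: "k s \<ge> 0" for s by (simp add: k_def)
  have mono: "len u \<le> len v" if "0 \<le> u" "u \<le> v" "v \<le> 1" for u v
    using inc[OF that] integral_nonneg[OF ksub[of u v]] that knn by auto
  have z: "norm (fst (\<gamma> v) - fst (\<gamma> u)) \<le> len v - len u" if uv: "0 \<le> u" "u \<le> v" "v \<le> 1" for u v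
    unfolding inc[OF uv, symmetric]
  proof (rule abs_cont_on_norm_diff_le[where N = N and a = 0 and b = 1])
    show "abs_cont_on 0 1 (\<lambda>s. fst (\<gamma> s))"
      by (rule abs_cont_on_Lipschitz_image[OF ac, where C = 1]) (simp add: dist_fst_le)
    fix s assume s: "s \<in> {u..v} - N"
    have "((\<lambda>s. fst (\<gamma> s)) has_vector_derivative fst (D s)) (at s within {0..1})"
      by (rule bounded_linear.has_vector_derivative[OF bounded_linear_fst derD]) (use s uv in auto)
    then show "\<exists>D. ((\<lambda>s. fst (\<gamma> s)) has_vector_derivative D) (at s within {0..1}) \<and> norm D \<le> k s"
      by (intro exI[of _ "fst (D s)"]) (simp add: k_def)
  qed (use uv ksub negN knn in auto)
  have t: "\<bar>snd (\<gamma> v) - snd (\<gamma> u) - 2 * ((fst (\<gamma> v) - fst (\<gamma> u)) \<bullet> symJ (fst (\<gamma> u)))\<bar> \<le> 2 * (len v - len u)\<^sup>2"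
    if uv: "0 \<le> u" "u \<le> v" "v \<le> 1" for u v
  proof -
    \<comment> \<open>\<open>F\<close> subtracts the first-order part of the vertical increment.
      Along the curve its derivative is 2 (h . J (z_s - z_u)), bounded by 2 |h| times the length of
      the arc from u.\<close>
    define F where "F P = snd P - 2 * (fst P \<bullet> symJ (fst (\<gamma> u)))" for P :: "'n heis"
    have F: "bounded_linear F" unfolding F_def
      by (intro bounded_linear_sub bounded_linear_snd
          bounded_linear_compose[OF bounded_linear_mult_right]
          bounded_linear_compose[OF bounded_linear_inner_left bounded_linear_fst])
    obtain C where C: "\<And>P. norm (F P) \<le> norm P * C" using bounded_linear.bounded[OF F] by auto
    have "norm (F (\<gamma> v) - F (\<gamma> u)) \<le> integral {u..v} (\<lambda>s. 2 * (len v - len u) * k s)"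
    proof (rule abs_cont_on_norm_diff_le[where N = N and a = 0 and b = 1])
      show "abs_cont_on 0 1 (\<lambda>s. F (\<gamma> s))"
        by (rule abs_cont_on_Lipschitz_image[OF ac, where C = C])
           (use C in \<open>simp add: dist_norm linear_diff[OF bounded_linear.linear[OF F], symmetric] mult.commute\<close>)
      fix s assume s: "s \<in> {u..v} - N"
      have 1: "((\<lambda>s. F (\<gamma> s)) has_vector_derivative F (D s)) (at s within {0..1})"
        by (rule bounded_linear.has_vector_derivative[OF F derD]) (use s uv in auto)
      have "F (D s) = 2 * (h s \<bullet> symJ (fst (\<gamma> s) - fst (\<gamma> u)))"
        using s by (simp add: F_def D_def symJ_diff inner_diff_right)
      then have "norm (F (D s)) \<le> 2 * (norm (h s) * norm (fst (\<gamma> s) - fst (\<gamma> u)))"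
        using Cauchy_Schwarz_ineq2[of "h s" "symJ (fst (\<gamma> s) - fst (\<gamma> u))"] by simp
      also have "\<dots> \<le> 2 * (norm (h s) * (len v - len u))"
        using z[of u s] mono[of s v] s uv by (intro mult_left_mono) auto
      also have "\<dots> = 2 * (len v - len u) * k s" using s by (simp add: k_def D_def)
      finally show "\<exists>D. ((\<lambda>s. F (\<gamma> s)) has_vector_derivative D) (at s within {0..1}) \<and> norm D \<le> 2 * (len v - len u) * k s"
        using 1 by blast
    next
      show "(\<lambda>s. 2 * (len v - len u) * k s) integrable_on {u..v}"
        using ksub[of u v] uv by (intro integrable_on_mult_right) auto
    qed (use uv negN knn mono[OF uv] in auto)
    also have "\<dots> = 2 * (len v - len u)\<^sup>2" using inc[OF uv] by (simp add: power2_eq_square)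
    finally show ?thesis
      by (simp add: F_def inner_diff_left algebra_simps)
  qed
  show thesis
  proof (rule that)
    show "continuous_on {0..1} len"
      unfolding len_def using indefinite_integral_continuous_1[OF kon] by simp
    show "len 0 = 0" "len 1 = L" using kL by (simp_all add: len_def)
    show "len u \<le> len v \<and> norm (fst (\<gamma> v) - fst (\<gamma> u)) \<le> len v - len u \<and>
       \<bar>snd (\<gamma> v) - snd (\<gamma> u) - 2 * ((fst (\<gamma> v) - fst (\<gamma> u)) \<bullet> symJ (fst (\<gamma> u)))\<bar> \<le> 2 * (len v - len u)\<^sup>2"
      if "0 \<le> u" "u \<le> v" "v \<le> 1" for u v
      using mono[OF that] z[OF that] t[OF that] by (intro conjI)
  qed
qed

text \<open>To be applied with $c = c_{i+1}$, $c' = c_i$, where the weights $c_i = \kappa \cot (\kappa i / N)$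
  solve the hypothesis exactly for $K = c_1$. Completing the square then costs $K |\zeta|^2$ per step, with no
  discretisation error.\<close>

lemma discrete_riccati_step:
  fixes z \<zeta> :: "'a::real_inner \<times> 'a"
  assumes "c' - c > 0" "K - c > 0" and ric: "(c' - c) * (K - c) = c\<^sup>2 + \<kappa>\<^sup>2" and sg: "\<bar>\<sigma>\<bar> = 1"
  shows "c * (norm (z + \<zeta>))\<^sup>2 + 2 * \<sigma> * \<kappa> * (\<zeta> \<bullet> symJ z) \<le> c' * (norm z)\<^sup>2 + K * (norm \<zeta>)\<^sup>2"
proof -
  define w where "w = c *\<^sub>R z + (\<sigma> * \<kappa>) *\<^sub>R symJ z"
  have sg2: "\<sigma>\<^sup>2 = 1" using sg by (metis abs_1 power2_abs one_power2)
  have w: "w \<bullet> w = (c\<^sup>2 + \<kappa>\<^sup>2) * (z \<bullet> z)"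
    unfolding w_def using sg2 by (simp add: inner_add_left inner_add_right power2_eq_square algebra_simps)
  define e where "e = K - c"
  have e: "e > 0" using assms(2) by (simp add: e_def)
  have "0 \<le> (e *\<^sub>R \<zeta> - w) \<bullet> (e *\<^sub>R \<zeta> - w)" by simp
  also have "\<dots> = e * (e * (\<zeta> \<bullet> \<zeta>) - 2 * (\<zeta> \<bullet> w)) + w \<bullet> w"
    by (simp add: inner_diff_left inner_diff_right inner_commute algebra_simps)
  also have "w \<bullet> w = e * ((c' - c) * (z \<bullet> z))"
    unfolding w ric[symmetric] e_def by simp
  finally have "0 \<le> e * (e * (\<zeta> \<bullet> \<zeta>) - 2 * (\<zeta> \<bullet> w) + (c' - c) * (z \<bullet> z))"
    by (simp add: algebra_simps)
  then have "0 \<le> e * (\<zeta> \<bullet> \<zeta>) - 2 * (\<zeta> \<bullet> w) + (c' - c) * (z \<bullet> z)"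
    using e by (simp add: zero_le_mult_iff)
  then show ?thesis
    unfolding power2_norm_eq_inner w_def e_def
    by (simp add: inner_add_left inner_add_right inner_commute algebra_simps)
qed

text \<open>In the continuous picture kappa cot (kappa s) |z|^2 + sigma kappa t grows at a rate of
  at most |h|^2: with w = kappa cot (kappa s) z + sigma kappa J z the rate is 2 h . w - |w|^2. Here
  the same is done along N steps of length at most \<epsilon>. A step costs K \<epsilon>^2 from the
  Riccati step and 2 \<kappa> \<epsilon>^2 from the error in t. For \<epsilon> = L/N the total tends
  to L^2, since K/N tends to 1. The sign \<sigma> reduces negative x to \<kappa> = |x|.\<close>

lemma discrete_calibration:
  fixes z :: "nat \<Rightarrow> 'a::real_inner \<times> 'a" and t :: "nat \<Rightarrow> real"
  assumes \<kappa>: "0 < \<kappa>" "\<kappa> < pi" and N: "N \<ge> 2" and sg: "\<bar>\<sigma>\<bar> = 1"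
    and z0: "z 0 = 0" "t 0 = 0" and \<epsilon>: "\<epsilon> \<ge> 0"
    and z: "\<And>i. i < N \<Longrightarrow> norm (z (Suc i) - z i) \<le> \<epsilon>"
    and t: "\<And>i. i < N \<Longrightarrow> \<bar>t (Suc i) - t i - 2 * ((z (Suc i) - z i) \<bullet> symJ (z i))\<bar> \<le> 2 * \<epsilon>\<^sup>2"
  defines "K \<equiv> \<kappa> * cos (\<kappa> / N) / sin (\<kappa> / N)"
  shows "\<kappa> * cos \<kappa> / sin \<kappa> * (norm (z N))\<^sup>2 + \<sigma> * \<kappa> * t N \<le> N * \<epsilon>\<^sup>2 * (K + 2 * \<kappa>)"
proof -
  define c where "c i = \<kappa> * cos (\<kappa> * real i / N) / sin (\<kappa> * real i / N)" for i :: nat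
  have N0: "real N > 0" using N by simp
  \<comment> \<open>N \<ge> 2 puts \<kappa>/N below pi/2, which makes \<open>K\<close> positive; the
    cost K |\<zeta>|^2 of a step is then at most K \<epsilon>^2.\<close>
  have B: "0 < \<kappa> / N" "\<kappa> / N < pi / 2"
  proof -
    have "\<kappa> / N \<le> \<kappa> / 2" using N \<kappa> by (intro divide_left_mono) auto
    then show "\<kappa> / N < pi / 2" using \<kappa> by linarith
  qed (use \<kappa> N0 in auto)
  have sB: "sin (\<kappa> / N) > 0" using B pi_gt_zero by (intro sin_gt_zero) linarith+
  have K: "K > 0" unfolding K_def using cos_gt_zero[OF B] sB \<kappa> by simp
  have sA: "sin (\<kappa> * real i / N) > 0" if "0 < i" "i \<le> N" for i
  proof (rule sin_gt_zero)
    show "0 < \<kappa> * real i / N" using that \<kappa> N0 by simp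
    have "\<kappa> * real i / N \<le> \<kappa>" using that \<kappa> N0 by (simp add: field_simps)
    then show "\<kappa> * real i / N < pi" using \<kappa> by simp
  qed
  have tb: "\<sigma> * \<kappa> * t (Suc i) \<le> \<sigma> * \<kappa> * t i + 2 * \<sigma> * \<kappa> * ((z (Suc i) - z i) \<bullet> symJ (z i)) + 2 * \<kappa> * \<epsilon>\<^sup>2"
    if "i < N" for i
  proof -
    have "\<sigma> * (t (Suc i) - t i - 2 * ((z (Suc i) - z i) \<bullet> symJ (z i))) \<le> 2 * \<epsilon>\<^sup>2"
      using t[OF that] abs_ge_self[of "\<sigma> * (t (Suc i) - t i - 2 * ((z (Suc i) - z i) \<bullet> symJ (z i)))"]
      by (simp add: abs_mult sg)
    from mult_left_mono[OF this, of \<kappa>] show ?thesis using \<kappa> by (simp add: algebra_simps)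
  qed
  have ind: "c (Suc i) * (norm (z (Suc i)))\<^sup>2 + \<sigma> * \<kappa> * t (Suc i) \<le> (Suc i) * (\<epsilon>\<^sup>2 * (K + 2 * \<kappa>))"
    if "Suc i \<le> N" for i
    using that
  proof (induction i)
    \<comment> \<open>The induction starts from index 1, where the weight is \<open>K\<close>: the
      cotangent is singular at index 0, but z 0 = 0, so the first step is bounded directly.\<close>
    case 0
    have c1: "c (Suc 0) = K" by (simp add: c_def K_def)
    have "norm (z (Suc 0)) \<le> \<epsilon>" using z[of 0] N z0 by simp
    then have "(norm (z (Suc 0)))\<^sup>2 \<le> \<epsilon>\<^sup>2" by (simp add: power_mono)
    then have "K * (norm (z (Suc 0)))\<^sup>2 \<le> K * \<epsilon>\<^sup>2" using K by simp
    moreover have "\<sigma> * \<kappa> * t (Suc 0) \<le> 2 * \<kappa> * \<epsilon>\<^sup>2" using tb[of 0] N z0 by simp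
    ultimately show ?case using c1 by (simp add: algebra_simps)
  next
    case (Suc i)
    define A B' where "A = \<kappa> * real (Suc (Suc i)) / N" and "B' = \<kappa> * real (Suc i) / N"
    have AB: "A - B' = \<kappa> / N" by (simp add: A_def B'_def add_divide_distrib distrib_left)
    have pA: "sin A > 0" "sin B' > 0" using sA[of "Suc (Suc i)"] sA[of "Suc i"] Suc.prems by (auto simp: A_def B'_def)
    have cc: "c (Suc (Suc i)) = \<kappa> * cos A / sin A" "c (Suc i) = \<kappa> * cos B' / sin B'"
      by (simp_all add: c_def A_def B'_def)
    have 1: "c (Suc i) - c (Suc (Suc i)) = \<kappa> * sin (\<kappa> / N) / (sin A * sin B')"
      unfolding cc AB[symmetric] using pA by (simp add: sin_diff field_simps)
    have KB: "K = \<kappa> * cos (A - B') / sin (A - B')" by (simp add: K_def AB)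
    have sAB: "sin (A - B') > 0" using sB AB by simp
    have id: "cos (A - B') * sin A - cos A * sin (A - B') = sin B'"
      using sin_diff[of A "A - B'"] by (simp add: algebra_simps)
    have 2: "K - c (Suc (Suc i)) = \<kappa> * sin B' / (sin A * sin (\<kappa> / N))"
      unfolding cc KB AB[symmetric] id[symmetric] using pA sAB by (simp add: field_simps)
    have "(c (Suc i) - c (Suc (Suc i))) * (K - c (Suc (Suc i))) = \<kappa>\<^sup>2 / (sin A)\<^sup>2"
      unfolding 1 2 using pA sB by (simp add: power2_eq_square)
    also have "\<dots> = (c (Suc (Suc i)))\<^sup>2 + \<kappa>\<^sup>2"
    proof -
      have c2: "(cos A)\<^sup>2 = 1 - (sin A)\<^sup>2" by (rule cos_squared_eq)
      show ?thesis unfolding cc power_divide power_mult_distrib c2 using pA by (simp add: field_simps)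
    qed
    finally have ric: "(c (Suc i) - c (Suc (Suc i))) * (K - c (Suc (Suc i))) = (c (Suc (Suc i)))\<^sup>2 + \<kappa>\<^sup>2" .
    define \<zeta> where "\<zeta> = z (Suc (Suc i)) - z (Suc i)"
    have zz: "z (Suc (Suc i)) = z (Suc i) + \<zeta>" by (simp add: \<zeta>_def)
    have "c (Suc (Suc i)) * (norm (z (Suc i) + \<zeta>))\<^sup>2 + 2 * \<sigma> * \<kappa> * (\<zeta> \<bullet> symJ (z (Suc i)))
        \<le> c (Suc i) * (norm (z (Suc i)))\<^sup>2 + K * (norm \<zeta>)\<^sup>2"
      by (rule discrete_riccati_step[OF _ _ ric sg]) (use 1 2 pA sB \<kappa> in auto)
    moreover have "K * (norm \<zeta>)\<^sup>2 \<le> K * \<epsilon>\<^sup>2"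
      using z[of "Suc i"] Suc.prems K by (simp add: \<zeta>_def power_mono)
    ultimately have "c (Suc (Suc i)) * (norm (z (Suc (Suc i))))\<^sup>2 + 2 * \<sigma> * \<kappa> * (\<zeta> \<bullet> symJ (z (Suc i)))
        \<le> c (Suc i) * (norm (z (Suc i)))\<^sup>2 + K * \<epsilon>\<^sup>2" unfolding zz by linarith
    then have "c (Suc (Suc i)) * (norm (z (Suc (Suc i))))\<^sup>2 + \<sigma> * \<kappa> * t (Suc (Suc i))
        \<le> (c (Suc i) * (norm (z (Suc i)))\<^sup>2 + \<sigma> * \<kappa> * t (Suc i)) + \<epsilon>\<^sup>2 * (K + 2 * \<kappa>)"
      using tb[of "Suc i"] Suc.prems unfolding \<zeta>_def[symmetric] by (simp add: algebra_simps)
    also have "\<dots> \<le> real (Suc i) * (\<epsilon>\<^sup>2 * (K + 2 * \<kappa>)) + \<epsilon>\<^sup>2 * (K + 2 * \<kappa>)"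
      using Suc.IH Suc.prems by simp
    also have "\<dots> = real (Suc (Suc i)) * (\<epsilon>\<^sup>2 * (K + 2 * \<kappa>))" by (simp add: distrib_right)
    finally show ?case .
  qed
  have "c N = \<kappa> * cos \<kappa> / sin \<kappa>" using N0 by (simp add: c_def)
  then show ?thesis using ind[of "N - 1"] N by (simp add: mult.assoc)
qed

text \<open>The curve is cut into N pieces of equal length L/N, \<open>discrete_calibration\<close>
  is applied to the division points, and N tends to infinity; \<kappa>/N cot (\<kappa>/N) tends to
  1. For L = 0 such pieces would not determine the order of the division points, but then P =
  0.\<close>

lemma horizontal_length_lower_bound:
  fixes \<gamma> :: "real \<Rightarrow> 'n::finite heis"
  assumes hor: "horizontal_with \<gamma> h" and \<gamma>: "\<gamma> 0 = 0" "\<gamma> 1 = P"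
    and L: "(\<integral>\<^sup>+ s. ennreal (norm (h s)) * indicator {0..1} s \<partial>lborel) = ennreal L" "L \<ge> 0"
    and x: "\<bar>x\<bar> < pi"
  shows "cotk x * (norm (fst P))\<^sup>2 + x * snd P \<le> L\<^sup>2"
proof -
  obtain len where len: "continuous_on {0..1} len" "len 0 = 0" "len 1 = L" and
    inc: "\<And>u v. 0 \<le> u \<Longrightarrow> u \<le> v \<Longrightarrow> v \<le> 1 \<Longrightarrow> len u \<le> len v \<and> norm (fst (\<gamma> v) - fst (\<gamma> u)) \<le> len v - len u \<and>
       \<bar>snd (\<gamma> v) - snd (\<gamma> u) - 2 * ((fst (\<gamma> v) - fst (\<gamma> u)) \<bullet> symJ (fst (\<gamma> u)))\<bar> \<le> 2 * (len v - len u)\<^sup>2"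
    using horizontal_increments[OF hor L] by blast
  have base: "norm (fst P) \<le> L" "\<bar>snd P\<bar> \<le> 2 * L\<^sup>2"
    using inc[of 0 1] \<gamma> len by auto
  have base2: "(norm (fst P))\<^sup>2 \<le> L\<^sup>2" using base by (simp add: power_mono)
  consider "x = 0" | "L = 0" | "x \<noteq> 0" "L > 0" using L(2) by linarith
  then show ?thesis
  proof cases
    case 1 then show ?thesis using base2 by (simp add: cotk_def)
  next
    case 2 then show ?thesis using base by auto
  next
    case 3
    define \<kappa> \<sigma> where "\<kappa> = \<bar>x\<bar>" and "\<sigma> = sgn x"
    have \<kappa>: "0 < \<kappa>" "\<kappa> < pi" "\<bar>\<sigma>\<bar> = 1" and x\<kappa>: "x = \<sigma> * \<kappa>" using 3 x
      by (auto simp: \<kappa>_def \<sigma>_def sgn_if abs_if)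
    have ck: "cotk x = \<kappa> * cos \<kappa> / sin \<kappa>" using 3 by (auto simp: cotk_def \<kappa>_def abs_if)
    have bd: "cotk x * (norm (fst P))\<^sup>2 + x * snd P \<le>
        L\<^sup>2 * (\<kappa> / real N * cos (\<kappa> / real N) / sin (\<kappa> / real N) + 2 * \<kappa> / real N)" if N: "N \<ge> 2" for N
    proof -
      \<comment> \<open>\<open>len\<close> may be constant on intervals, so its values 0 and L do
        not single out the endpoints; they are prescribed, because the values of the curve at 0 and
        1 are what is known.\<close>
      have "\<exists>s. 0 \<le> s \<and> s \<le> 1 \<and> len s = real i * L / N \<and> (i = 0 \<longrightarrow> s = 0) \<and> (i = N \<longrightarrow> s = 1)" if "i \<le> N" for i
      proof -
        have "real i * L / N \<le> L" using mult_right_mono[of "real i" "real N" L] that L N by (simp add: field_simps)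
        then have ex: "\<exists>s\<ge>0. s \<le> 1 \<and> len s = real i * L / N"
          using len L by (intro IVT') auto
        show ?thesis
        proof (cases "i = 0 \<or> i = N")
          case True
          then show ?thesis
          proof
            assume "i = 0" then show ?thesis using len N by (intro exI[of _ 0]) simp
          next
            assume "i = N" then show ?thesis using len N by (intro exI[of _ 1]) simp
          qed
        next
          case False then show ?thesis using ex by auto
        qed
      qed
      then obtain s where s: "\<And>i. i \<le> N \<Longrightarrow> 0 \<le> s i \<and> s i \<le> 1 \<and> len (s i) = real i * L / N
          \<and> (i = 0 \<longrightarrow> s i = 0) \<and> (i = N \<longrightarrow> s i = 1)" by metis
      have N0: "real N > 0" using N by simp
      have step: "len (s (Suc i)) - len (s i) = L / N" if "i < N" for i
        using s[of i] s[of "Suc i"] that N0 by (simp add: field_simps)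
      have ord: "s i \<le> s (Suc i)" if "i < N" for i
      proof (rule ccontr)
        assume "\<not> s i \<le> s (Suc i)"
        then have "len (s (Suc i)) \<le> len (s i)" using inc[of "s (Suc i)" "s i"] s[of i] s[of "Suc i"] that by auto
        moreover have "L / N > 0" using 3 N0 by simp
        ultimately show False using step[OF that] by linarith
      qed
      have "\<kappa> * cos \<kappa> / sin \<kappa> * (norm (fst (\<gamma> (s N))))\<^sup>2 + \<sigma> * \<kappa> * snd (\<gamma> (s N))
          \<le> N * (L / N)\<^sup>2 * (\<kappa> * cos (\<kappa> / N) / sin (\<kappa> / N) + 2 * \<kappa>)"
      proof (rule discrete_calibration[OF \<kappa>(1,2) N \<kappa>(3), of "\<lambda>i. fst (\<gamma> (s i))" "\<lambda>i. snd (\<gamma> (s i))"])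
        fix i assume i: "i < N"
        have "0 \<le> s i" "s (Suc i) \<le> 1" using s[of i] s[of "Suc i"] i by auto
        from inc[OF this(1) ord[OF i] this(2)] step[OF i]
        show "norm (fst (\<gamma> (s (Suc i))) - fst (\<gamma> (s i))) \<le> L / N"
          "\<bar>snd (\<gamma> (s (Suc i))) - snd (\<gamma> (s i)) - 2 * ((fst (\<gamma> (s (Suc i))) - fst (\<gamma> (s i))) \<bullet> symJ (fst (\<gamma> (s i))))\<bar> \<le> 2 * (L / N)\<^sup>2"
          by auto
      qed (use s[of 0] \<gamma> L in auto)
      also have "\<dots> = L\<^sup>2 * (\<kappa> / real N * cos (\<kappa> / real N) / sin (\<kappa> / real N) + 2 * \<kappa> / real N)"
        using N0 by (simp add: power2_eq_square add_divide_distrib distrib_left)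
      finally show ?thesis using s[of N] \<gamma> ck x\<kappa> by simp
    qed
    have lim: "(\<lambda>N::nat. L\<^sup>2 * (\<kappa> / real N * cos (\<kappa> / real N) / sin (\<kappa> / real N) + 2 * \<kappa> / real N)) \<longlonglongrightarrow> L\<^sup>2"
    proof -
      have "(\<lambda>N::nat. (\<kappa> / real N * cos (\<kappa> / real N) / sin (\<kappa> / real N) + 2 * \<kappa> / real N)) \<longlonglongrightarrow> 1"
        using \<kappa>(1) by real_asymp
      from tendsto_mult_left[OF this, of "L\<^sup>2"] show ?thesis by simp
    qed
    show ?thesis
      by (rule LIMSEQ_le_const[OF lim]) (use bd in blast)
  qed
qed

section \<open>Geodesics\<close>

lemma C1_imp_abs_cont_on:
  fixes f :: "real \<Rightarrow> 'a::real_normed_vector"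
  assumes der: "\<And>s. s \<in> {a..b} \<Longrightarrow> (f has_vector_derivative f' s) (at s within {a..b})"
    and cont: "continuous_on {a..b} f'"
  shows "abs_cont_on a b f"
proof -
  have "bounded (f' ` {a..b})"
    by (intro compact_imp_bounded compact_continuous_image cont) simp
  then obtain B where B: "\<And>s. s \<in> {a..b} \<Longrightarrow> norm (f' s) \<le> B"
    unfolding bounded_iff by blast
  show ?thesis
  proof (rule Lipschitz_imp_abs_cont_on)
    fix x y assume xy: "x \<in> {a..b}" "y \<in> {a..b}"
    have "norm (f x - f y) \<le> B * norm (x - y)"
    proof (rule differentiable_bound[where S = "{a..b}" and f' = "\<lambda>s h. h *\<^sub>R f' s"])
      show "(f has_derivative (\<lambda>h. h *\<^sub>R f' s)) (at s within {a..b})" if "s \<in> {a..b}" for s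
        using der[OF that] by (simp add: has_vector_derivative_def)
      show "onorm (\<lambda>h. h *\<^sub>R f' s) \<le> B" if "s \<in> {a..b}" for s
      proof (rule onorm_le)
        show "norm (h *\<^sub>R f' s) \<le> B * norm h" for h
          using mult_left_mono[OF B[OF that], of "\<bar>h\<bar>"] by (simp add: mult.commute)
      qed
    qed (use xy in auto)
    then show "dist (f x) (f y) \<le> B * \<bar>x - y\<bar>" by (simp add: dist_norm)
  qed
qed

lemma horizontal_withI:
  fixes \<gamma> :: "real \<Rightarrow> 'n::finite heis"
  assumes der: "\<And>s. (\<gamma> has_vector_derivative (h s, 2 * (h s \<bullet> symJ (fst (\<gamma> s))))) (at s)"
    and h: "continuous_on {0..1} h"
  shows "horizontal_with \<gamma> h"
proof -
  have d: "(\<gamma> has_vector_derivative (h s, 2 * (h s \<bullet> symJ (fst (\<gamma> s))))) (at s within {0..1})" for s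
    using der has_vector_derivative_at_within by blast
  have g: "continuous_on {0..1} (\<lambda>s. fst (\<gamma> s))"
    using d has_vector_derivative_continuous continuous_on_eq_continuous_within
    by (intro continuous_on_fst) blast
  have "continuous_on {0..1} (\<lambda>s. symJ (fst (\<gamma> s)))"
    by (rule bounded_linear.continuous_on[OF bounded_linear_symJ g])
  then have "abs_cont_on 0 1 \<gamma>"
    by (intro C1_imp_abs_cont_on[OF d]) (intro continuous_intros h)
  then show ?thesis using d by (simp add: horizontal_with_symJ)
qed

text \<open>Reading $J$ as multiplication by $i$, the curve is $z (e^{2ixs} - 1) / (e^{2ix} - 1)$,
  a circular arc from $0$ to $z$.\<close>

lemma geodesic_exists:
  fixes z :: "(real^'n::finite) \<times> (real^'n)"
  assumes x: "\<bar>x\<bar> < pi"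
  shows "\<exists>\<gamma> h. \<gamma> 0 = 0 \<and> \<gamma> 1 = (z, (norm z)\<^sup>2 * mu x) \<and> horizontal_with \<gamma> h \<and>
    (\<integral>\<^sup>+ s. ennreal (norm (h s)) * indicator {0..1} s \<partial>lborel) = ennreal (norm z * xsin x)"
proof -
  have len: "(\<integral>\<^sup>+ s. ennreal (norm (h s)) * indicator {0..1} s \<partial>lborel) = ennreal r"
    if "\<And>s. norm (h s) = r" for h :: "real \<Rightarrow> (real^'n) \<times> (real^'n)" and r
    unfolding that by (subst nn_integral_cmult_indicator) auto
  show ?thesis
  proof (cases "x = 0")
    case True
    define \<gamma> where "\<gamma> s = (s *\<^sub>R z, 0::real)" for s
    have "horizontal_with \<gamma> (\<lambda>_. z)"
    proof (rule horizontal_withI)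
      fix s
      have "((\<lambda>s. s *\<^sub>R z) has_vector_derivative z) (at s)"
        by (auto intro!: derivative_eq_intros)
      then have "(\<gamma> has_vector_derivative (z, 0)) (at s)"
        unfolding \<gamma>_def[abs_def] by (intro has_vector_derivative_Pair has_vector_derivative_const)
      then show "(\<gamma> has_vector_derivative (z, 2 * (z \<bullet> symJ (fst (\<gamma> s))))) (at s)"
        by (simp add: \<gamma>_def symJ_linear)
    qed simp
    then show ?thesis
      using len[of "\<lambda>_. z" "norm z"] True
      by (intro exI[of _ \<gamma>] exI[of _ "\<lambda>_. z"]) (simp add: \<gamma>_def xsin_def prod_eq_iff)
  next
    case False
    have sx: "sin x \<noteq> 0" using sin_neq_0 x False by auto
    \<comment> \<open>\<open>p\<close> and \<open>r\<close> are the real and imaginary parts of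
      (e^(2ixs) - 1)/(e^(2ix) - 1) = e^(i(xs - x)) sin(xs)/sin x. Its derivative is (x/sin x)
      e^(i(2xs - x)), of constant modulus. The angle 2xs - x is written as a sum so that
      \<open>cos_add\<close> and \<open>sin_add\<close> produce the terms of the product
      rule.\<close>
    define p r t h \<gamma> where "p s = sin (x * s) * cos (x * s - x) / sin x"
      and "r s = sin (x * s) * sin (x * s - x) / sin x"
      and "t s = (norm z)\<^sup>2 * (x * s - sin (x * s) * cos (x * s)) / (sin x)\<^sup>2"
      and "h s = (x / sin x) *\<^sub>R (cos (x * s + (x * s - x)) *\<^sub>R z + sin (x * s + (x * s - x)) *\<^sub>R symJ z)"
      and "\<gamma> s = (p s *\<^sub>R z + r s *\<^sub>R symJ z, t s)" for s
    have dp: "(p has_real_derivative x / sin x * cos (x * s + (x * s - x))) (at s)" for s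
      unfolding p_def[abs_def] cos_add using sx
      by (auto intro!: derivative_eq_intros simp: field_simps)
    have dr: "(r has_real_derivative x / sin x * sin (x * s + (x * s - x))) (at s)" for s
      unfolding r_def[abs_def] sin_add using sx
      by (auto intro!: derivative_eq_intros simp: field_simps)
    have dt: "(t has_real_derivative 2 * (norm z)\<^sup>2 * x * (sin (x * s))\<^sup>2 / (sin x)\<^sup>2) (at s)" for s
    proof -
      have "(t has_real_derivative (norm z)\<^sup>2 * (x - (x * cos (x * s) * cos (x * s) - sin (x * s) * (x * sin (x * s)))) / (sin x)\<^sup>2) (at s)"
        unfolding t_def[abs_def] using sx
        by (auto intro!: derivative_eq_intros simp: field_simps)
      also have "x - (x * cos (x * s) * cos (x * s) - sin (x * s) * (x * sin (x * s))) = 2 * x * (sin (x * s))\<^sup>2"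
        using sin_cos_squared_add3[of "x * s"] unfolding power2_eq_square by algebra
      finally show ?thesis by (simp add: mult.assoc mult.left_commute)
    qed
    have ht: "2 * (h s \<bullet> symJ (fst (\<gamma> s))) = 2 * (norm z)\<^sup>2 * x * (sin (x * s))\<^sup>2 / (sin x)\<^sup>2" for s
    proof -
      define c' s' where "c' = cos (x * s + (x * s - x))" and "s' = sin (x * s + (x * s - x))"
      have id: "s' * cos (x * s - x) - c' * sin (x * s - x) = sin (x * s)"
        using sin_diff[of "x * s + (x * s - x)" "x * s - x", symmetric]
        by (simp only: c'_def s'_def add_diff_cancel_right')
      have "h s \<bullet> symJ (fst (\<gamma> s)) = x / sin x * (s' * p s - c' * r s) * (norm z)\<^sup>2"
        unfolding h_def \<gamma>_def c'_def[symmetric] s'_def[symmetric]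
        by (simp add: symJ_linear inner_add_left inner_add_right inner_diff_left inner_diff_right
            power2_norm_eq_inner algebra_simps)
      also have "s' * p s - c' * r s = sin (x * s) * (s' * cos (x * s - x) - c' * sin (x * s - x)) / sin x"
        by (simp add: p_def r_def diff_divide_distrib algebra_simps)
      finally show ?thesis unfolding id by (simp add: power2_eq_square)
    qed
    have "horizontal_with \<gamma> h"
    proof (rule horizontal_withI)
      fix s
      have dz: "((\<lambda>s. p s *\<^sub>R z + r s *\<^sub>R symJ z) has_vector_derivative
          ((x / sin x * cos (x * s + (x * s - x))) *\<^sub>R z + (x / sin x * sin (x * s + (x * s - x))) *\<^sub>R symJ z)) (at s)"
        using has_vector_derivative_scaleR[OF dp[of s] has_vector_derivative_const[of z]]
          has_vector_derivative_scaleR[OF dr[of s] has_vector_derivative_const[of "symJ z"]]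
        by (intro has_vector_derivative_add) simp_all
      have "(x / sin x * cos (x * s + (x * s - x))) *\<^sub>R z + (x / sin x * sin (x * s + (x * s - x))) *\<^sub>R symJ z = h s"
        by (simp add: h_def scaleR_add_right)
      with dz have "((\<lambda>s. p s *\<^sub>R z + r s *\<^sub>R symJ z) has_vector_derivative h s) (at s)" by simp
      then show "(\<gamma> has_vector_derivative (h s, 2 * (h s \<bullet> symJ (fst (\<gamma> s))))) (at s)"
        unfolding ht unfolding \<gamma>_def[abs_def]
        by (intro has_vector_derivative_Pair) (use dt in \<open>simp_all add: has_real_derivative_iff_has_vector_derivative\<close>)
    next
      show "continuous_on {0..1} h" unfolding h_def by (intro continuous_intros)
    qed
    moreover have "norm (h s) = norm z * xsin x" for s
    proof -
      define c' s' where "c' = cos (x * s + (x * s - x))" and "s' = sin (x * s + (x * s - x))"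
      have cs: "c' * c' + s' * s' = 1" unfolding c'_def s'_def by simp
      have "(norm (c' *\<^sub>R z + s' *\<^sub>R symJ z))\<^sup>2 = (c' * c' + s' * s') * (norm z)\<^sup>2"
        unfolding power2_norm_eq_inner by (simp add: inner_add_left inner_add_right algebra_simps)
      then have "norm (c' *\<^sub>R z + s' *\<^sub>R symJ z) = norm z"
        unfolding cs by (simp add: power2_eq_iff_nonneg)
      moreover have "\<bar>x / sin x\<bar> = xsin x"
        using xsin_ge_1[OF x] False abs_of_nonneg[of "x / sin x"] by (simp only: xsin_def if_False)
      ultimately show ?thesis unfolding h_def c'_def s'_def by (simp add: mult.commute)
    qed
    moreover have "\<gamma> 0 = 0" by (simp add: \<gamma>_def p_def r_def t_def prod_eq_iff)
    moreover have "\<gamma> 1 = (z, (norm z)\<^sup>2 * mu x)" using sx by (simp add: \<gamma>_def p_def r_def t_def mu_def)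
    ultimately show ?thesis using len[of h "norm z * xsin x"] by blast
  qed
qed

text \<open>The geodesic and the lower bound are both taken at x = \<open>mu_inv\<close> (t/|z|^2),
  and there they agree: the geodesic has squared length |z|^2 (x/sin x)^2, and by
  \<open>cotk_add_mu\<close> this is |z|^2 (x cot x + x mu x).\<close>

lemma cc_dist_eq:
  fixes P :: "'n::finite heis"
  assumes "fst P \<noteq> 0"
  shows "cc_dist P = sqrt ((norm (fst P))\<^sup>2 * cc_prof (snd P / (norm (fst P))\<^sup>2))"
proof -
  define z m \<tau> x where "z = fst P" and "m = (norm z)\<^sup>2" and "\<tau> = snd P / m" and "x = mu_inv \<tau>"
  have m: "m > 0" using assms by (simp add: m_def z_def)
  have x: "\<bar>x\<bar> < pi" "mu x = \<tau>" by (simp_all add: x_def mu_inv)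
  have P: "P = (z, m * mu x)" using m by (simp add: z_def x \<tau>_def prod_eq_iff)
  define r where "r = norm z * xsin x"
  have r0: "r \<ge> 0" using xsin_ge_1[OF x(1)] by (simp add: r_def)
  have r2: "r\<^sup>2 = m * cc_prof \<tau>" unfolding r_def m_def cc_prof_eq x_def by (simp add: power_mult_distrib)
  define F where "F = (\<lambda>(\<gamma>::real \<Rightarrow> 'n heis, h::real \<Rightarrow> (real^'n) \<times> (real^'n)). \<integral>\<^sup>+ s. ennreal (norm (h s)) * indicator {0..1} s \<partial>lborel)"
  define S where "S = {(\<gamma>, h). \<gamma> 0 = 0 \<and> \<gamma> 1 = P \<and> horizontal_with \<gamma> h}"
  obtain \<gamma> h where gh: "\<gamma> 0 = 0" "\<gamma> 1 = P" "horizontal_with \<gamma> h" "F (\<gamma>, h) = ennreal r"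
    using geodesic_exists[OF x(1), of z] unfolding P F_def r_def m_def by auto
  have "(INF gh \<in> S. F gh) = ennreal r"
  proof (rule antisym)
    show "(INF gh \<in> S. F gh) \<le> ennreal r"
      using gh by (intro INF_lower2[of "(\<gamma>, h)"]) (auto simp: S_def)
    show "ennreal r \<le> (INF gh \<in> S. F gh)"
    proof (rule INF_greatest)
      fix gh assume "gh \<in> S"
      then obtain \<gamma> h where gh: "gh = (\<gamma>, h)" "\<gamma> 0 = 0" "\<gamma> 1 = P" "horizontal_with \<gamma> h" by (auto simp: S_def)
      show "ennreal r \<le> F gh"
      proof (cases "F gh")
        case (real L)
        then have "(\<integral>\<^sup>+ s. ennreal (norm (h s)) * indicator {0..1} s \<partial>lborel) = ennreal L" by (simp add: F_def gh)
        from horizontal_length_lower_bound[OF gh(4,2,3) this real(1) x(1)]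
        have "m * (cotk x + x * mu x) \<le> L\<^sup>2" unfolding P m_def by (simp add: algebra_simps)
        then have "r\<^sup>2 \<le> L\<^sup>2" unfolding cotk_add_mu[OF x(1)] r_def m_def by (simp add: power_mult_distrib)
        then have "r \<le> L" using real(1) by (simp add: power2_le_iff_abs_le r0 power_mono_iff)
        then show ?thesis using real by (simp add: ennreal_leI)
      qed simp
    qed
  qed
  then have "cc_dist P = r" using r0 unfolding cc_dist_def F_def S_def by simp
  then show ?thesis using r0 r2 unfolding \<tau>_def m_def z_def
    by (simp add: real_sqrt_unique)
qed

section \<open>Integration by parts\<close>

lemma integrable_compact_support:
  fixes g :: "'a::euclidean_space \<Rightarrow> real"
  assumes "continuous_on UNIV g" "compact K" "\<And>x. x \<notin> K \<Longrightarrow> g x = 0"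
  shows "integrable lborel g"
proof -
  have "integrable lborel (\<lambda>x. indicator K x *\<^sub>R g x)"
    using assms by (intro borel_integrable_compact) (auto intro: continuous_on_subset)
  also have "(\<lambda>x. indicator K x *\<^sub>R g x) = g"
    using assms(3) by (auto simp: indicator_def fun_eq_iff)
  finally show ?thesis .
qed

lemma has_derivative_zero_off_support:
  assumes "closed K" "\<And>x. x \<notin> K \<Longrightarrow> f x = 0" "(f has_derivative D) (at x)" "x \<notin> K"
  shows "D = (\<lambda>_. 0)"
proof -
  have "((\<lambda>_. 0) has_derivative D) (at x)"
    by (rule has_derivative_transform_within_open[OF assms(3), of "- K"]) (use assms in auto)
  then show ?thesis using has_derivative_unique has_derivative_const by blast
qed

text \<open>Translation invariance makes the integral of every difference quotient vanish.\<close>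

lemma integral_directional_derivative_zero:
  fixes f :: "'a::euclidean_space \<Rightarrow> real"
  assumes der: "\<And>x. (f has_derivative f' x) (at x)" and cont: "continuous_on UNIV (\<lambda>x. f' x e)"
    and K: "compact K" and supp: "\<And>x. x \<notin> K \<Longrightarrow> f x = 0"
  shows "integrable lborel (\<lambda>x. f' x e) \<and> (LINT x|lborel. f' x e) = 0"
proof -
  have contf: "continuous_on UNIV f"
    using der has_derivative_continuous by (intro continuous_at_imp_continuous_on) blast
  have supp': "f' x e = 0" if "x \<notin> K" for x
    using has_derivative_zero_off_support[of K f "f' x" x] compact_imp_closed[OF K] supp der that by auto
  have int': "integrable lborel (\<lambda>x. f' x e)"
    by (rule integrable_compact_support[OF cont K supp'])
  have intf: "integrable lborel f"
    by (rule integrable_compact_support[OF contf K supp])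
  have "bounded ((\<lambda>x. f' x e) ` K)"
    by (intro compact_imp_bounded compact_continuous_image K continuous_on_subset[OF cont]) simp
  then obtain B0 where B0: "\<And>x. x \<in> K \<Longrightarrow> \<bar>f' x e\<bar> \<le> B0" unfolding bounded_iff by auto
  define B where "B = max B0 0"
  have B: "\<bar>f' x e\<bar> \<le> B" "B \<ge> 0" for x
    using B0[of x] supp'[of x] by (cases "x \<in> K"; auto simp: B_def)+
  obtain R where R: "\<And>x. x \<in> K \<Longrightarrow> norm x \<le> R"
    using compact_imp_bounded[OF K] unfolding bounded_iff by blast
  have line: "((\<lambda>s. f (x + s *\<^sub>R e)) has_real_derivative f' (x + s *\<^sub>R e) e) (at s)" for x s
  proof -
    have "((\<lambda>s. x + s *\<^sub>R e) has_derivative (\<lambda>t. t *\<^sub>R e)) (at s)"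
      by (auto intro!: derivative_eq_intros)
    from has_derivative_compose[OF this der]
    have "((\<lambda>s. f (x + s *\<^sub>R e)) has_derivative (\<lambda>t. f' (x + s *\<^sub>R e) (t *\<^sub>R e))) (at s)" .
    moreover have "f' (x + s *\<^sub>R e) (t *\<^sub>R e) = f' (x + s *\<^sub>R e) e * t" for t
      using linear_cmul[OF has_derivative_linear[OF der]] by (simp add: mult.commute)
    ultimately show ?thesis by (simp add: has_field_derivative_def mult.commute[of _ "f' _ _"])
  qed
  \<comment> \<open>Increments of at most 1 keep every difference quotient supported within |e| of
    \<open>K\<close>; the mean value theorem bounds them all by \<open>B\<close>, which gives a
    single integrable majorant.\<close>
  define h :: "nat \<Rightarrow> real" where "h n = 1 / (real n + 1)" for n
  have h: "h n > 0" "h n \<le> 1" for n by (auto simp: h_def)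
  define q where "q n x = (f (x + h n *\<^sub>R e) - f x) / h n" for n x
  have shift: "integrable lborel (\<lambda>x. f (x + c)) \<and> (LINT x|lborel. f (x + c)) = (LINT x|lborel. f x)" for c
  proof -
    have "integrable (distr lborel borel ((+) c)) f" "(LINT x|distr lborel borel ((+) c). f x) = (LINT x|lborel. f x)"
      using intf by (simp_all add: lborel_distr_plus)
    then show ?thesis
      using borel_measurable_integrable[OF intf]
      by (simp add: integrable_distr_eq integral_distr add.commute)
  qed
  have q0: "(LINT x|lborel. q n x) = 0" for n
    using shift[of "h n *\<^sub>R e"] intf unfolding q_def by simp
  have "(\<lambda>n. LINT x|lborel. q n x) \<longlonglongrightarrow> (LINT x|lborel. f' x e)"
  proof (rule integral_dominated_convergence)
    show "(\<lambda>x. f' x e) \<in> borel_measurable lborel" using int' by simp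
    show "q n \<in> borel_measurable lborel" for n
    proof -
      have "integrable lborel (q n)" unfolding q_def using shift[of "h n *\<^sub>R e"] intf by simp
      then show ?thesis by simp
    qed
    show "integrable lborel (\<lambda>x. indicator (cball 0 (R + norm e)) x *\<^sub>R B)"
      by (intro borel_integrable_compact) auto
    show "AE x in lborel. (\<lambda>n. q n x) \<longlonglongrightarrow> f' x e"
    proof (rule AE_I2)
      fix x
      have "((\<lambda>k. (f (x + k *\<^sub>R e) - f x) / k) \<longlongrightarrow> f' x e) (at 0)"
        using line[of x 0] by (simp add: DERIV_def)
      moreover have "filterlim h (at 0) sequentially" unfolding h_def by real_asymp
      ultimately show "(\<lambda>n. q n x) \<longlonglongrightarrow> f' x e"
        unfolding q_def by (rule filterlim_compose)
    qed
    show "AE x in lborel. norm (q n x) \<le> indicator (cball 0 (R + norm e)) x *\<^sub>R B" for n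
    proof (rule AE_I2)
      fix x
      show "norm (q n x) \<le> indicator (cball 0 (R + norm e)) x *\<^sub>R B"
      proof (cases "norm x \<le> R + norm e")
        case True
        obtain s where "f (x + h n *\<^sub>R e) - f (x + 0 *\<^sub>R e) = (h n - 0) * f' (x + s *\<^sub>R e) e"
          using MVT2[OF h(1)[of n], of "\<lambda>s. f (x + s *\<^sub>R e)" "\<lambda>s. f' (x + s *\<^sub>R e) e"] line by auto
        then have "q n x = f' (x + s *\<^sub>R e) e" using h[of n] by (simp add: q_def)
        then show ?thesis using B True by simp
      next
        case False
        have "norm x \<le> norm (x + h n *\<^sub>R e) + h n * norm e"
          using norm_triangle_ineq4[of "x + h n *\<^sub>R e" "h n *\<^sub>R e"] h[of n] by simp
        moreover have "h n * norm e \<le> norm e" using h[of n] by (simp add: mult_left_le_one_le)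
        ultimately have "x + h n *\<^sub>R e \<notin> K" "x \<notin> K"
          using False R[of "x + h n *\<^sub>R e"] R[of x] norm_ge_zero[of e] by auto
        then show ?thesis using supp False by (simp add: q_def)
      qed
    qed
  qed
  then have "(LINT x|lborel. f' x e) = 0" unfolding q0 by (simp add: LIMSEQ_const_iff)
  then show ?thesis using int' by simp
qed

text \<open>The integrand is the divergence of the field (U z, 0), assembled from the derivatives of
  U (z . b) in the directions b of an orthonormal basis.\<close>

lemma integral_divergence_radial:
  fixes U :: "'e::euclidean_space \<times> real \<Rightarrow> real"
  assumes der: "\<And>P. (U has_derivative U' P) (at P)" and cont: "\<And>v. continuous_on UNIV (\<lambda>P. U' P v)"
    and K: "compact K" and supp: "\<And>P. P \<notin> K \<Longrightarrow> U P = 0"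
  shows "integrable lborel (\<lambda>P. DIM('e) * U P + U' P (fst P, 0)) \<and>
    (LINT P|lborel. DIM('e) * U P + U' P (fst P, 0)) = 0"
proof -
  have contU: "continuous_on UNIV U"
    using der has_derivative_continuous by (intro continuous_at_imp_continuous_on) blast
  have bl: "bounded_linear (\<lambda>P::'e \<times> real. fst P \<bullet> b)" for b
    by (intro bounded_linear_compose[OF bounded_linear_inner_left bounded_linear_fst])
  define g where "g b P = U' P (b, 0) * (fst P \<bullet> b) + U P * (b \<bullet> b)" for b P
  have g: "integrable lborel (g b) \<and> (LINT P|lborel. g b P) = 0" for b
    unfolding g_def
  proof (rule integral_directional_derivative_zero[where f = "\<lambda>P. U P * (fst P \<bullet> b)"
        and f' = "\<lambda>P v. U' P v * (fst P \<bullet> b) + U P * (fst v \<bullet> b)" and e = "(b, 0)" and K = K, simplified fst_conv])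
    show "((\<lambda>P. U P * (fst P \<bullet> b)) has_derivative (\<lambda>v. U' P v * (fst P \<bullet> b) + U P * (fst v \<bullet> b))) (at P)" for P
      by (rule has_derivative_eq_rhs[OF has_derivative_mult[OF der bounded_linear.has_derivative[OF bl has_derivative_ident]]])
         (simp add: fun_eq_iff)
    show "continuous_on UNIV (\<lambda>P. U' P (b, 0) * (fst P \<bullet> b) + U P * (b \<bullet> b))"
      by (intro continuous_intros cont contU)
  qed (use K supp in auto)
  have sum: "(\<Sum>b\<in>Basis. g b P) = DIM('e) * U P + U' P (fst P, 0)" for P
  proof -
    have "(fst P, 0::real) = (\<Sum>b\<in>Basis. (fst P \<bullet> b) *\<^sub>R (b, 0))"
      by (simp add: prod_eq_iff fst_sum snd_sum euclidean_representation)
    then have "U' P (fst P, 0) = (\<Sum>b\<in>Basis. (fst P \<bullet> b) * U' P (b, 0))"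
      using has_derivative_linear[OF der[of P]] by (simp add: linear_sum linear_cmul del: scaleR_Pair)
    then show ?thesis by (simp add: g_def sum.distrib inner_Basis mult.commute)
  qed
  show ?thesis unfolding sum[symmetric] using g by simp
qed

text \<open>The field (J z, 2 |z|^2) is horizontal, since 2 (J z . J z) = 2 |z|^2, and
  divergence-free: J is skew and the last component does not depend on t. Hence the divergence of
  its multiple by W consists of derivatives of W alone.\<close>

lemma integral_divergence_rotational:
  fixes W :: "('a::euclidean_space \<times> 'a) \<times> real \<Rightarrow> real"
  assumes der: "\<And>P. (W has_derivative W' P) (at P)" and cont: "\<And>v. continuous_on UNIV (\<lambda>P. W' P v)"
    and K: "compact K" and supp: "\<And>P. P \<notin> K \<Longrightarrow> W P = 0"
  shows "integrable lborel (\<lambda>P. W' P (symJ (fst P), 2 * (norm (fst P))\<^sup>2)) \<and>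
    (LINT P|lborel. W' P (symJ (fst P), 2 * (norm (fst P))\<^sup>2)) = 0"
proof -
  have contW: "continuous_on UNIV W"
    using der has_derivative_continuous by (intro continuous_at_imp_continuous_on) blast
  define g where "g b P = W' P (b, 0) * (symJ (fst P) \<bullet> b)" for b P
  have blJ: "bounded_linear (\<lambda>P::('a \<times> 'a) \<times> real. symJ (fst P) \<bullet> b)" for b
    by (intro bounded_linear_compose[OF bounded_linear_inner_left]
        bounded_linear_compose[OF bounded_linear_symJ bounded_linear_fst])
  have g: "integrable lborel (g b) \<and> (LINT P|lborel. g b P) = 0" for b
  proof -
    have "integrable lborel (\<lambda>P. W' P (b, 0) * (symJ (fst P) \<bullet> b) + W P * (symJ (fst (b, 0::real)) \<bullet> b)) \<and>
      (LINT P|lborel. W' P (b, 0) * (symJ (fst P) \<bullet> b) + W P * (symJ (fst (b, 0::real)) \<bullet> b)) = 0"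
    proof (rule integral_directional_derivative_zero[where f = "\<lambda>P. W P * (symJ (fst P) \<bullet> b)"
        and f' = "\<lambda>P v. W' P v * (symJ (fst P) \<bullet> b) + W P * (symJ (fst v) \<bullet> b)" and K = K])
      show "((\<lambda>P. W P * (symJ (fst P) \<bullet> b)) has_derivative (\<lambda>v. W' P v * (symJ (fst P) \<bullet> b) + W P * (symJ (fst v) \<bullet> b))) (at P)" for P
        by (rule has_derivative_eq_rhs[OF has_derivative_mult[OF der bounded_linear.has_derivative[OF blJ has_derivative_ident]]])
           (simp add: fun_eq_iff)
      show "continuous_on UNIV (\<lambda>P. W' P (b, 0) * (symJ (fst P) \<bullet> b) + W P * (symJ (fst (b, 0::real)) \<bullet> b))"
        by (intro continuous_intros cont contW bounded_linear.continuous_on[OF bounded_linear_symJ])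
    qed (use K supp in auto)
    then show ?thesis by (simp add: g_def[abs_def])
  qed
  define k where "k P = W' P (0, 1) * (2 * (fst P \<bullet> fst P))" for P
  have k: "integrable lborel k \<and> (LINT P|lborel. k P) = 0"
  proof -
    have "integrable lborel (\<lambda>P. W' P (0, 1) * (2 * (fst P \<bullet> fst P)) + W P * (4 * (fst P \<bullet> fst (0, 1::real)))) \<and>
      (LINT P|lborel. W' P (0, 1) * (2 * (fst P \<bullet> fst P)) + W P * (4 * (fst P \<bullet> fst (0, 1::real)))) = 0"
    proof (rule integral_directional_derivative_zero[where f = "\<lambda>P. W P * (2 * (fst P \<bullet> fst P))"
        and f' = "\<lambda>P v. W' P v * (2 * (fst P \<bullet> fst P)) + W P * (4 * (fst P \<bullet> fst v))" and K = K])
      show "((\<lambda>P. W P * (2 * (fst P \<bullet> fst P))) has_derivative (\<lambda>v. W' P v * (2 * (fst P \<bullet> fst P)) + W P * (4 * (fst P \<bullet> fst v)))) (at P)" for P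
      proof -
        have "((\<lambda>P::('a \<times> 'a) \<times> real. fst P) has_derivative fst) (at P)"
          by (rule bounded_linear_imp_has_derivative[OF bounded_linear_fst])
        from has_derivative_mult[OF der has_derivative_mult_right[OF has_derivative_inner[OF this this], of 2]]
        show ?thesis by (rule has_derivative_eq_rhs) (simp add: fun_eq_iff inner_commute)
      qed
      show "continuous_on UNIV (\<lambda>P. W' P (0, 1) * (2 * (fst P \<bullet> fst P)) + W P * (4 * (fst P \<bullet> fst (0, 1::real))))"
        by (intro continuous_intros cont contW)
    qed (use K supp in auto)
    then show ?thesis by (simp add: k_def[abs_def])
  qed
  have sum: "(\<Sum>b\<in>Basis. g b P) + k P = W' P (symJ (fst P), 2 * (norm (fst P))\<^sup>2)" for P
  proof -
    have "(symJ (fst P), 2 * (norm (fst P))\<^sup>2) = (\<Sum>b\<in>Basis. (symJ (fst P) \<bullet> b) *\<^sub>R (b, 0)) + (2 * (fst P \<bullet> fst P)) *\<^sub>R (0, 1)"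
      by (simp add: prod_eq_iff fst_sum snd_sum euclidean_representation power2_norm_eq_inner)
    then have "W' P (symJ (fst P), 2 * (norm (fst P))\<^sup>2) = (\<Sum>b\<in>Basis. (symJ (fst P) \<bullet> b) * W' P (b, 0)) + (2 * (fst P \<bullet> fst P)) * W' P (0, 1)"
      using has_derivative_linear[OF der[of P]] by (simp add: linear_sum linear_add linear_cmul del: scaleR_Pair)
    then show ?thesis by (simp add: g_def k_def mult.commute)
  qed
  show ?thesis unfolding sum[symmetric] using g k by simp
qed

section \<open>Truncated squares, powers of absolute values and Young's inequality\<close>

lemma DERIV_pos_square: "DERIV (\<lambda>x::real. (max 0 x)\<^sup>2) x :> 2 * max 0 x"
proof -
  consider "x > 0" | "x < 0" | "x = 0" by linarith
  then show ?thesis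
  proof cases
    case 1
    have "((\<lambda>x::real. x\<^sup>2) has_real_derivative 2 * max 0 x) (at x)"
      using 1 by (auto intro!: derivative_eq_intros)
    then show ?thesis
      by (rule has_field_derivative_transform_within_open[where S = "{0<..}"]) (use 1 in auto)
  next
    case 2
    have "((\<lambda>x::real. 0) has_real_derivative 2 * max 0 x) (at x)" using 2 by simp
    then show ?thesis
      by (rule has_field_derivative_transform_within_open[where S = "{..<0}"]) (use 2 in auto)
  next
    case 3
    have "((\<lambda>h::real. (max 0 h)\<^sup>2 / h) \<longlongrightarrow> 0) (at 0)"
    proof (rule Lim_null_comparison)
      show "eventually (\<lambda>h::real. norm ((max 0 h)\<^sup>2 / h) \<le> \<bar>h\<bar>) (at 0)"
        by (rule always_eventually) (auto simp: max_def power2_eq_square)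
      show "((\<lambda>h::real. \<bar>h\<bar>) \<longlongrightarrow> 0) (at 0)" by (intro tendsto_eq_intros) auto
    qed
    then show ?thesis unfolding 3 DERIV_def by simp
  qed
qed

lemma DERIV_abs_powr:
  assumes "p > 1" shows "DERIV (\<lambda>x::real. \<bar>x\<bar> powr p) x :> p * (\<bar>x\<bar> powr (p - 1) * sgn x)"
proof -
  consider "x > 0" | "x < 0" | "x = 0" by linarith
  then show ?thesis
  proof cases
    case 1
    have "((\<lambda>x::real. x powr p) has_real_derivative p * (\<bar>x\<bar> powr (p - 1) * sgn x)) (at x)"
      using 1 by (auto intro!: derivative_eq_intros)
    then show ?thesis
      by (rule has_field_derivative_transform_within_open[where S = "{0<..}"]) (use 1 in auto)
  next
    case 2
    have "((\<lambda>x::real. (- x) powr p) has_real_derivative p * (\<bar>x\<bar> powr (p - 1) * sgn x)) (at x)"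
      using 2 by (auto intro!: derivative_eq_intros)
    then show ?thesis
      by (rule has_field_derivative_transform_within_open[where S = "{..<0}"]) (use 2 in auto)
  next
    case 3
    have "((\<lambda>h::real. \<bar>h\<bar> powr p / h) \<longlongrightarrow> 0) (at 0)"
    proof (rule Lim_null_comparison)
      show "eventually (\<lambda>h::real. norm (\<bar>h\<bar> powr p / h) \<le> \<bar>h\<bar> powr (p - 1)) (at 0)"
      proof (rule always_eventually, rule allI)
        fix h :: real
        show "norm (\<bar>h\<bar> powr p / h) \<le> \<bar>h\<bar> powr (p - 1)"
          by (cases "h = 0") (simp_all add: powr_diff)
      qed
      have "((\<lambda>h::real. \<bar>h\<bar> powr (p - 1)) \<longlongrightarrow> 0 powr (p - 1)) (at 0)"
        using assms by (intro tendsto_powr2 tendsto_rabs_zero) (auto intro!: tendsto_eq_intros)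
      then show "((\<lambda>h::real. \<bar>h\<bar> powr (p - 1)) \<longlongrightarrow> 0) (at 0)" by simp
    qed
    then show ?thesis unfolding 3 DERIV_def by simp
  qed
qed

lemma isCont_abs_powr_sgn:
  assumes "r > 0" shows "isCont (\<lambda>x::real. \<bar>x\<bar> powr r * sgn x) x"
proof (cases "x = 0")
  case True
  have "((\<lambda>h::real. \<bar>h\<bar> powr r * sgn h) \<longlongrightarrow> 0) (at 0)"
  proof (rule Lim_null_comparison)
    show "eventually (\<lambda>h::real. norm (\<bar>h\<bar> powr r * sgn h) \<le> \<bar>h\<bar> powr r) (at 0)"
      by (rule always_eventually) (auto simp: abs_mult sgn_if)
    have "((\<lambda>h::real. \<bar>h\<bar> powr r) \<longlongrightarrow> 0 powr r) (at 0)"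
      using assms by (intro tendsto_powr2 tendsto_rabs_zero) (auto intro!: tendsto_eq_intros)
    then show "((\<lambda>h::real. \<bar>h\<bar> powr r) \<longlongrightarrow> 0) (at 0)" by simp
  qed
  then show ?thesis unfolding True isCont_def by simp
next
  case False
  then show ?thesis by (intro continuous_intros) auto
qed

text \<open>Equality holds at y = s x. The parameter s stays free until the integrated inequality is
  available and is optimised there.\<close>

lemma weighted_Young:
  fixes x y s p :: real
  assumes "p > 1" "x \<ge> 0" "y \<ge> 0" "s > 0"
  shows "p * x powr (p - 1) * y \<le> (p - 1) * s * x powr p + s powr (1 - p) * y powr p"
proof -
  define r where "r = p / (p - 1)"
  have r: "r > 1" "1 / r + 1 / p = 1" "(p - 1) * r = p" using assms by (auto simp: r_def field_simps)
  define a b where "a = s powr (1 / r) * x powr (p - 1)" and "b = s powr (- 1 / r) * y"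
  have "a * b \<le> a powr r / r + b powr p / p"
    using assms r by (intro Youngs_inequality) (auto simp: a_def b_def)
  also have "a powr r = s * x powr p"
    using assms r by (simp add: a_def powr_mult powr_powr)
  also have "b powr p = s powr (1 - p) * y powr p"
  proof -
    have "- 1 / r * p = 1 - p" using assms by (simp add: r_def field_simps)
    then show ?thesis using assms by (simp add: b_def powr_mult powr_powr)
  qed
  also have "a * b = x powr (p - 1) * y"
  proof -
    have "s powr (1 / r) * s powr (- 1 / r) = 1" using assms by (simp add: powr_add[symmetric])
    then show ?thesis by (simp add: a_def b_def algebra_simps)
  qed
  finally have "p * (x powr (p - 1) * y) \<le> p * (s * x powr p / r + s powr (1 - p) * y powr p / p)"
    using assms by (intro mult_left_mono) auto
  also have "\<dots> = (p - 1) * s * x powr p + s powr (1 - p) * y powr p"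
    using assms by (simp add: r_def field_simps)
  finally show ?thesis by (simp add: mult.assoc)
qed

section \<open>Horizontal fields with prescribed divergence\<close>

text \<open>The general function of |z| and t, off the axis, that is homogeneous of degree -2q under
  the dilations. In this form identities between derivatives become ordinary differential equations
  in \<tau> = t/|z|^2.\<close>

definition pullback :: "real \<Rightarrow> (real \<Rightarrow> real) \<Rightarrow> 'e::real_inner \<times> real \<Rightarrow> real" where
  "pullback q G P = (fst P \<bullet> fst P) powr (- q) * G (snd P / (fst P \<bullet> fst P))"

definition pullback_deriv ::
    "real \<Rightarrow> (real \<Rightarrow> real) \<Rightarrow> (real \<Rightarrow> real) \<Rightarrow> 'e::real_inner \<times> real \<Rightarrow> 'e \<times> real \<Rightarrow> real" where
  "pullback_deriv q G G' P v =
    (fst P \<bullet> fst P) powr (- q) * (G' (snd P / (fst P \<bullet> fst P)) *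
        (snd v / (fst P \<bullet> fst P) - snd P * (2 * (fst P \<bullet> fst v)) / ((fst P \<bullet> fst P) * (fst P \<bullet> fst P))))
     + (- q * (fst P \<bullet> fst P) powr (- q - 1) * (2 * (fst P \<bullet> fst v))) * G (snd P / (fst P \<bullet> fst P))"

lemma pullback_has_derivative:
  fixes P :: "'e::real_inner \<times> real"
  assumes z: "fst P \<noteq> 0" and G: "\<And>\<tau>. DERIV G \<tau> :> G' \<tau>"
  shows "(pullback q G has_derivative pullback_deriv q G G' P) (at P)"
proof -
  have m0: "fst P \<bullet> fst P > 0" using z by simp
  have f: "((\<lambda>P::'e \<times> real. fst P) has_derivative fst) (at P)"
    by (rule bounded_linear_imp_has_derivative[OF bounded_linear_fst])
  have s: "((\<lambda>P::'e \<times> real. snd P) has_derivative snd) (at P)"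
    by (rule bounded_linear_imp_has_derivative[OF bounded_linear_snd])
  have m: "((\<lambda>P::'e \<times> real. fst P \<bullet> fst P) has_derivative (\<lambda>v. 2 * (fst P \<bullet> fst v))) (at P)"
    using has_derivative_inner[OF f f] by (rule has_derivative_eq_rhs) (simp add: fun_eq_iff inner_commute)
  have "((\<lambda>m. m powr (- q)) has_real_derivative - q * (fst P \<bullet> fst P) powr (- q - 1)) (at (fst P \<bullet> fst P))"
    using m0 by (auto intro!: derivative_eq_intros)
  from has_derivative_compose[OF m this[unfolded has_field_derivative_def]]
  have pw: "((\<lambda>P::'e \<times> real. (fst P \<bullet> fst P) powr (- q)) has_derivative
      (\<lambda>v. - q * (fst P \<bullet> fst P) powr (- q - 1) * (2 * (fst P \<bullet> fst v)))) (at P)" .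
  have \<tau>: "((\<lambda>P::'e \<times> real. snd P / (fst P \<bullet> fst P)) has_derivative
      (\<lambda>v. snd v / (fst P \<bullet> fst P) - snd P * (2 * (fst P \<bullet> fst v)) / ((fst P \<bullet> fst P) * (fst P \<bullet> fst P)))) (at P)"
    using m0 by (intro has_derivative_eq_rhs[OF has_derivative_divide'[OF s m]])
      (auto simp: fun_eq_iff field_simps)
  from has_derivative_compose[OF \<tau> G[unfolded has_field_derivative_def]]
  have "((\<lambda>P::'e \<times> real. G (snd P / (fst P \<bullet> fst P))) has_derivative
      (\<lambda>v. G' (snd P / (fst P \<bullet> fst P)) * (snd v / (fst P \<bullet> fst P) - snd P * (2 * (fst P \<bullet> fst v)) / ((fst P \<bullet> fst P) * (fst P \<bullet> fst P))))) (at P)" .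
  from has_derivative_mult[OF pw this]
  show ?thesis unfolding pullback_def[abs_def] pullback_deriv_def[abs_def] .
qed

lemma continuous_on_pullback_deriv:
  fixes v :: "'e::real_inner \<times> real"
  assumes G: "continuous_on UNIV G" "continuous_on UNIV G'"
  shows "continuous_on {P. fst P \<noteq> 0} (\<lambda>P. pullback_deriv q G G' P v)"
proof -
  have \<tau>: "continuous_on {P::'e \<times> real. fst P \<noteq> 0} (\<lambda>P. snd P / (fst P \<bullet> fst P))"
    by (intro continuous_intros) auto
  have "continuous_on {P::'e \<times> real. fst P \<noteq> 0} (\<lambda>P. G (snd P / (fst P \<bullet> fst P)))"
    "continuous_on {P::'e \<times> real. fst P \<noteq> 0} (\<lambda>P. G' (snd P / (fst P \<bullet> fst P)))"
    using continuous_on_compose2[OF G(1) \<tau>] continuous_on_compose2[OF G(2) \<tau>] by auto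
  then show ?thesis unfolding pullback_deriv_def by (intro continuous_intros) auto
qed

lemma pullback_deriv_radial:
  assumes "fst P \<noteq> 0"
  shows "pullback_deriv q G G' P (fst P, 0) = (fst P \<bullet> fst P) powr (- q) *
    (- 2 * q * G (snd P / (fst P \<bullet> fst P)) - 2 * (snd P / (fst P \<bullet> fst P)) * G' (snd P / (fst P \<bullet> fst P)))"
proof -
  define m where "m = fst P \<bullet> fst P"
  have m: "m > 0" using assms by (simp add: m_def)
  have "m powr (- q - 1) * m = m powr (- q)" using m by (simp add: powr_diff)
  then have "m * m powr (- q - 1) = m powr (- q)" by (simp add: mult.commute)
  then show ?thesis unfolding pullback_deriv_def fst_conv snd_conv m_def[symmetric]
    using m by (simp add: algebra_simps)
qed

lemma pullback_deriv_rotational: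
  fixes P :: "('a::real_inner \<times> 'a) \<times> real"
  assumes "fst P \<noteq> 0"
  shows "pullback_deriv q G G' P (symJ (fst P), 2 * (norm (fst P))\<^sup>2) =
    (fst P \<bullet> fst P) powr (- q) * (2 * G' (snd P / (fst P \<bullet> fst P)))"
  unfolding pullback_deriv_def using assms by (simp add: power2_norm_eq_inner)

text \<open>Pullbacks are singular on the axis, while the integration by parts asks for C^1
  functions on the whole space. A factor that vanishes in a tube around the axis makes the product
  C^1: it is identically 0 inside the tube and regular outside the axis, and these two open sets
  cover the space.\<close>

lemma C1_mult_vanishing_near_axis:
  fixes f h :: "'e::euclidean_space \<times> real \<Rightarrow> real"
  assumes f: "\<And>P. (f has_derivative f' P) (at P)" "\<And>v. continuous_on UNIV (\<lambda>P. f' P v)"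
    and e: "e > 0" "\<And>P. norm (fst P) < e \<Longrightarrow> f P = 0"
    and h: "\<And>P. fst P \<noteq> 0 \<Longrightarrow> (h has_derivative h' P) (at P)"
      "\<And>v. continuous_on {P. fst P \<noteq> 0} (\<lambda>P. h' P v)"
  shows "((\<lambda>P. f P * h P) has_derivative (\<lambda>v. f P * h' P v + f' P v * h P)) (at P)"
    and "continuous_on UNIV (\<lambda>P. f P * h' P v + f' P v * h P)"
    and "norm (fst P) < e \<Longrightarrow> f' P v = 0"
proof -
  define V where "V = {P::'e \<times> real. norm (fst P) < e}"
  have V: "open V" unfolding V_def by (intro open_Collect_less continuous_intros)
  have W: "open {P::'e \<times> real. fst P \<noteq> 0}" by (intro open_Collect_neq continuous_intros)
  have f'0: "f' P = (\<lambda>_. 0)" if "P \<in> V" for P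
    by (rule has_derivative_zero_off_support[of "- V" f])
      (use V f(1) e(2) that in \<open>auto simp: V_def\<close>)
  then show "norm (fst P) < e \<Longrightarrow> f' P v = 0" by (simp add: V_def)
  show "((\<lambda>P. f P * h P) has_derivative (\<lambda>v. f P * h' P v + f' P v * h P)) (at P)"
  proof (cases "fst P = 0")
    case True
    then have P: "P \<in> V" using e by (simp add: V_def)
    have "((\<lambda>_. 0) has_derivative (\<lambda>_. 0::real)) (at P)" by simp
    then have "((\<lambda>P. f P * h P) has_derivative (\<lambda>_. 0)) (at P)"
      by (rule has_derivative_transform_within_open[OF _ V P]) (use e in \<open>simp add: V_def\<close>)
    then show ?thesis using f'0[OF P] P e by (simp add: V_def)
  next
    case False
    then show ?thesis using has_derivative_mult[OF f(1) h(1)] by simp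
  qed
  have contf: "continuous_on UNIV f"
    using f(1) has_derivative_continuous by (intro continuous_at_imp_continuous_on) blast
  have conth: "continuous_on {P. fst P \<noteq> 0} h"
    using h(1) has_derivative_continuous by (intro continuous_at_imp_continuous_on) blast
  have "continuous_on V (\<lambda>P. f P * h' P v + f' P v * h P)"
    using e f'0 by (subst continuous_on_cong[OF refl, of _ _ "\<lambda>_. 0"]) (auto simp: V_def)
  moreover have "continuous_on {P. fst P \<noteq> 0} (\<lambda>P. f P * h' P v + f' P v * h P)"
    by (intro continuous_intros h(2) conth continuous_on_subset[OF contf] continuous_on_subset[OF f(2)]) auto
  ultimately have "continuous_on (V \<union> {P. fst P \<noteq> 0}) (\<lambda>P. f P * h' P v + f' P v * h P)"
    by (rule continuous_on_open_Un[OF V W])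
  moreover have "V \<union> {P. fst P \<noteq> 0} = UNIV" using e by (auto simp: V_def)
  ultimately show "continuous_on UNIV (\<lambda>P. f P * h' P v + f' P v * h P)" by simp
qed

text \<open>The two derivatives make the field F a C^1 field off the axis, since F already contains
  the first derivative of the profile. The three bounds say max(|z|^2, |t|) \<le> d^2 \<le> |z|^2 +
  4 |t|, which controls the weights on compact sets up to the axis. The 4 accommodates the slope of
  the Carnot-Caratheodory profile, which stays below pi in absolute value.\<close>

locale homogeneous_profile =
  fixes \<phi> \<kappa> \<kappa>' :: "real \<Rightarrow> real"
  assumes DERIV_phi: "DERIV \<phi> \<tau> :> \<kappa> \<tau>"
    and DERIV_kappa: "DERIV \<kappa> \<tau> :> \<kappa>' \<tau>"
    and isCont_kappa': "isCont \<kappa>' \<tau>"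
    and phi_ge_1: "\<phi> \<tau> \<ge> 1"
    and phi_ge_abs: "\<bar>\<tau>\<bar> \<le> \<phi> \<tau>"
    and phi_le: "\<phi> \<tau> \<le> 1 + 4 * \<bar>\<tau>\<bar>"
begin

lemma phi_pos: "\<phi> \<tau> > 0" using phi_ge_1[of \<tau>] by linarith

text \<open>The squared norm d^2 off the axis. On the axis the formula gives 0, which affects no
  integral because the axis is a null set.\<close>

definition Phi :: "'e::real_inner \<times> real \<Rightarrow> real" where
  "Phi P = (fst P \<bullet> fst P) * \<phi> (snd P / (fst P \<bullet> fst P))"

lemma Phi_pos: "fst P \<noteq> 0 \<Longrightarrow> Phi P > 0"
  using phi_pos by (simp add: Phi_def)

text \<open>|z|^2 and |t| both lie below \<open>Phi\<close>, hence so does half their sum, and this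
  continuous function has a positive minimum on a compact set that misses the origin. The constants
  do not deteriorate towards the axis, although \<open>Phi\<close> is not continuous there.\<close>

lemma Phi_bounds:
  assumes "compact K" "0 \<notin> K"
  obtains c C where "c > 0" "\<And>P. P \<in> K \<Longrightarrow> fst P \<noteq> 0 \<Longrightarrow> c \<le> Phi (P::'e::euclidean_space \<times> real) \<and> Phi P \<le> C"
proof (cases "K = {}")
  case True then show ?thesis using that[of 1] by auto
next
  case False
  have "continuous_on K (\<lambda>P. (fst P \<bullet> fst P) + \<bar>snd P\<bar>)" by (intro continuous_intros)
  from continuous_attains_inf[OF assms(1) False this]
  obtain P0 where P0: "P0 \<in> K" "\<And>P. P \<in> K \<Longrightarrow> (fst P0 \<bullet> fst P0) + \<bar>snd P0\<bar> \<le> (fst P \<bullet> fst P) + \<bar>snd P\<bar>" by auto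
  have "continuous_on K (\<lambda>P. (fst P \<bullet> fst P) + 4 * \<bar>snd P\<bar>)" by (intro continuous_intros)
  from continuous_attains_sup[OF assms(1) False this]
  obtain P1 where P1: "P1 \<in> K" "\<And>P. P \<in> K \<Longrightarrow> (fst P \<bullet> fst P) + 4 * \<bar>snd P\<bar> \<le> (fst P1 \<bullet> fst P1) + 4 * \<bar>snd P1\<bar>" by auto
  show ?thesis
  proof (rule that)
    have "P0 \<noteq> 0" using P0 assms by auto
    then have "fst P0 \<noteq> 0 \<or> snd P0 \<noteq> 0" by (auto simp: prod_eq_iff)
    then show "((fst P0 \<bullet> fst P0) + \<bar>snd P0\<bar>) / 2 > 0"
      by (auto intro: add_pos_nonneg add_nonneg_pos)
    fix P assume P: "P \<in> K" "fst P \<noteq> 0"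
    define m t where "m = fst P \<bullet> fst P" and "t = snd P"
    have m: "m > 0" using P by (simp add: m_def)
    have 1: "m \<le> m * \<phi> (t / m)" using mult_left_mono[OF phi_ge_1[of "t / m"], of m] m by simp
    have 2: "\<bar>t\<bar> \<le> m * \<phi> (t / m)" using mult_left_mono[OF phi_ge_abs[of "t / m"], of m] m by simp
    have 3: "m * \<phi> (t / m) \<le> m + 4 * \<bar>t\<bar>" using mult_left_mono[OF phi_le[of "t / m"], of m] m by (simp add: distrib_left)
    have "Phi P = m * \<phi> (t / m)" by (simp add: Phi_def m_def t_def)
    then show "((fst P0 \<bullet> fst P0) + \<bar>snd P0\<bar>) / 2 \<le> Phi P \<and> Phi P \<le> (fst P1 \<bullet> fst P1) + 4 * \<bar>snd P1\<bar>"
      using 1 2 3 P0(2)[OF P(1)] P1(2)[OF P(1)] by (simp add: m_def t_def)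
  qed
qed

definition psi :: "real \<Rightarrow> real \<Rightarrow> real" where "psi q \<tau> = \<phi> \<tau> powr (- q)"

definition psi' :: "real \<Rightarrow> real \<Rightarrow> real" where "psi' q \<tau> = - q * psi q \<tau> * \<kappa> \<tau> / \<phi> \<tau>"

text \<open>With |z|^(-2q) factored out, the coefficient of z in F is psi + (2/N) (psi + \<tau>
  psi'). The second summand comes from the t-derivative of w = 2 t d^(-2q): J applied to the part 2
  J z dw/dt of the horizontal gradient returns a multiple of z.\<close>

definition radial_coeff :: "real \<Rightarrow> real \<Rightarrow> real \<Rightarrow> real" where
  "radial_coeff N q \<tau> = psi q \<tau> * ((N + 2) / N - 2 * q / N * (\<tau> * \<kappa> \<tau> / \<phi> \<tau>))"

definition radial_coeff' :: "real \<Rightarrow> real \<Rightarrow> real \<Rightarrow> real" where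
  "radial_coeff' N q \<tau> = psi' q \<tau> * ((N + 2) / N - 2 * q / N * (\<tau> * \<kappa> \<tau> / \<phi> \<tau>))
     - psi q \<tau> * (2 * q / N * (((\<kappa> \<tau> + \<tau> * \<kappa>' \<tau>) * \<phi> \<tau> - \<tau> * \<kappa> \<tau> * \<kappa> \<tau>) / (\<phi> \<tau> * \<phi> \<tau>)))"

text \<open>The coefficient of J z in F, equal to (2q/N) \<tau> psi (1 - \<tau> \<kappa>/\<phi>).
  Expressed through \<open>radial_coeff\<close>, its derivative contains \<tau>
  \<open>radial_coeff'\<close>, which cancels in the divergence.\<close>

definition rot_coeff :: "real \<Rightarrow> real \<Rightarrow> real \<Rightarrow> real" where
  "rot_coeff N q \<tau> = \<tau> * (radial_coeff N q \<tau> - (N + 2 - 2 * q) / N * psi q \<tau>)"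

definition rot_coeff' :: "real \<Rightarrow> real \<Rightarrow> real \<Rightarrow> real" where
  "rot_coeff' N q \<tau> = radial_coeff N q \<tau> - (N + 2 - 2 * q) / N * psi q \<tau>
     + \<tau> * (radial_coeff' N q \<tau> - (N + 2 - 2 * q) / N * psi' q \<tau>)"

lemma DERIV_psi: "DERIV (psi q) \<tau> :> psi' q \<tau>"
proof -
  have "DERIV (\<lambda>\<tau>. \<phi> \<tau> powr (- q)) \<tau> :> - q * \<phi> \<tau> powr (- q - 1) * \<kappa> \<tau>"
    using phi_pos[of \<tau>] DERIV_phi[of \<tau>] by (auto intro!: derivative_eq_intros)
  then show ?thesis
    using phi_pos[of \<tau>] by (simp add: psi_def[abs_def] psi'_def powr_diff)
qed

lemma DERIV_radial_coeff: "DERIV (radial_coeff N q) \<tau> :> radial_coeff' N q \<tau>"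
proof -
  have "DERIV (\<lambda>\<tau>. \<tau> * \<kappa> \<tau> / \<phi> \<tau>) \<tau> :> ((\<kappa> \<tau> + \<tau> * \<kappa>' \<tau>) * \<phi> \<tau> - \<tau> * \<kappa> \<tau> * \<kappa> \<tau>) / (\<phi> \<tau> * \<phi> \<tau>)"
    using phi_pos[of \<tau>] by (auto intro!: derivative_eq_intros DERIV_phi DERIV_kappa)
  from DERIV_mult[OF DERIV_psi DERIV_diff[OF DERIV_const DERIV_cmult[OF this]], of q "(N + 2) / N" "2 * q / N"]
  show ?thesis unfolding radial_coeff_def[abs_def] radial_coeff'_def
    by (rule DERIV_cong) (simp add: algebra_simps)
qed

lemma DERIV_rot_coeff: "DERIV (rot_coeff N q) \<tau> :> rot_coeff' N q \<tau>"
  unfolding rot_coeff_def[abs_def] rot_coeff'_def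
  by (rule DERIV_cong[OF DERIV_mult[OF DERIV_ident DERIV_diff[OF DERIV_radial_coeff DERIV_cmult[OF DERIV_psi]]]])
    (simp add: algebra_simps)

lemma continuous_on_phi: "continuous_on UNIV \<phi>"
  using DERIV_isCont[OF DERIV_phi] by (simp add: continuous_at_imp_continuous_on)

lemma continuous_on_coeffs:
  "continuous_on UNIV (radial_coeff N q)" "continuous_on UNIV (radial_coeff' N q)"
  "continuous_on UNIV (rot_coeff N q)" "continuous_on UNIV (rot_coeff' N q)"
proof -
  have k: "continuous_on UNIV \<kappa>" "continuous_on UNIV \<kappa>'"
    using DERIV_isCont[OF DERIV_kappa] isCont_kappa' by (simp_all add: continuous_at_imp_continuous_on)
  have nz: "\<phi> \<tau> \<noteq> 0" for \<tau> using phi_pos[of \<tau>] by simp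
  have p: "continuous_on UNIV (psi q)"
    unfolding psi_def[abs_def] by (intro continuous_intros continuous_on_phi) (use nz in auto)
  have p': "continuous_on UNIV (psi' q)"
    unfolding psi'_def[abs_def] by (intro continuous_intros continuous_on_phi p k) (use nz in auto)
  show r: "continuous_on UNIV (radial_coeff N q)"
    unfolding radial_coeff_def[abs_def] by (intro continuous_intros continuous_on_phi p k) (use nz in auto)
  show r': "continuous_on UNIV (radial_coeff' N q)"
    unfolding radial_coeff'_def[abs_def] by (intro continuous_intros continuous_on_phi p p' k) (use nz in auto)
  show "continuous_on UNIV (rot_coeff N q)"
    unfolding rot_coeff_def[abs_def] by (intro continuous_intros r p)
  show "continuous_on UNIV (rot_coeff' N q)"
    unfolding rot_coeff'_def[abs_def] by (intro continuous_intros r r' p p')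
qed

text \<open>The identity div F = (Q - p \<theta>) d^(-p \<theta>) in terms of \<tau>, for N = Q - 2
  and 2q = p \<theta>. The derivatives of \<open>radial_coeff\<close> cancel, so the second
  derivative of the profile drops out.\<close>

lemma coeff_ode:
  assumes "N \<noteq> 0"
  shows "(N - 2 * q) * radial_coeff N q \<tau> - 2 * \<tau> * radial_coeff' N q \<tau> + 2 * rot_coeff' N q \<tau>
    = (N + 2 - 2 * q) * psi q \<tau>"
proof -
  define e where "e = \<tau> * \<kappa> \<tau> / \<phi> \<tau>"
  have p': "\<tau> * psi' q \<tau> = - q * psi q \<tau> * e" by (simp add: psi'_def e_def)
  have "N * ((N - 2 * q) * radial_coeff N q \<tau> - 2 * \<tau> * radial_coeff' N q \<tau> + 2 * rot_coeff' N q \<tau>)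
      = N * (N + 2 - 2 * q) * radial_coeff N q \<tau> - 2 * (N + 2 - 2 * q) * (psi q \<tau> + \<tau> * psi' q \<tau>)"
    using assms by (simp add: rot_coeff'_def field_simps)
  also have "\<dots> = N * ((N + 2 - 2 * q) * psi q \<tau>)"
    unfolding p' radial_coeff_def e_def[symmetric] using assms by (simp add: field_simps)
  finally show ?thesis using assms by simp
qed

text \<open>z and J z are orthogonal and of equal length, so the left side is |F|^2 up to a power of
  |z|. The factor in parentheses is what has to be compared with \<phi> for each of the two
  norms.\<close>

lemma coeff_sq_sum:
  assumes "N \<noteq> 0"
  shows "(radial_coeff N q \<tau>)\<^sup>2 + (rot_coeff N q \<tau>)\<^sup>2 = (psi q \<tau>)\<^sup>2 *
    (((N + 2) / N - 2 * q / N * (\<tau> * \<kappa> \<tau> / \<phi> \<tau>))\<^sup>2 + (2 * q / N * \<tau> * (1 - \<tau> * \<kappa> \<tau> / \<phi> \<tau>))\<^sup>2)"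
proof -
  have "rot_coeff N q \<tau> = psi q \<tau> * (2 * q / N * \<tau> * (1 - \<tau> * \<kappa> \<tau> / \<phi> \<tau>))"
    using assms by (simp add: rot_coeff_def radial_coeff_def add_divide_distrib diff_divide_distrib algebra_simps)
  then show ?thesis by (simp only: radial_coeff_def power_mult_distrib distrib_left)
qed

text \<open>With $d^2 = \Phi$ and $w = 2 t d^{-2q}$ this is $d^{-2q} z - \frac{1}{2N} J \nabla_H w$:
  the vertical part $2 t \partial_t$ of the dilation field, turned into a horizontal one by writing
  $\partial_t$ as a sum of commutators.\<close>

definition hfield :: "real \<Rightarrow> real \<Rightarrow> ('a::real_inner \<times> 'a) \<times> real \<Rightarrow> 'a \<times> 'a" where
  "hfield N q P = pullback q (radial_coeff N q) P *\<^sub>R fst P + pullback q (rot_coeff N q) P *\<^sub>R symJ (fst P)"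

text \<open>The weak form of div F = (N + 2 - 2q) d^(-2q). The vector at which f' is evaluated is
  the horizontal lift of F, so only the horizontal gradient of f is involved. The function f has to
  vanish near the axis because the coefficients of F blow up there.\<close>

lemma hfield_integration_by_parts:
  fixes f :: "('a::euclidean_space \<times> 'a) \<times> real \<Rightarrow> real"
  assumes f: "\<And>P. (f has_derivative f' P) (at P)" "\<And>v. continuous_on UNIV (\<lambda>P. f' P v)"
    and K: "compact K" "\<And>P. P \<notin> K \<Longrightarrow> f P = 0"
    and e: "e > 0" "\<And>P. norm (fst P) < e \<Longrightarrow> f P = 0"
  defines "N \<equiv> real DIM('a \<times> 'a)"
  shows "integrable lborel (\<lambda>P. (N + 2 - 2 * q) * (f P * Phi P powr (- q)) + f' P (hfield N q P, 2 * (hfield N q P \<bullet> symJ (fst P)))) \<and>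
     (LINT P|lborel. (N + 2 - 2 * q) * (f P * Phi P powr (- q)) + f' P (hfield N q P, 2 * (hfield N q P \<bullet> symJ (fst P)))) = 0"
proof -
  have N: "N \<noteq> 0" unfolding N_def by simp
  define A A' B B' where "A = radial_coeff N q" and "A' = radial_coeff' N q"
    and "B = rot_coeff N q" and "B' = rot_coeff' N q"
  have dA: "DERIV A \<tau> :> A' \<tau>" and dB: "DERIV B \<tau> :> B' \<tau>" for \<tau>
    unfolding A_def A'_def B_def B'_def by (rule DERIV_radial_coeff DERIV_rot_coeff)+
  have cA: "continuous_on UNIV A" "continuous_on UNIV A'" and cB: "continuous_on UNIV B" "continuous_on UNIV B'"
    unfolding A_def A'_def B_def B'_def by (rule continuous_on_coeffs)+
  define U' where "U' P v = f P * pullback_deriv q A A' P v + f' P v * pullback q A P" for P v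
  define W' where "W' P v = f P * pullback_deriv q B B' P v + f' P v * pullback q B P" for P v
  note mA = C1_mult_vanishing_near_axis[OF f e pullback_has_derivative[OF _ dA] continuous_on_pullback_deriv[OF cA]]
  note mB = C1_mult_vanishing_near_axis[OF f e pullback_has_derivative[OF _ dB] continuous_on_pullback_deriv[OF cB]]
  have U: "integrable lborel (\<lambda>P. N * (f P * pullback q A P) + U' P (fst P, 0)) \<and>
      (LINT P|lborel. N * (f P * pullback q A P) + U' P (fst P, 0)) = 0"
    unfolding N_def
    by (rule integral_divergence_radial[OF _ _ K(1)])
      (use mA(1,2) K(2) in \<open>auto simp: U'_def[abs_def]\<close>)
  have W: "integrable lborel (\<lambda>P. W' P (symJ (fst P), 2 * (norm (fst P))\<^sup>2)) \<and>
      (LINT P|lborel. W' P (symJ (fst P), 2 * (norm (fst P))\<^sup>2)) = 0"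
    by (rule integral_divergence_rotational[OF _ _ K(1), where W = "\<lambda>P. f P * pullback q B P"])
      (use mB(1,2) K(2) in \<open>auto simp: W'_def[abs_def]\<close>)
  have eq: "(N * (f P * pullback q A P) + U' P (fst P, 0)) + W' P (symJ (fst P), 2 * (norm (fst P))\<^sup>2)
     = (N + 2 - 2 * q) * (f P * Phi P powr (- q)) + f' P (hfield N q P, 2 * (hfield N q P \<bullet> symJ (fst P)))" for P
  proof (cases "fst P = 0")
    case True
    then have "f P = 0" "f' P v = 0" for v using e mA(3)[of P v] by auto
    then show ?thesis by (simp add: U'_def W'_def)
  next
    case False
    define m \<tau> where "m = fst P \<bullet> fst P" and "\<tau> = snd P / m"
    have m: "m > 0" using False by (simp add: m_def)
    have pA: "pullback_deriv q A A' P (fst P, 0) = m powr (- q) * (- 2 * q * A \<tau> - 2 * \<tau> * A' \<tau>)"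
      using pullback_deriv_radial[OF False] by (simp add: m_def \<tau>_def)
    have pB: "pullback_deriv q B B' P (symJ (fst P), 2 * (norm (fst P))\<^sup>2) = m powr (- q) * (2 * B' \<tau>)"
      using pullback_deriv_rotational[OF False] by (simp add: m_def \<tau>_def)
    have pa: "pullback q A P = m powr (- q) * A \<tau>" by (simp add: pullback_def m_def \<tau>_def)
    have "N * pullback q A P + pullback_deriv q A A' P (fst P, 0) + pullback_deriv q B B' P (symJ (fst P), 2 * (norm (fst P))\<^sup>2)
       = m powr (- q) * ((N - 2 * q) * A \<tau> - 2 * \<tau> * A' \<tau> + 2 * B' \<tau>)"
      unfolding pA pB pa by (simp add: algebra_simps)
    also have "\<dots> = (N + 2 - 2 * q) * (m powr (- q) * psi q \<tau>)"
      unfolding A_def A'_def B'_def coeff_ode[OF N] by simp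
    also have "m powr (- q) * psi q \<tau> = Phi P powr (- q)"
      using m phi_pos[of \<tau>] by (simp add: Phi_def psi_def m_def \<tau>_def powr_mult)
    finally have 1: "N * pullback q A P + pullback_deriv q A A' P (fst P, 0) + pullback_deriv q B B' P (symJ (fst P), 2 * (norm (fst P))\<^sup>2)
       = (N + 2 - 2 * q) * Phi P powr (- q)" .
    have "hfield N q P \<bullet> symJ (fst P) = pullback q B P * (fst P \<bullet> fst P)"
      by (simp add: hfield_def inner_add_left A_def B_def)
    then have "(hfield N q P, 2 * (hfield N q P \<bullet> symJ (fst P))) =
        pullback q A P *\<^sub>R (fst P, 0) + pullback q B P *\<^sub>R (symJ (fst P), 2 * (norm (fst P))\<^sup>2)"
      by (simp add: hfield_def A_def B_def power2_norm_eq_inner)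
    then have 2: "f' P (hfield N q P, 2 * (hfield N q P \<bullet> symJ (fst P))) =
        pullback q A P * f' P (fst P, 0) + pullback q B P * f' P (symJ (fst P), 2 * (norm (fst P))\<^sup>2)"
      using has_derivative_linear[OF f(1)[of P]] by (simp add: linear_add linear_cmul del: scaleR_Pair)
    have "(N * (f P * pullback q A P) + U' P (fst P, 0)) + W' P (symJ (fst P), 2 * (norm (fst P))\<^sup>2)
      = f P * (N * pullback q A P + pullback_deriv q A A' P (fst P, 0) + pullback_deriv q B B' P (symJ (fst P), 2 * (norm (fst P))\<^sup>2))
        + (pullback q A P * f' P (fst P, 0) + pullback q B P * f' P (symJ (fst P), 2 * (norm (fst P))\<^sup>2))"
      by (simp add: U'_def W'_def algebra_simps)
    then show ?thesis unfolding 1 2 by simp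
  qed
  show ?thesis unfolding eq[symmetric] using U W by simp
qed

text \<open>|F|^2 equals |z|^2 d^(-4q) times the left side of the hypothesis \<open>G\<close>; the
  factor \<phi> on its right side turns |z|^2 into d^2.\<close>

lemma norm_hfield_le:
  fixes P :: "('a::real_inner \<times> 'a) \<times> real"
  assumes N: "N \<noteq> 0" and M: "M \<ge> 0" and z: "fst P \<noteq> 0"
    and G: "\<And>\<tau>. (((N + 2) / N - 2 * q / N * (\<tau> * \<kappa> \<tau> / \<phi> \<tau>))\<^sup>2 + (2 * q / N * \<tau> * (1 - \<tau> * \<kappa> \<tau> / \<phi> \<tau>))\<^sup>2) \<le> M\<^sup>2 * \<phi> \<tau>"
  shows "norm (hfield N q P) \<le> M * Phi P powr (1/2 - q)"
proof (rule power2_le_imp_le)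
  define m \<tau> where "m = fst P \<bullet> fst P" and "\<tau> = snd P / m"
  have m: "m > 0" using z by (simp add: m_def)
  have Ph: "Phi P = m * \<phi> \<tau>" "Phi P > 0" using Phi_pos[OF z] by (simp_all add: Phi_def m_def \<tau>_def)
  have sq: "x powr (- q) * x powr (- q) * x = (x powr (1/2 - q))\<^sup>2" if "x > 0" for x
  proof -
    have "x powr (- q) * x powr (- q) * x powr 1 = x powr (1/2 - q) * x powr (1/2 - q)"
      unfolding powr_add[symmetric] by simp
    then show ?thesis using that by (simp add: power2_eq_square)
  qed
  have "(norm (hfield N q P))\<^sup>2 = ((pullback q (radial_coeff N q) P)\<^sup>2 + (pullback q (rot_coeff N q) P)\<^sup>2) * m"
    unfolding power2_norm_eq_inner hfield_def m_def
    by (simp add: inner_add_left inner_add_right power2_eq_square algebra_simps)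
  also have "\<dots> = (m powr (- q))\<^sup>2 * m * ((radial_coeff N q \<tau>)\<^sup>2 + (rot_coeff N q \<tau>)\<^sup>2)"
    by (simp add: pullback_def m_def[symmetric] \<tau>_def[symmetric] power_mult_distrib algebra_simps)
  also have "\<dots> \<le> (m powr (- q))\<^sup>2 * m * ((psi q \<tau>)\<^sup>2 * (M\<^sup>2 * \<phi> \<tau>))"
    unfolding coeff_sq_sum[OF N] by (intro mult_left_mono G) (use m in auto)
  also have "\<dots> = M\<^sup>2 * (Phi P powr (- q) * Phi P powr (- q) * Phi P)"
    unfolding Ph(1) psi_def using m phi_pos[of \<tau>] by (simp add: powr_mult power2_eq_square)
  also have "\<dots> = (M * Phi P powr (1/2 - q))\<^sup>2"
    unfolding sq[OF Ph(2)] by (simp add: power_mult_distrib)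
  finally show "(norm (hfield N q P))\<^sup>2 \<le> (M * Phi P powr (1/2 - q))\<^sup>2" .
qed (use M in simp)

end

section \<open>The Hardy inequality for a homogeneous profile\<close>

lemma smooth_fun_has_derivative:
  assumes "smooth_fun u" shows "(u has_derivative frechet_derivative u (at P)) (at P)"
proof -
  have "iter_dd [] u differentiable (at P)" using assms unfolding smooth_fun_def by blast
  then show ?thesis by (simp add: frechet_derivative_works)
qed

lemma smooth_fun_continuous_derivative:
  assumes "smooth_fun u" shows "continuous_on UNIV (\<lambda>P. frechet_derivative u (at P) v)"
proof -
  have "iter_dd [v] u differentiable (at P)" for P using assms unfolding smooth_fun_def by blast
  then have "isCont (\<lambda>P. ddir u P v) P" for P
    by (simp add: differentiable_imp_continuous_within)
  then show ?thesis unfolding ddir_def by (simp add: continuous_at_imp_continuous_on)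
qed

definition hgrad :: "('n::finite heis \<Rightarrow> real) \<Rightarrow> 'n heis \<Rightarrow> (real^'n) \<times> (real^'n)" where
  "hgrad u P = (\<chi> i. Xodd i u P, \<chi> i. Xeven i u P)"

lemma hgrad_norm_eq: "hgrad_norm u P = norm (hgrad u P)"
  by (simp add: hgrad_norm_def hgrad_def norm_prod_def norm_vec_def L2_set_def sum_nonneg sum.distrib)

lemma horizontal_derivative_eq:
  fixes u :: "'n::finite heis \<Rightarrow> real"
  assumes u: "(u has_derivative frechet_derivative u (at P)) (at P)"
  shows "frechet_derivative u (at P) (w, 2 * (w \<bullet> symJ (fst P))) = w \<bullet> hgrad u P"
proof -
  define D where "D = frechet_derivative u (at P)"
  have D: "linear D" unfolding D_def by (rule has_derivative_linear[OF u])
  have o: "D ((axis i 1, 0), 2 * snd (fst P) $ i) = Xodd i u P" for i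
  proof -
    have "((axis i 1, 0), 2 * snd (fst P) $ i) = ((axis i 1, 0), 0) + (2 * snd (fst P) $ i) *\<^sub>R ((0::real^'n, 0::real^'n), 1::real)"
      by (simp add: prod_eq_iff)
    then show ?thesis using D by (simp add: Xodd_def ddir_def D_def[symmetric] linear_add linear_cmul del: scaleR_Pair add_Pair)
  qed
  have e: "D ((0, axis i 1), - 2 * fst (fst P) $ i) = Xeven i u P" for i
  proof -
    have "((0, axis i 1), - 2 * fst (fst P) $ i) = ((0, axis i 1), 0) + (- 2 * fst (fst P) $ i) *\<^sub>R ((0::real^'n, 0::real^'n), 1::real)"
      by (simp add: prod_eq_iff)
    then show ?thesis using D by (simp only: Xeven_def ddir_def D_def[symmetric] linear_add linear_cmul) simp
  qed
  have "(w, 2 * (w \<bullet> symJ (fst P))) =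
      (\<Sum>i\<in>UNIV. (fst w $ i) *\<^sub>R ((axis i 1, 0), 2 * snd (fst P) $ i)) + (\<Sum>i\<in>UNIV. (snd w $ i) *\<^sub>R ((0, axis i 1), - 2 * fst (fst P) $ i))"
    by (simp add: prod_eq_iff fst_sum snd_sum vec_eq_iff axis_def if_distrib symJ_def inner_prod_def
        inner_vec_def sum_distrib_left sum_negf mult.left_commute cong: if_cong)
  then have "D (w, 2 * (w \<bullet> symJ (fst P))) = (\<Sum>i\<in>UNIV. fst w $ i * Xodd i u P) + (\<Sum>i\<in>UNIV. snd w $ i * Xeven i u P)"
    using D by (simp only: linear_add linear_sum linear_cmul o e) simp
  then show ?thesis by (simp add: D_def hgrad_def inner_prod_def inner_vec_def)
qed

lemma continuous_on_hgrad_norm: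
  assumes "smooth_fun u" shows "continuous_on UNIV (hgrad_norm u)"
  unfolding hgrad_norm_def[abs_def] Xodd_def Xeven_def ddir_def
  by (intro continuous_intros smooth_fun_continuous_derivative[OF assms])

text \<open>A cut-off that rises from 0 on y \<le> 1 to 1 on y \<ge> 2. It is only C^1, which is
  enough for one integration by parts, and composing truncated squares gives an explicit derivative
  bounded by 4.\<close>

definition smooth_step :: "real \<Rightarrow> real" where
  "smooth_step y = 1 - (max 0 (1 - (max 0 (y - 1))\<^sup>2))\<^sup>2"

definition smooth_step' :: "real \<Rightarrow> real" where
  "smooth_step' y = 4 * max 0 (1 - (max 0 (y - 1))\<^sup>2) * max 0 (y - 1)"

lemma DERIV_smooth_step: "DERIV smooth_step y :> smooth_step' y"
proof -
  have 1: "DERIV (\<lambda>y::real. (max 0 (y - 1))\<^sup>2) y :> 2 * max 0 (y - 1) * 1"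
    by (rule DERIV_chain2[OF DERIV_pos_square]) (auto intro!: derivative_eq_intros)
  have 2: "DERIV (\<lambda>y::real. 1 - (max 0 (y - 1))\<^sup>2) y :> 0 - 2 * max 0 (y - 1) * 1"
    by (rule DERIV_diff[OF DERIV_const 1])
  have 3: "DERIV (\<lambda>y::real. (max 0 (1 - (max 0 (y - 1))\<^sup>2))\<^sup>2) y :>
      2 * max 0 (1 - (max 0 (y - 1))\<^sup>2) * (0 - 2 * max 0 (y - 1) * 1)"
    by (rule DERIV_chain2[OF DERIV_pos_square 2])
  show ?thesis unfolding smooth_step_def[abs_def] smooth_step'_def
    by (rule DERIV_cong[OF DERIV_diff[OF DERIV_const 3]]) simp
qed

lemma smooth_step_props:
  "0 \<le> smooth_step y" "smooth_step y \<le> 1" "y \<le> 1 \<Longrightarrow> smooth_step y = 0" "y \<ge> 2 \<Longrightarrow> smooth_step y = 1"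
proof -
  have "max 0 (1 - (max 0 (y - 1))\<^sup>2) \<le> 1" by simp
  then have "(max 0 (1 - (max 0 (y - 1))\<^sup>2))\<^sup>2 \<le> 1" by (simp add: power_le_one)
  then show "0 \<le> smooth_step y" by (simp add: smooth_step_def)
  show "y \<le> 1 \<Longrightarrow> smooth_step y = 0" by (simp add: smooth_step_def)
  show "smooth_step y = 1" if "y \<ge> 2"
  proof -
    have "1 \<le> (max 0 (y - 1))\<^sup>2" using that one_le_power[of "y - 1" 2] by simp
    then show ?thesis by (simp add: smooth_step_def)
  qed
qed (simp add: smooth_step_def)

lemma smooth_step'_props:
  "0 \<le> smooth_step' y" "smooth_step' y \<le> 4" "y \<ge> 2 \<Longrightarrow> smooth_step' y = 0"
proof -
  show "0 \<le> smooth_step' y" by (simp add: smooth_step'_def)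
  show z: "smooth_step' y = 0" if "y \<ge> 2"
  proof -
    have "1 \<le> (max 0 (y - 1))\<^sup>2" using that one_le_power[of "y - 1" 2] by simp
    then show ?thesis by (simp add: smooth_step'_def)
  qed
  show "smooth_step' y \<le> 4"
  proof (cases "y \<ge> 2")
    case False
    then have "max 0 (1 - (max 0 (y - 1))\<^sup>2) * max 0 (y - 1) \<le> 1 * 1" by (intro mult_mono) auto
    then show ?thesis by (simp add: smooth_step'_def)
  qed (simp add: z)
qed

lemma continuous_on_smooth_step': "continuous_on A smooth_step'"
  unfolding smooth_step'_def[abs_def] by (intro continuous_intros)

lemma powr_le_endpoints:
  fixes x c C r :: real
  assumes "0 < c" "c \<le> x" "x \<le> C" shows "x powr r \<le> c powr r + C powr r"
proof (cases "r \<ge> 0")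
  case True
  then have "x powr r \<le> C powr r" using assms by (intro powr_mono2) auto
  then show ?thesis by (simp add: add_increasing)
next
  case False
  then have "x powr r \<le> c powr r" using assms by (intro powr_mono2') auto
  then show ?thesis by (simp add: add_increasing2)
qed

lemma integrable_bounded_compact_support:
  fixes g :: "'a::euclidean_space \<Rightarrow> real"
  assumes "g \<in> borel_measurable borel" "compact K" "\<And>x. x \<in> K \<Longrightarrow> \<bar>g x\<bar> \<le> B" "\<And>x. x \<notin> K \<Longrightarrow> g x = 0"
  shows "integrable lborel g"
proof (rule Bochner_Integration.integrable_bound)
  show "integrable lborel (\<lambda>x. indicator K x *\<^sub>R B)"
    using assms by (intro borel_integrable_compact) auto
  show "AE x in lborel. norm (g x) \<le> norm (indicator K x *\<^sub>R B)"
    using assms(3,4) by (intro AE_I2) (auto simp: indicator_def intro: order_trans[OF _ abs_ge_self])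
qed (use assms in auto)

lemma measure_axis_tube:
  assumes "r \<ge> 0" "R \<ge> 0"
  shows "emeasure lborel (cball (0::'e::euclidean_space) r \<times> {-R..R::real}) =
    ennreal (unit_ball_vol DIM('e) * r ^ DIM('e) * (2 * R))"
proof -
  have "emeasure (lborel \<Otimes>\<^sub>M lborel) (cball (0::'e) r \<times> {-R..R::real}) =
      emeasure lborel (cball (0::'e) r) * emeasure lborel {-R..R}"
    by (rule lborel.emeasure_pair_measure_Times) auto
  then show ?thesis
    using assms by (simp add: lborel_prod emeasure_cball ennreal_mult[symmetric] unit_ball_vol_nonneg)
qed

text \<open>Both norms are known through their profile only off the axis; this permits replacing d
  by \<open>Phi\<close> powers under the integral.\<close>

lemma AE_off_axis: "AE P in (lborel :: ('e::euclidean_space \<times> real) measure). fst P \<noteq> 0"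
proof (rule AE_I)
  have "emeasure (lborel \<Otimes>\<^sub>M lborel) ({0::'e} \<times> (UNIV::real set)) = emeasure lborel {0::'e} * emeasure lborel (UNIV::real set)"
    by (rule lborel.emeasure_pair_measure_Times) auto
  then show "emeasure lborel ({0::'e} \<times> (UNIV::real set)) = 0" by (simp add: lborel_prod)
  show "{0::'e} \<times> (UNIV::real set) \<in> sets lborel" by (auto intro!: borel_closed closed_Times)
qed auto

text \<open>With F = d^2 the weight is divided so that the p-th powers of the two factors carry
  d^(-2q) and d^(p - 2q), the weights on the two sides of the Hardy inequality; the exponents of the
  mixed product then add up to that of the bound for |F|.\<close>

lemma weighted_Young_powr:
  fixes p s M U H F q :: real
  assumes "p > 1" "s > 0" "M \<ge> 0" "U \<ge> 0" "H \<ge> 0" "F > 0"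
  shows "p * U powr (p - 1) * (H * (M * F powr (1/2 - q)))
    \<le> (p - 1) * s * (U powr p * F powr (- q)) + s powr (1 - p) * M powr p * (H powr p * F powr (p / 2 - q))"
proof -
  define x y where "x = U * F powr (- q / p)" and "y = M * H * F powr (1/2 - q / p)"
  have "p * x powr (p - 1) * y \<le> (p - 1) * s * x powr p + s powr (1 - p) * y powr p"
    using assms by (intro weighted_Young) (auto simp: x_def y_def)
  moreover have "x powr p = U powr p * F powr (- q)"
    using assms by (simp add: x_def powr_mult powr_powr)
  moreover have "y powr p = M powr p * (H powr p * F powr (p / 2 - q))"
  proof -
    have "(1/2 - q / p) * p = p / 2 - q" using assms by (simp add: field_simps)
    then show ?thesis using assms by (simp add: y_def powr_mult powr_powr)
  qed
  moreover have "x powr (p - 1) * y = U powr (p - 1) * (H * (M * F powr (1/2 - q)))"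
  proof -
    have "- q / p * (p - 1) + (1/2 - q / p) = 1/2 - q" using assms by (simp add: field_simps)
    then have "(F powr (- q / p)) powr (p - 1) * F powr (1/2 - q / p) = F powr (1/2 - q)"
      unfolding powr_powr powr_add[symmetric] by (simp only:)
    then show ?thesis using assms by (simp add: x_def y_def powr_mult algebra_simps)
  qed
  ultimately show ?thesis by (simp add: mult.assoc)
qed

context homogeneous_profile
begin

lemma Phi_measurable: "Phi \<in> borel_measurable (borel :: ('e::euclidean_space \<times> real) measure)"
proof -
  have m: "(\<lambda>P::'e \<times> real. fst P \<bullet> fst P) \<in> borel_measurable borel"
    by (intro borel_measurable_continuous_onI continuous_intros)
  have t: "(\<lambda>P::'e \<times> real. snd P) \<in> borel_measurable borel"
    by (intro borel_measurable_continuous_onI continuous_intros)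
  have "(\<lambda>P::'e \<times> real. \<phi> (snd P / (fst P \<bullet> fst P))) \<in> borel_measurable borel"
    by (rule measurable_compose[OF borel_measurable_divide[OF t m] borel_measurable_continuous_onI[OF continuous_on_phi]])
  then show ?thesis unfolding Phi_def[abs_def] by (rule borel_measurable_times[OF m])
qed

lemma Phi_powr_bound:
  assumes "compact K" "0 \<notin> K"
  obtains B where "B \<ge> 0" "\<And>P. P \<in> K \<Longrightarrow> Phi (P::'e::euclidean_space \<times> real) powr r \<le> B"
proof -
  obtain c C where c: "c > 0" "\<And>P. P \<in> K \<Longrightarrow> fst P \<noteq> 0 \<Longrightarrow> c \<le> Phi P \<and> Phi P \<le> C"
    using Phi_bounds[OF assms] by blast
  show ?thesis
  proof (rule that)
    show "c powr r + C powr r \<ge> 0" by simp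
    fix P assume P: "P \<in> K"
    show "Phi P powr r \<le> c powr r + C powr r"
    proof (cases "fst P = 0")
      case True then show ?thesis by (simp add: Phi_def)
    next
      case False then show ?thesis using c P by (intro powr_le_endpoints) auto
    qed
  qed
qed

text \<open>The weights are bounded on the support of u, which is compact and avoids the origin, so
  both integrals are finite. Integrability is part of the conclusion because a Bochner integral that
  fails to converge is 0 by convention, and the passage to the nonnegative integrals of
  \<open>hardy_const\<close> depends on it.\<close>

lemma hardy_inequality:
  fixes u :: "'n::finite heis \<Rightarrow> real"
  assumes p: "p \<ge> 2" and u: "u \<in> Cc_inf_punct" and M: "M > 0"
  defines "N \<equiv> 2 * real CARD('n)"
  assumes G: "\<And>\<tau>. (((N + 2) / N - 2 * q / N * (\<tau> * \<kappa> \<tau> / \<phi> \<tau>))\<^sup>2 + (2 * q / N * \<tau> * (1 - \<tau> * \<kappa> \<tau> / \<phi> \<tau>))\<^sup>2) \<le> M\<^sup>2 * \<phi> \<tau>"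
  shows "integrable lborel (\<lambda>P. \<bar>u P\<bar> powr p * Phi P powr (- q)) \<and>
    integrable lborel (\<lambda>P. hgrad_norm u P powr p * Phi P powr (p / 2 - q)) \<and>
    (\<bar>N + 2 - 2 * q\<bar> / (p * M)) powr p * (LINT P|lborel. \<bar>u P\<bar> powr p * Phi P powr (- q))
      \<le> (LINT P|lborel. hgrad_norm u P powr p * Phi P powr (p / 2 - q))"
proof -
  have Nd: "N = real DIM((real^'n) \<times> (real^'n))" and N0: "N \<noteq> 0" by (simp_all add: N_def)
  have sm: "smooth_fun u" using u by (simp add: Cc_inf_punct_def)
  define K where "K = closure {P. u P \<noteq> 0}"
  have K: "compact K" "0 \<notin> K" using u by (simp_all add: Cc_inf_punct_def K_def)
  have uK: "u P = 0" if "P \<notin> K" for P using that closure_subset[of "{P. u P \<noteq> 0}"] by (auto simp: K_def)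
  define D where "D P = frechet_derivative u (at P)" for P
  have dD: "(u has_derivative D P) (at P)" for P unfolding D_def by (rule smooth_fun_has_derivative[OF sm])
  have cD: "continuous_on UNIV (\<lambda>P. D P v)" for v unfolding D_def by (rule smooth_fun_continuous_derivative[OF sm])
  have cu: "continuous_on UNIV u"
    using dD has_derivative_continuous by (intro continuous_at_imp_continuous_on) blast
  have ch: "continuous_on UNIV (hgrad_norm u)" by (rule continuous_on_hgrad_norm[OF sm])
  have hK: "hgrad_norm u P = 0" if "P \<notin> K" for P
  proof -
    have "D P = (\<lambda>_. 0)"
      by (rule has_derivative_zero_off_support[OF compact_imp_closed[OF K(1)] uK dD that])
    then show ?thesis by (simp add: hgrad_norm_def Xodd_def Xeven_def ddir_def D_def)
  qed
  have Dw: "\<bar>D P (w, 2 * (w \<bullet> symJ (fst P)))\<bar> \<le> hgrad_norm u P * norm w" for P w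
    unfolding D_def horizontal_derivative_eq[OF dD[unfolded D_def]] hgrad_norm_eq
    using Cauchy_Schwarz_ineq2[of w "hgrad u P"] by (simp add: mult.commute)
  define g1 g2 where "g1 P = \<bar>u P\<bar> powr p * Phi P powr (- q)"
    and "g2 P = hgrad_norm u P powr p * Phi P powr (p / 2 - q)" for P
  have up: "continuous_on UNIV (\<lambda>P. \<bar>u P\<bar> powr p)"
    using p by (intro continuous_on_powr' continuous_intros cu) auto
  have hp: "continuous_on UNIV (\<lambda>P. hgrad_norm u P powr p)"
    using p by (intro continuous_on_powr' continuous_intros ch) (auto simp: hgrad_norm_eq)
  have "bounded ((\<lambda>P. \<bar>u P\<bar> powr p) ` K)"
    by (intro compact_imp_bounded compact_continuous_image K(1) continuous_on_subset[OF up]) simp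
  then obtain B1 where B1: "\<And>P. P \<in> K \<Longrightarrow> \<bar>u P\<bar> powr p \<le> B1" unfolding bounded_iff by auto
  have "bounded ((\<lambda>P. hgrad_norm u P powr p) ` K)"
    by (intro compact_imp_bounded compact_continuous_image K(1) continuous_on_subset[OF hp]) simp
  then obtain B2 where B2: "\<And>P. P \<in> K \<Longrightarrow> hgrad_norm u P powr p \<le> B2" unfolding bounded_iff by auto
  obtain B3 where B3: "B3 \<ge> 0" "\<And>P. P \<in> K \<Longrightarrow> Phi P powr (- q) \<le> B3" using Phi_powr_bound[OF K] by blast
  obtain B4 where B4: "B4 \<ge> 0" "\<And>P. P \<in> K \<Longrightarrow> Phi P powr (p / 2 - q) \<le> B4" using Phi_powr_bound[OF K] by blast
  obtain B5 where B5: "B5 \<ge> 0" "\<And>P. P \<in> K \<Longrightarrow> Phi P powr (1 / 2 - q) \<le> B5" using Phi_powr_bound[OF K] by blast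
  have g0: "g1 P \<ge> 0" "g2 P \<ge> 0" for P by (simp_all add: g1_def g2_def)
  have mPhi: "(\<lambda>P::'n heis. Phi P powr r) \<in> borel_measurable borel" for r
    by (rule measurable_compose[OF Phi_measurable]) measurable
  have mg1: "g1 \<in> borel_measurable borel" unfolding g1_def[abs_def]
    by (intro borel_measurable_times mPhi borel_measurable_continuous_onI up)
  have ig1: "integrable lborel g1"
  proof (rule integrable_bounded_compact_support[OF mg1 K(1)])
    show "\<bar>g1 P\<bar> \<le> B1 * B3" if "P \<in> K" for P
    proof -
      have "0 \<le> B1" using order_trans[OF powr_ge_zero B1[OF that]] .
      then have "g1 P \<le> B1 * B3" unfolding g1_def using B1[OF that] B3(2)[OF that] by (intro mult_mono) auto
      then show ?thesis using g0 by simp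
    qed
  qed (use uK in \<open>simp add: g1_def\<close>)
  have ig2: "integrable lborel g2"
  proof (rule integrable_bounded_compact_support[OF _ K(1)])
    show "g2 \<in> borel_measurable borel" unfolding g2_def[abs_def]
      by (intro borel_measurable_times mPhi borel_measurable_continuous_onI hp)
    show "\<bar>g2 P\<bar> \<le> B2 * B4" if "P \<in> K" for P
    proof -
      have "0 \<le> B2" using order_trans[OF powr_ge_zero B2[OF that]] .
      then have "g2 P \<le> B2 * B4" unfolding g2_def using B2[OF that] B4(2)[OF that] by (intro mult_mono) auto
      then show ?thesis using g0 by simp
    qed
  qed (use hK in \<open>simp add: g2_def\<close>)
  define S where "S = N + 2 - 2 * q"
  define I1 I2 where "I1 = (LINT P|lborel. g1 P)" and "I2 = (LINT P|lborel. g2 P)"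
  have I20: "I2 \<ge> 0" unfolding I2_def using g0 by simp
  obtain R where R: "\<And>P. P \<in> K \<Longrightarrow> norm P \<le> R" and R0: "R \<ge> 0"
  proof -
    obtain R where "\<And>P. P \<in> K \<Longrightarrow> norm P \<le> R"
      using compact_imp_bounded[OF K(1)] unfolding bounded_iff by blast
    then have "\<And>P. P \<in> K \<Longrightarrow> norm P \<le> max R 0" by (simp add: le_max_iff_disj)
    then show ?thesis using that[of "max R 0"] by simp
  qed
  \<comment> \<open>The parameter s of Young's inequality is kept fixed while the cut-off is
    removed.\<close>
  have main: "\<bar>S\<bar> * I1 \<le> (p - 1) * s * I1 + s powr (1 - p) * M powr p * I2" if s: "s > 0" for s
  proof -
    \<comment> \<open>The shift by 2 ensures 2 \<epsilon> \<le> 1, so that sqrt (2 \<epsilon>) to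
      the power 2n is at most its square.\<close>
    define \<epsilon> where "\<epsilon> k = 1 / (real k + 2)" for k :: nat
    have \<epsilon>: "\<epsilon> k > 0" "2 * \<epsilon> k \<le> 1" for k by (auto simp: \<epsilon>_def)
    define chi where "chi k P = smooth_step ((fst P \<bullet> fst P) / \<epsilon> k)" for k and P :: "'n heis"
    have cut01: "0 \<le> chi k P" "chi k P \<le> 1" for k P by (simp_all add: chi_def smooth_step_props)
    \<comment> \<open>C0 / sqrt \<epsilon> bounds the term with the derivative of the cut-off, which
      lives in the tube \<open>Z\<close> of radius sqrt (2 \<epsilon>). The volume of the tube is at
      most a constant times \<epsilon>, which leaves an error of order sqrt \<epsilon> with constant
      \<open>C1\<close>.\<close>
    define C0 where "C0 = 4 * max B1 0 * (4 * (M * B5))"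
    have C0: "C0 \<ge> 0" unfolding C0_def using M B5(1) by simp
    define Z where "Z k = cball (0::(real^'n) \<times> (real^'n)) (sqrt (2 * \<epsilon> k)) \<times> {-R..R}" for k
    define C1 where "C1 = C0 * (unit_ball_vol (real DIM((real^'n) \<times> (real^'n))) * 2 * (2 * R))"
    have step: "\<bar>S\<bar> * (LINT P|lborel. chi k P * g1 P) \<le> ((p - 1) * s * I1 + s powr (1 - p) * M powr p * I2) + C1 * sqrt (\<epsilon> k)" for k
    proof -
      define f where "f P = chi k P * \<bar>u P\<bar> powr p" for P
      define f' where "f' P v = chi k P * (p * (\<bar>u P\<bar> powr (p - 1) * sgn (u P)) * D P v)
          + smooth_step' ((fst P \<bullet> fst P) / \<epsilon> k) * (2 * (fst P \<bullet> fst v) / \<epsilon> k) * \<bar>u P\<bar> powr p" for P v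
      have m: "((\<lambda>P::'n heis. fst P \<bullet> fst P) has_derivative (\<lambda>v. 2 * (fst P \<bullet> fst v))) (at P)" for P
      proof -
        have f: "((\<lambda>P::'n heis. fst P) has_derivative fst) (at P)"
          by (rule bounded_linear_imp_has_derivative[OF bounded_linear_fst])
        show ?thesis using has_derivative_inner[OF f f]
          by (rule has_derivative_eq_rhs) (simp add: fun_eq_iff inner_commute)
      qed
      have dcut: "(chi k has_derivative (\<lambda>v. smooth_step' ((fst P \<bullet> fst P) / \<epsilon> k) * (2 * (fst P \<bullet> fst v) / \<epsilon> k))) (at P)" for P
      proof -
        have "((\<lambda>P::'n heis. (fst P \<bullet> fst P) / \<epsilon> k) has_derivative (\<lambda>v. 2 * (fst P \<bullet> fst v) / \<epsilon> k)) (at P)"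
          using bounded_linear.has_derivative[OF bounded_linear_divide m] .
        from has_derivative_compose[OF this DERIV_smooth_step[unfolded has_field_derivative_def]]
        show ?thesis unfolding chi_def[abs_def] .
      qed
      have du: "((\<lambda>P. \<bar>u P\<bar> powr p) has_derivative (\<lambda>v. p * (\<bar>u P\<bar> powr (p - 1) * sgn (u P)) * D P v)) (at P)" for P
        using has_derivative_compose[OF dD DERIV_abs_powr[unfolded has_field_derivative_def]] p by simp
      have df: "(f has_derivative f' P) (at P)" for P
        unfolding f_def[abs_def] f'_def[abs_def] by (rule has_derivative_mult[OF dcut du])
      have ccut: "continuous_on UNIV (chi k)"
        using dcut has_derivative_continuous by (intro continuous_at_imp_continuous_on) blast
      have cs: "continuous_on UNIV (\<lambda>P. \<bar>u P\<bar> powr (p - 1) * sgn (u P))"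
      proof -
        have "continuous_on UNIV (\<lambda>x::real. \<bar>x\<bar> powr (p - 1) * sgn x)"
          using isCont_abs_powr_sgn[of "p - 1"] p by (intro continuous_at_imp_continuous_on) auto
        from continuous_on_compose2[OF this cu] show ?thesis by simp
      qed
      have cst: "continuous_on UNIV (\<lambda>P::'n heis. smooth_step' ((fst P \<bullet> fst P) / \<epsilon> k))"
        by (rule continuous_on_compose2[OF continuous_on_smooth_step'[of UNIV]]) (use \<epsilon>(1)[of k] in \<open>auto intro!: continuous_intros\<close>)
      have cf': "continuous_on UNIV (\<lambda>P. f' P v)" for v
        unfolding f'_def using \<epsilon>(1)[of k] by (intro continuous_intros ccut cs cst cD up) auto
      have fK: "f P = 0" if "P \<notin> K" for P using uK[OF that] by (simp add: f_def)
      have fe: "f P = 0" if "norm (fst P) < sqrt (\<epsilon> k)" for P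
      proof -
        have "(norm (fst P))\<^sup>2 < \<epsilon> k" using power_strict_mono[OF that, of 2] \<epsilon>(1)[of k] by simp
        then have "(fst P \<bullet> fst P) / \<epsilon> k \<le> 1" using \<epsilon>(1)[of k] by (simp add: power2_norm_eq_inner)
        then show ?thesis by (simp add: f_def chi_def smooth_step_props)
      qed
      define w :: "'n heis \<Rightarrow> (real^'n) \<times> (real^'n)" where "w = hfield N q"
      define T where "T P = f' P (w P, 2 * (w P \<bullet> symJ (fst P)))" for P
      have ibp: "integrable lborel (\<lambda>P. S * (f P * Phi P powr (- q)) + T P)"
        "(LINT P|lborel. S * (f P * Phi P powr (- q)) + T P) = 0"
        using hfield_integration_by_parts[where q = q and e = "sqrt (\<epsilon> k)", OF df cf' K(1) fK _ fe] \<epsilon>(1)[of k]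
        unfolding Nd[symmetric] S_def[symmetric] w_def[symmetric] T_def[symmetric] by simp_all
      have fg: "f P * Phi P powr (- q) = chi k P * g1 P" for P by (simp add: f_def g1_def)
      have icut: "integrable lborel (\<lambda>P. chi k P * g1 P)"
      proof (rule Bochner_Integration.integrable_bound[OF ig1])
        show "(\<lambda>P. chi k P * g1 P) \<in> borel_measurable lborel"
          using borel_measurable_continuous_onI[OF ccut] mg1 by simp
        show "AE P in lborel. norm (chi k P * g1 P) \<le> norm (g1 P)"
          using cut01 g0 by (intro AE_I2) (simp add: abs_mult mult_left_le_one_le)
      qed
      have iT: "integrable lborel T" and TI: "(LINT P|lborel. T P) = - S * (LINT P|lborel. chi k P * g1 P)"
      proof -
        have "integrable lborel (\<lambda>P. (S * (f P * Phi P powr (- q)) + T P) - S * (chi k P * g1 P))"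
          using ibp(1) icut by (intro Bochner_Integration.integrable_diff integrable_mult_right) auto
        then show iT: "integrable lborel T" by (simp add: fg)
        show "(LINT P|lborel. T P) = - S * (LINT P|lborel. chi k P * g1 P)"
          using ibp(2) iT icut unfolding fg by simp
      qed
      have Tb: "\<bar>T P\<bar> \<le> ((p - 1) * s * g1 P + s powr (1 - p) * M powr p * g2 P) + C0 / sqrt (\<epsilon> k) * indicator (Z k) P" for P
      proof (cases "fst P = 0 \<or> P \<notin> K")
        case True
        have "T P = 0"
        proof (cases "P \<in> K")
          case True
          then have "w P = 0" using \<open>fst P = 0 \<or> P \<notin> K\<close> by (simp add: w_def hfield_def)
          then have "(w P, 2 * (w P \<bullet> symJ (fst P))) = (0, 0)" by (simp only: inner_zero_left mult_zero_right)
          then have "(w P, 2 * (w P \<bullet> symJ (fst P))) = 0" by (simp only: zero_prod_def)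
          then show ?thesis using linear_0[OF has_derivative_linear[OF df[of P]]] by (simp only: T_def)
        next
          case False
          then show ?thesis using uK[OF False] p by (simp add: T_def f'_def)
        qed
        then show ?thesis using g0[of P] s p C0 M \<epsilon>(1)[of k] by (simp add: add_nonneg_nonneg)
      next
        case False
        then have z: "fst P \<noteq> 0" and PK: "P \<in> K" by auto
        have wb: "norm (w P) \<le> M * Phi P powr (1/2 - q)"
          unfolding w_def by (rule norm_hfield_le[OF N0 _ z G]) (use M in simp)
        have "\<bar>T P\<bar> \<le> \<bar>chi k P * (p * (\<bar>u P\<bar> powr (p - 1) * sgn (u P)) * D P (w P, 2 * (w P \<bullet> symJ (fst P))))\<bar>
          + \<bar>smooth_step' ((fst P \<bullet> fst P) / \<epsilon> k) * (2 * (fst P \<bullet> w P) / \<epsilon> k) * \<bar>u P\<bar> powr p\<bar>"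
          unfolding T_def f'_def fst_conv by (rule abs_triangle_ineq)
        moreover have "\<bar>chi k P * (p * (\<bar>u P\<bar> powr (p - 1) * sgn (u P)) * D P (w P, 2 * (w P \<bullet> symJ (fst P))))\<bar>
          \<le> (p - 1) * s * g1 P + s powr (1 - p) * M powr p * g2 P"
        proof -
          have "\<bar>chi k P * (p * (\<bar>u P\<bar> powr (p - 1) * sgn (u P)) * D P (w P, 2 * (w P \<bullet> symJ (fst P))))\<bar>
            = chi k P * (\<bar>sgn (u P)\<bar> * (p * \<bar>u P\<bar> powr (p - 1) * \<bar>D P (w P, 2 * (w P \<bullet> symJ (fst P)))\<bar>))"
            using cut01[of k P] p by (simp add: abs_mult)
          also have "\<dots> \<le> 1 * (1 * (p * \<bar>u P\<bar> powr (p - 1) * (hgrad_norm u P * (M * Phi P powr (1/2 - q)))))"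
          proof (intro mult_mono)
            show "\<bar>D P (w P, 2 * (w P \<bullet> symJ (fst P)))\<bar> \<le> hgrad_norm u P * (M * Phi P powr (1/2 - q))"
              using Dw[of P "w P"] mult_left_mono[OF wb, of "hgrad_norm u P"] by (simp add: hgrad_norm_eq)
          qed (use cut01[of k P] p in \<open>auto simp: sgn_if\<close>)
          also have "\<dots> = p * \<bar>u P\<bar> powr (p - 1) * (hgrad_norm u P * (M * Phi P powr (1/2 - q)))" by simp
          also have "\<dots> \<le> (p - 1) * s * g1 P + s powr (1 - p) * M powr p * g2 P"
            unfolding g1_def g2_def
            by (rule weighted_Young_powr) (use p s M Phi_pos[OF z] in \<open>auto simp: hgrad_norm_eq\<close>)
          finally show ?thesis .
        qed
        \<comment> \<open>The cut-off depends on |z|^2 alone, so its derivative along F involves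
          only z . F / \<epsilon>. In the tube |z| is of order sqrt \<epsilon>, which improves
          1/\<epsilon> to 1/sqrt \<epsilon>.\<close>
        moreover have "\<bar>smooth_step' ((fst P \<bullet> fst P) / \<epsilon> k) * (2 * (fst P \<bullet> w P) / \<epsilon> k) * \<bar>u P\<bar> powr p\<bar>
          \<le> C0 / sqrt (\<epsilon> k) * indicator (Z k) P"
        proof (cases "fst P \<bullet> fst P \<ge> 2 * \<epsilon> k")
          case True
          then have "smooth_step' ((fst P \<bullet> fst P) / \<epsilon> k) = 0"
            using \<epsilon>(1)[of k] by (intro smooth_step'_props) (simp add: field_simps)
          then show ?thesis using C0 \<epsilon>(1)[of k] by simp
        next
          case False
          then have "sqrt ((norm (fst P))\<^sup>2) \<le> sqrt (2 * \<epsilon> k)"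
            by (intro real_sqrt_le_mono) (simp add: power2_norm_eq_inner)
          then have nz: "norm (fst P) \<le> sqrt (2 * \<epsilon> k)" by simp
          have "\<bar>snd P\<bar> \<le> R" using R[OF PK] norm_snd_le[of "snd P" "fst P"] by simp
          then have "P \<in> Z k" using nz by (auto simp: Z_def mem_Times_iff)
          have "\<bar>fst P \<bullet> w P\<bar> \<le> norm (fst P) * norm (w P)" by (rule Cauchy_Schwarz_ineq2)
          also have "norm (fst P) * norm (w P) \<le> sqrt (2 * \<epsilon> k) * (M * B5)"
            using order_trans[OF wb mult_left_mono[OF B5(2)[OF PK]]] M nz \<epsilon>(1)[of k]
            by (intro mult_mono) simp_all
          also have "\<dots> \<le> (2 * sqrt (\<epsilon> k)) * (M * B5)"
          proof (rule mult_right_mono)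
            have "sqrt 2 \<le> 2" using real_sqrt_le_mono[of 2 4] by simp
            then show "sqrt (2 * \<epsilon> k) \<le> 2 * sqrt (\<epsilon> k)"
              using \<epsilon>(1)[of k] by (simp add: real_sqrt_mult)
          qed (use M B5 in simp)
          finally have zw: "\<bar>fst P \<bullet> w P\<bar> \<le> 2 * sqrt (\<epsilon> k) * (M * B5)" by simp
          have "\<bar>2 * (fst P \<bullet> w P) / \<epsilon> k\<bar> = 2 * \<bar>fst P \<bullet> w P\<bar> / \<epsilon> k"
            using \<epsilon>(1)[of k] by (simp add: abs_mult)
          also have "\<dots> \<le> 2 * (2 * sqrt (\<epsilon> k) * (M * B5)) / \<epsilon> k"
            using zw \<epsilon>(1)[of k] by (intro divide_right_mono mult_left_mono) auto
          also have "\<dots> = 4 * (M * B5) / sqrt (\<epsilon> k)"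
            using \<epsilon>(1)[of k] real_sqrt_mult_self[of "\<epsilon> k"] by (simp add: field_simps)
          finally have zz: "\<bar>2 * (fst P \<bullet> w P) / \<epsilon> k\<bar> \<le> 4 * (M * B5) / sqrt (\<epsilon> k)" .
          have "\<bar>smooth_step' ((fst P \<bullet> fst P) / \<epsilon> k) * (2 * (fst P \<bullet> w P) / \<epsilon> k) * \<bar>u P\<bar> powr p\<bar>
            = smooth_step' ((fst P \<bullet> fst P) / \<epsilon> k) * \<bar>2 * (fst P \<bullet> w P) / \<epsilon> k\<bar> * \<bar>u P\<bar> powr p"
            by (simp add: abs_mult smooth_step'_props)
          also have "\<dots> \<le> 4 * (4 * (M * B5) / sqrt (\<epsilon> k)) * max B1 0"
          proof (intro mult_mono)
            show "\<bar>u P\<bar> powr p \<le> max B1 0" using B1[OF PK] by simp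
            show "0 \<le> 4 * (4 * (M * B5) / sqrt (\<epsilon> k))" using M B5 \<epsilon>(1)[of k] by simp
          qed (use zz smooth_step'_props in auto)
          also have "\<dots> = C0 / sqrt (\<epsilon> k)" by (simp add: C0_def)
          finally show ?thesis using \<open>P \<in> Z k\<close> by simp
        qed
        ultimately show ?thesis by linarith
      qed
      have Zm: "emeasure lborel (Z k) = ennreal (unit_ball_vol (real DIM((real^'n) \<times> (real^'n))) * (sqrt (2 * \<epsilon> k)) ^ DIM((real^'n) \<times> (real^'n)) * (2 * R))"
        unfolding Z_def by (rule measure_axis_tube) (use \<epsilon>(1)[of k] R0 in auto)
      have Zs: "Z k \<in> sets lborel" unfolding Z_def by (auto intro!: borel_closed closed_Times)
      have d2: "2 \<le> DIM((real^'n) \<times> (real^'n))"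
      proof -
        have e: "DIM((real^'n) \<times> (real^'n)) = CARD('n) + CARD('n)" by simp
        show ?thesis unfolding e using zero_less_card_finite[where 'a = 'n] by linarith
      qed
      have Zv: "measure lborel (Z k) \<le> unit_ball_vol (real DIM((real^'n) \<times> (real^'n))) * (2 * \<epsilon> k) * (2 * R)"
      proof -
        have "measure lborel (Z k) = unit_ball_vol (real DIM((real^'n) \<times> (real^'n))) * (sqrt (2 * \<epsilon> k)) ^ DIM((real^'n) \<times> (real^'n)) * (2 * R)"
          unfolding measure_def Zm using \<epsilon>(1)[of k] R0 by (intro enn2real_ennreal) (auto intro!: mult_nonneg_nonneg)
        also have "(sqrt (2 * \<epsilon> k)) ^ DIM((real^'n) \<times> (real^'n)) \<le> (sqrt (2 * \<epsilon> k)) ^ 2"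
          using \<epsilon>[of k] by (intro power_decreasing d2) auto
        also have "(sqrt (2 * \<epsilon> k)) ^ 2 = 2 * \<epsilon> k" using \<epsilon>(1)[of k] by simp
        finally show ?thesis using R0 by (simp add: mult_left_mono mult_right_mono)
      qed
      have iZ: "integrable lborel (\<lambda>P. C0 / sqrt (\<epsilon> k) * indicator (Z k) P)"
        using Zs Zm by (intro integrable_mult_right integrable_real_indicator) (auto simp: less_top[symmetric])
      have LZ: "(LINT P|lborel. C0 / sqrt (\<epsilon> k) * indicator (Z k) P) \<le> C1 * sqrt (\<epsilon> k)"
      proof -
        have "(LINT P|lborel. C0 / sqrt (\<epsilon> k) * indicator (Z k) P) = C0 / sqrt (\<epsilon> k) * measure lborel (Z k)"
          by simp
        also have "\<dots> \<le> C0 / sqrt (\<epsilon> k) * (unit_ball_vol (real DIM((real^'n) \<times> (real^'n))) * (2 * \<epsilon> k) * (2 * R))"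
          using C0 \<epsilon>(1)[of k] by (intro mult_left_mono Zv) auto
        also have "\<dots> = C1 * (\<epsilon> k / sqrt (\<epsilon> k))" by (simp add: C1_def)
        also have "\<epsilon> k / sqrt (\<epsilon> k) = sqrt (\<epsilon> k)" using \<epsilon>(1)[of k] by (simp add: real_div_sqrt)
        finally show ?thesis .
      qed
      have iG: "integrable lborel (\<lambda>P. (p - 1) * s * g1 P + s powr (1 - p) * M powr p * g2 P)"
        by (rule Bochner_Integration.integrable_add[OF integrable_mult_right[OF ig1] integrable_mult_right[OF ig2]])
      have iR: "integrable lborel (\<lambda>P. ((p - 1) * s * g1 P + s powr (1 - p) * M powr p * g2 P) + C0 / sqrt (\<epsilon> k) * indicator (Z k) P)"
        by (rule Bochner_Integration.integrable_add[OF iG iZ])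
      have "\<bar>S\<bar> * (LINT P|lborel. chi k P * g1 P) = \<bar>LINT P|lborel. T P\<bar>"
        unfolding TI using cut01 g0 by (simp add: abs_mult)
      also have "\<dots> \<le> (LINT P|lborel. \<bar>T P\<bar>)" by (rule integral_abs_bound)
      also have "\<dots> \<le> (LINT P|lborel. ((p - 1) * s * g1 P + s powr (1 - p) * M powr p * g2 P) + C0 / sqrt (\<epsilon> k) * indicator (Z k) P)"
        by (rule integral_mono[OF integrable_abs[OF iT] iR Tb])
      also have "\<dots> = ((p - 1) * s * I1 + s powr (1 - p) * M powr p * I2) + (LINT P|lborel. C0 / sqrt (\<epsilon> k) * indicator (Z k) P)"
        unfolding Bochner_Integration.integral_add[OF iG iZ]
          Bochner_Integration.integral_add[OF integrable_mult_right[OF ig1] integrable_mult_right[OF ig2]]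
          I1_def I2_def by simp
      finally show ?thesis using LZ by linarith
    qed
    have lim1: "(\<lambda>k. LINT P|lborel. chi k P * g1 P) \<longlonglongrightarrow> I1"
      unfolding I1_def
    proof (rule integral_dominated_convergence[where w = g1])
      show "AE P in lborel. norm (chi k P * g1 P) \<le> g1 P" for k
        using cut01 g0 by (intro AE_I2) (simp add: abs_mult mult_left_le_one_le)
      show "(\<lambda>P. chi k P * g1 P) \<in> borel_measurable lborel" for k
      proof -
        have "continuous_on UNIV smooth_step" using DERIV_isCont[OF DERIV_smooth_step] by (simp add: continuous_at_imp_continuous_on)
        then have "continuous_on UNIV (chi k)" unfolding chi_def[abs_def]
          by (rule continuous_on_compose2) (use \<epsilon>(1)[of k] in \<open>auto intro!: continuous_intros\<close>)
        then show ?thesis using borel_measurable_times[OF borel_measurable_continuous_onI mg1] by simp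
      qed
      show "AE P in lborel. (\<lambda>k. chi k P * g1 P) \<longlonglongrightarrow> g1 P"
      proof (rule AE_I2)
        fix P :: "'n heis"
        show "(\<lambda>k. chi k P * g1 P) \<longlonglongrightarrow> g1 P"
        proof (cases "fst P = 0")
          case True then show ?thesis by (simp add: g1_def Phi_def)
        next
          case False
          then have m: "fst P \<bullet> fst P > 0" by simp
          have "filterlim (\<lambda>k. (fst P \<bullet> fst P) * (real k + 2)) at_top sequentially"
            using m by real_asymp
          then have "eventually (\<lambda>k. (fst P \<bullet> fst P) / \<epsilon> k \<ge> 2) sequentially"
            unfolding filterlim_at_top by (simp add: \<epsilon>_def)
          then have "eventually (\<lambda>k. g1 P = chi k P * g1 P) sequentially"
            by eventually_elim (simp add: chi_def smooth_step_props)
          then show ?thesis by (rule Lim_transform_eventually[OF tendsto_const])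
        qed
      qed
    qed (use ig1 mg1 in auto)
    have lim2: "(\<lambda>k. ((p - 1) * s * I1 + s powr (1 - p) * M powr p * I2) + C1 * sqrt (\<epsilon> k)) \<longlonglongrightarrow>
        ((p - 1) * s * I1 + s powr (1 - p) * M powr p * I2) + C1 * 0"
    proof (intro tendsto_intros)
      show "(\<lambda>k. sqrt (\<epsilon> k)) \<longlonglongrightarrow> 0" unfolding \<epsilon>_def by real_asymp
    qed
    have "\<bar>S\<bar> * I1 \<le> ((p - 1) * s * I1 + s powr (1 - p) * M powr p * I2) + C1 * 0"
      by (rule LIMSEQ_le[OF tendsto_mult_left[OF lim1] lim2]) (use step in blast)
    then show ?thesis by simp
  qed
  have "(\<bar>S\<bar> / (p * M)) powr p * I1 \<le> I2"
  proof (cases "S = 0")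
    case True then show ?thesis using I20 by simp
  next
    case False
    \<comment> \<open>The maximiser of s^(p-1) (|S| - (p-1) s), the factor of I1 after the
      inequality is multiplied by s^(p-1).\<close>
    define s where "s = \<bar>S\<bar> / p"
    have s: "s > 0" using False p by (simp add: s_def)
    have "\<bar>S\<bar> = p * s" using p by (simp add: s_def)
    with main[OF s] have "s * I1 \<le> s powr (1 - p) * M powr p * I2" by (simp add: algebra_simps)
    then have "s powr (p - 1) * (s * I1) \<le> s powr (p - 1) * (s powr (1 - p) * M powr p * I2)"
      by (intro mult_left_mono) auto
    also have "s powr (p - 1) * (s powr (1 - p) * M powr p * I2) = (s powr (p - 1) * s powr (1 - p)) * (M powr p * I2)" by simp
    also have "s powr (p - 1) * s powr (1 - p) = 1" using s by (simp add: powr_add[symmetric])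
    also have "s powr (p - 1) * (s * I1) = s powr p * I1" using s by (simp add: powr_diff)
    finally have "s powr p * I1 \<le> M powr p * I2" by simp
    then have "s powr p / M powr p * I1 \<le> I2" using M by (simp add: field_simps)
    moreover have "\<bar>S\<bar> / (p * M) = s / M" by (simp add: s_def)
    ultimately show ?thesis using s M by (simp add: powr_divide)
  qed
  then show ?thesis using ig1 ig2 unfolding S_def I1_def I2_def g1_def g2_def by blast
qed

end

section \<open>The two norms\<close>

text \<open>Equivalently pi/2 < sqrt 3, which follows from cos (sqrt 3) < 0. At sqrt 3 the even
  powers are integers: the Taylor polynomial is 1 - 3/2 + 9/24 = -1/8, and the remainder is at most
  27/720. The inequality allows the denominator 12 - pi^2 to be cleared.\<close>

lemma pi_squared_less_12: "pi\<^sup>2 < 12"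
proof -
  obtain t where t: "cos (sqrt 3) = (\<Sum>m<6. cos_coeff m * sqrt 3 ^ m) + (cos (t + 1/2 * real 6 * pi) / fact 6) * sqrt 3 ^ 6"
    using Maclaurin_cos_expansion[of "sqrt 3" 6] by blast
  have pw: "sqrt 3 ^ 2 = (3::real)" "sqrt 3 ^ 4 = (9::real)" "sqrt 3 ^ 6 = (27::real)"
    using power_mult[of "sqrt 3" 2 2] power_mult[of "sqrt 3" 2 3] by simp_all
  have "(\<Sum>m<6. cos_coeff m * sqrt 3 ^ m) = - 1/8"
  proof -
    have "{..<6::nat} = {0, 1, 2, 3, 4, 5}" by auto
    moreover have "cos_coeff 0 = 1" "cos_coeff 1 = 0" "cos_coeff 2 = - 1/2" "cos_coeff 3 = 0"
      "cos_coeff 4 = 1/24" "cos_coeff 5 = 0"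
      by (simp_all add: cos_coeff_def fact_numeral)
    ultimately show ?thesis using pw by simp
  qed
  moreover have "(cos (t + 1/2 * real 6 * pi) / fact 6) * sqrt 3 ^ 6 \<le> 27 / 720"
    unfolding pw using cos_le_one[of "t + 1/2 * real 6 * pi"] by (simp add: fact_numeral)
  ultimately have "cos (sqrt 3) < 0" using t by linarith
  then have "pi / 2 < sqrt 3" using cos_ge_zero[of "sqrt 3"] pi_gt_zero
    by (smt (verit) real_sqrt_ge_zero)
  then have "(pi / 2)\<^sup>2 < (sqrt 3)\<^sup>2" by (intro power_strict_mono) auto
  then show ?thesis by (simp add: power_divide)
qed

text \<open>The translation is N = Q - 2 and q = p \<theta> / 2. What remains for each norm is to
  find an admissible M in the pointwise hypothesis \<open>G\<close>.\<close>

lemma (in homogeneous_profile) hardy_const_ge: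
  fixes d :: "'n::finite heis \<Rightarrow> real"
  assumes p: "p \<ge> 2" and M: "M > 0"
    and d: "\<And>P. fst P \<noteq> 0 \<Longrightarrow> d P = sqrt ((norm (fst P))\<^sup>2 * \<phi> (snd P / (norm (fst P))\<^sup>2))"
  defines "Q \<equiv> hdim TYPE('n)"
  assumes G: "\<And>\<tau>. ((Q / (Q - 2) - p * \<theta> / (Q - 2) * (\<tau> * \<kappa> \<tau> / \<phi> \<tau>))\<^sup>2 + (p * \<theta> / (Q - 2) * \<tau> * (1 - \<tau> * \<kappa> \<tau> / \<phi> \<tau>))\<^sup>2) \<le> M\<^sup>2 * \<phi> \<tau>"
  shows "ereal ((\<bar>Q - p * \<theta>\<bar> / (p * M)) powr p) \<le> hardy_const d p \<theta>"
  unfolding hardy_const_def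
proof (intro Sup_upper imageI CollectI conjI ballI)
  show "0 \<le> (\<bar>Q - p * \<theta>\<bar> / (p * M)) powr p" by simp
  fix u :: "'n heis \<Rightarrow> real" assume u: "u \<in> Cc_inf_punct"
  define N q where "N = 2 * real CARD('n)" and "q = p * \<theta> / 2"
  have Q: "Q = N + 2" "Q - 2 = N" "2 * q = p * \<theta>" by (simp_all add: Q_def hdim_def N_def q_def)
  have "\<And>\<tau>. (((N + 2) / N - 2 * q / N * (\<tau> * \<kappa> \<tau> / \<phi> \<tau>))\<^sup>2 + (2 * q / N * \<tau> * (1 - \<tau> * \<kappa> \<tau> / \<phi> \<tau>))\<^sup>2) \<le> M\<^sup>2 * \<phi> \<tau>"
    using G unfolding Q by simp
  from hardy_inequality[OF p u M this[unfolded N_def]]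
  have i1: "integrable lborel (\<lambda>P. \<bar>u P\<bar> powr p * Phi P powr (- q))"
    and i2: "integrable lborel (\<lambda>P. hgrad_norm u P powr p * Phi P powr (p / 2 - q))"
    and le: "(\<bar>Q - p * \<theta>\<bar> / (p * M)) powr p * (LINT P|lborel. \<bar>u P\<bar> powr p * Phi P powr (- q))
      \<le> (LINT P|lborel. hgrad_norm u P powr p * Phi P powr (p / 2 - q))"
    by (simp_all add: N_def[symmetric] Q)
  have dP: "d P powr r = Phi P powr (r / 2)" "Phi P > 0" if "fst P \<noteq> 0" for P r
  proof -
    show pos: "Phi P > 0" using Phi_pos[OF that] .
    have "d P = Phi P powr (1/2)"
      using d[OF that] pos by (simp add: Phi_def power2_norm_eq_inner powr_half_sqrt)
    then show "d P powr r = Phi P powr (r / 2)" by (simp add: powr_powr)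
  qed
  have e1: "(\<integral>\<^sup>+ P. ennreal (\<bar>u P\<bar> powr p / d P powr (p * \<theta>)) \<partial>lborel) =
      ennreal (LINT P|lborel. \<bar>u P\<bar> powr p * Phi P powr (- q))"
  proof -
    have "(\<integral>\<^sup>+ P. ennreal (\<bar>u P\<bar> powr p / d P powr (p * \<theta>)) \<partial>lborel) = (\<integral>\<^sup>+ P. ennreal (\<bar>u P\<bar> powr p * Phi P powr (- q)) \<partial>lborel)"
    proof (rule nn_integral_cong_AE, rule AE_mp[OF AE_off_axis], intro AE_I2 impI)
      fix P :: "'n heis" assume "fst P \<noteq> 0"
      then show "ennreal (\<bar>u P\<bar> powr p / d P powr (p * \<theta>)) = ennreal (\<bar>u P\<bar> powr p * Phi P powr (- q))"
        by (simp add: dP q_def powr_minus_divide)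
    qed
    then show ?thesis using i1 by (simp add: nn_integral_eq_integral)
  qed
  have e2: "(\<integral>\<^sup>+ P. ennreal (hgrad_norm u P powr p / d P powr (p * (\<theta> - 1))) \<partial>lborel) =
      ennreal (LINT P|lborel. hgrad_norm u P powr p * Phi P powr (p / 2 - q))"
  proof -
    have "(\<integral>\<^sup>+ P. ennreal (hgrad_norm u P powr p / d P powr (p * (\<theta> - 1))) \<partial>lborel) = (\<integral>\<^sup>+ P. ennreal (hgrad_norm u P powr p * Phi P powr (p / 2 - q)) \<partial>lborel)"
    proof (rule nn_integral_cong_AE, rule AE_mp[OF AE_off_axis], intro AE_I2 impI)
      fix P :: "'n heis" assume z: "fst P \<noteq> 0"
      have "p / 2 - q = - (p * (\<theta> - 1) / 2)" by (simp add: q_def algebra_simps add_divide_distrib diff_divide_distrib)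
      then have "Phi P powr (p / 2 - q) = 1 / Phi P powr (p * (\<theta> - 1) / 2)" by (simp only: powr_minus_divide)
      then show "ennreal (hgrad_norm u P powr p / d P powr (p * (\<theta> - 1))) = ennreal (hgrad_norm u P powr p * Phi P powr (p / 2 - q))"
        using z by (simp add: dP)
    qed
    then show ?thesis using i2 by (simp add: nn_integral_eq_integral)
  qed
  show "(\<integral>\<^sup>+ P. ennreal (hgrad_norm u P powr p / d P powr (p * (\<theta> - 1))) \<partial>lborel)
      \<ge> ennreal ((\<bar>Q - p * \<theta>\<bar> / (p * M)) powr p) * (\<integral>\<^sup>+ P. ennreal (\<bar>u P\<bar> powr p / d P powr (p * \<theta>)) \<partial>lborel)"
    unfolding e1 e2 using le by (subst ennreal_mult[symmetric]) (auto intro!: ennreal_leI)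
qed

section \<open>The Koranyi norm\<close>

lemma koranyi_profile:
  "homogeneous_profile (\<lambda>\<tau>. sqrt (1 + \<tau>\<^sup>2)) (\<lambda>\<tau>. \<tau> / sqrt (1 + \<tau>\<^sup>2)) (\<lambda>\<tau>. 1 / (sqrt (1 + \<tau>\<^sup>2))^3)"
proof
  fix \<tau> :: real
  define r where "r = sqrt (1 + \<tau>\<^sup>2)"
  have pos: "1 + \<tau>\<^sup>2 > 0" by (simp add: add_pos_nonneg)
  have r: "r > 0" "r\<^sup>2 = 1 + \<tau>\<^sup>2" using pos by (simp_all add: r_def)
  show d: "((\<lambda>\<tau>. sqrt (1 + \<tau>\<^sup>2)) has_real_derivative \<tau> / sqrt (1 + \<tau>\<^sup>2)) (at \<tau>)"
    using pos by (auto intro!: derivative_eq_intros simp: field_simps)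
  have "((\<lambda>\<tau>. \<tau> / sqrt (1 + \<tau>\<^sup>2)) has_real_derivative (1 * sqrt (1 + \<tau>\<^sup>2) - \<tau> * (\<tau> / sqrt (1 + \<tau>\<^sup>2))) / (sqrt (1 + \<tau>\<^sup>2) * sqrt (1 + \<tau>\<^sup>2))) (at \<tau>)"
    using r by (intro DERIV_divide DERIV_ident d) (simp add: r_def)
  moreover have "(1 * r - \<tau> * (\<tau> / r)) / (r * r) = 1 / r^3"
    using r by (simp add: field_simps power2_eq_square power3_eq_cube)
  ultimately show "((\<lambda>\<tau>. \<tau> / sqrt (1 + \<tau>\<^sup>2)) has_real_derivative 1 / sqrt (1 + \<tau>\<^sup>2) ^ 3) (at \<tau>)"
    by (simp only: r_def)
  show "isCont (\<lambda>\<tau>. 1 / sqrt (1 + \<tau>\<^sup>2) ^ 3) \<tau>"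
    using r by (intro continuous_intros) (simp add: r_def)
  show "1 \<le> sqrt (1 + \<tau>\<^sup>2)" by simp
  show "\<bar>\<tau>\<bar> \<le> sqrt (1 + \<tau>\<^sup>2)" by (rule real_le_rsqrt) simp
  have "sqrt (1 + \<tau>\<^sup>2) \<le> 1 + \<bar>\<tau>\<bar>"
    by (rule real_le_lsqrt) (auto simp: power2_eq_square algebra_simps)
  then show "sqrt (1 + \<tau>\<^sup>2) \<le> 1 + 4 * \<bar>\<tau>\<bar>" by linarith
qed

lemma koranyi_eq:
  assumes "fst P \<noteq> 0"
  shows "koranyi P = sqrt ((norm (fst P))\<^sup>2 * sqrt (1 + (snd P / (norm (fst P))\<^sup>2)\<^sup>2))"
proof -
  define m t where "m = (norm (fst P))\<^sup>2" and "t = snd P"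
  have m: "m > 0" using assms by (simp add: m_def)
  have "m * sqrt (1 + (t / m)\<^sup>2) = sqrt (m\<^sup>2 * (1 + (t / m)\<^sup>2))" using m by (simp add: real_sqrt_mult)
  also have "m\<^sup>2 * (1 + (t / m)\<^sup>2) = m\<^sup>2 + t\<^sup>2" using m by (simp add: field_simps)
  finally have "m * sqrt (1 + (t / m)\<^sup>2) = (m\<^sup>2 + t\<^sup>2) powr (1/2)" by (simp add: powr_half_sqrt)
  then have "sqrt (m * sqrt (1 + (t / m)\<^sup>2)) = ((m\<^sup>2 + t\<^sup>2) powr (1/2)) powr (1/2)"
    by (simp add: powr_half_sqrt)
  also have "\<dots> = (m\<^sup>2 + t\<^sup>2) powr (1/4)" by (simp add: powr_powr)
  finally show ?thesis by (simp add: koranyi_def m_def t_def flip: power_mult)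
qed

text \<open>In the variable x = 1/r = |z|^2/\<rho>^2, which runs through (0,1], one has \<tau>
  \<kappa>/\<phi> = 1 - x^2 and \<tau>^2 x^2 = 1 - x^2. The quotient by \<phi> thus becomes a cubic
  polynomial in x.\<close>

lemma koranyi_field_sq:
  fixes a b \<tau> :: real
  defines "r \<equiv> sqrt (1 + \<tau>\<^sup>2)"
  shows "(a - b * (\<tau> * (\<tau> / r) / r))\<^sup>2 + (b * \<tau> * (1 - \<tau> * (\<tau> / r) / r))\<^sup>2
    = ((a - b)\<^sup>2 * (1 / r) - b * (b - 2 * a) * (1 / r)^3) * r"
proof -
  have pos: "1 + \<tau>\<^sup>2 > 0" by (simp add: add_pos_nonneg)
  have r: "r > 0" "r\<^sup>2 = 1 + \<tau>\<^sup>2" using pos by (simp_all add: r_def)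
  define x where "x = 1 / r"
  have x: "x * r = 1" using r by (simp add: x_def)
  have "x\<^sup>2 * r\<^sup>2 = 1" using x by (simp add: power_mult_distrib[symmetric])
  then have \<tau>: "\<tau>\<^sup>2 * x\<^sup>2 = 1 - x\<^sup>2" unfolding r(2) by (simp add: algebra_simps)
  have "\<tau> * (\<tau> / r) / r = \<tau>\<^sup>2 * x\<^sup>2" by (simp add: x_def power2_eq_square)
  then have e: "\<tau> * (\<tau> / r) / r = 1 - x\<^sup>2" unfolding \<tau> .
  have "(a - b * (1 - x\<^sup>2))\<^sup>2 + (b * \<tau> * (1 - (1 - x\<^sup>2)))\<^sup>2 = (a - b * (1 - x\<^sup>2))\<^sup>2 + b\<^sup>2 * (\<tau>\<^sup>2 * x\<^sup>2) * x\<^sup>2"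
    by (simp add: power2_eq_square)
  also have "\<dots> = ((a - b)\<^sup>2 - b * (b - 2 * a) * x\<^sup>2)"
    unfolding \<tau> by (simp add: power2_eq_square algebra_simps)
  also have "\<dots> = ((a - b)\<^sup>2 * x - b * (b - 2 * a) * x^3) * r"
    using x by (simp add: power3_eq_cube power2_eq_square) algebra
  finally show ?thesis unfolding e x_def .
qed

text \<open>The maximum over [0,1] sits at the endpoint x = 1, so 1 - x can be split off: the
  difference of the two sides is (1 - x) (a^2 - k x (1 + x)). For k > 0 the hypothesis says that the
  positive critical point, x^2 = (a^2 + k)/(3k), is not below 1.\<close>

lemma cubic_le_left:
  fixes a k x :: real
  assumes "0 \<le> x" "x \<le> 1" "2 * k \<le> a\<^sup>2"
  shows "(a\<^sup>2 + k) * x - k * x^3 \<le> a\<^sup>2"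
proof -
  have "k * (x * (1 + x)) \<le> a\<^sup>2"
  proof (cases "k \<ge> 0")
    case True
    have "x * (1 + x) \<le> 1 * 2" using assms by (intro mult_mono) auto
    then have "k * (x * (1 + x)) \<le> k * 2" using True by (intro mult_left_mono) auto
    then show ?thesis using assms by simp
  next
    case False
    then have "k * (x * (1 + x)) \<le> 0" using assms by (intro mult_nonpos_nonneg) auto
    then show ?thesis by (smt (verit) zero_le_power2)
  qed
  then have "0 \<le> (1 - x) * (a\<^sup>2 - k * (x * (1 + x)))" using assms by (intro mult_nonneg_nonneg) auto
  then show ?thesis by (simp add: power3_eq_cube algebra_simps)
qed

text \<open>The cubic attains its maximum over x \<ge> 0 at the critical point y, so the difference
  of the two sides has a double root there; it equals k (x - y)^2 (x + 2y).\<close>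

lemma cubic_le_right:
  fixes k x y :: real
  assumes "0 \<le> x" "0 \<le> y" "0 \<le> k"
  shows "3 * k * y\<^sup>2 * x - k * x^3 \<le> 2 * k * y^3"
proof -
  have "0 \<le> k * ((x - y)\<^sup>2 * (x + 2 * y))" using assms by (intro mult_nonneg_nonneg) auto
  then show ?thesis by (simp add: power3_eq_cube power2_eq_square algebra_simps)
qed

lemma koranyi_bound:
  fixes p \<theta> :: real
  assumes p: "p \<ge> 2"
  defines "Q \<equiv> hdim TYPE('n::finite)"
  shows "ereal (if p * \<theta> \<in> {(1 - sqrt (3/2)) * Q .. (1 + sqrt (3/2)) * Q}
                then \<bar>(Q - p * \<theta>) / p\<bar> powr p * \<bar>(Q - 2) / Q\<bar> powr p
                else (3/2) powr (p/2) * (3 * p * \<theta> * (p * \<theta> - 2 * Q)) powr (p/4)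
                       / \<bar>p * \<theta> - Q\<bar> powr (p/2) * \<bar>(Q - 2) / p\<bar> powr p)
           \<le> hardy_const (koranyi :: 'n heis \<Rightarrow> real) p \<theta>"
proof -
  interpret homogeneous_profile "\<lambda>\<tau>. sqrt (1 + \<tau>\<^sup>2)" "\<lambda>\<tau>. \<tau> / sqrt (1 + \<tau>\<^sup>2)" "\<lambda>\<tau>. 1 / (sqrt (1 + \<tau>\<^sup>2))^3"
    by (rule koranyi_profile)
  define N a b k X R where "N = Q - 2" and "a = Q / N" and "b = p * \<theta> / N" and "k = b * (b - 2 * a)"
    and "X = p * \<theta> * (p * \<theta> - 2 * Q)" and "R = \<bar>p * \<theta> - Q\<bar>"
  have N: "N > 0" "Q > 0" by (simp_all add: N_def Q_def hdim_def add_pos_pos)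
  have kX: "k * N\<^sup>2 = X" using N by (simp add: k_def a_def b_def X_def field_simps power2_eq_square)
  have abR: "(a - b)\<^sup>2 * N\<^sup>2 = R\<^sup>2" using N by (simp add: a_def b_def R_def field_simps power2_eq_square)
  have abk: "(a - b)\<^sup>2 = a\<^sup>2 + k" by (simp add: k_def power2_eq_square algebra_simps)
  have XR: "X = R\<^sup>2 - Q\<^sup>2" by (simp add: X_def R_def power2_eq_square algebra_simps)
  \<comment> \<open>The interval is (p \<theta> - Q)^2 \<le> 3/2 Q^2. By \<open>XR\<close> this is
    2X \<le> Q^2, or 2k \<le> a^2 after division by N^2: the condition under which the cubic is
    largest at x = 1. This is the origin of sqrt (3/2).\<close>
  have mem: "p * \<theta> \<in> {(1 - sqrt (3/2)) * Q .. (1 + sqrt (3/2)) * Q} \<longleftrightarrow> 2 * X \<le> Q\<^sup>2"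
  proof -
    have "p * \<theta> \<in> {(1 - sqrt (3/2)) * Q .. (1 + sqrt (3/2)) * Q} \<longleftrightarrow> R \<le> sqrt (3/2) * Q"
      unfolding R_def by (auto simp: abs_le_iff algebra_simps)
    also have "\<dots> \<longleftrightarrow> R\<^sup>2 \<le> (sqrt (3/2) * Q)\<^sup>2"
      using N by (subst power_mono_iff) (auto simp: R_def)
    also have "(sqrt (3/2) * Q)\<^sup>2 = 3/2 * Q\<^sup>2" by (simp add: power_mult_distrib)
    finally show ?thesis unfolding XR by auto
  qed
  have red: "ereal ((R / (p * M)) powr p) \<le> hardy_const (koranyi :: 'n heis \<Rightarrow> real) p \<theta>"
    if M: "M > 0" and f: "\<And>x. 0 \<le> x \<Longrightarrow> x \<le> 1 \<Longrightarrow> (a - b)\<^sup>2 * x - k * x^3 \<le> M\<^sup>2" for M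
  proof -
    have "ereal ((\<bar>Q - p * \<theta>\<bar> / (p * M)) powr p) \<le> hardy_const (koranyi :: 'n heis \<Rightarrow> real) p \<theta>"
      unfolding Q_def
    proof (rule hardy_const_ge[OF p M koranyi_eq], assumption)
      fix \<tau> :: real
      have inv: "0 \<le> 1 / y" "1 / y \<le> 1" if "y \<ge> 1" for y :: real using that by simp_all
      have "sqrt (1 + \<tau>\<^sup>2) \<ge> 1" by simp
      then have "((a - b)\<^sup>2 * (1 / sqrt (1 + \<tau>\<^sup>2)) - k * (1 / sqrt (1 + \<tau>\<^sup>2))^3) \<le> M\<^sup>2"
        by (intro f inv)
      then have "((a - b)\<^sup>2 * (1 / sqrt (1 + \<tau>\<^sup>2)) - k * (1 / sqrt (1 + \<tau>\<^sup>2))^3) * sqrt (1 + \<tau>\<^sup>2) \<le> M\<^sup>2 * sqrt (1 + \<tau>\<^sup>2)"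
        by (intro mult_right_mono) auto
      then show "(hdim TYPE('n) / (hdim TYPE('n) - 2) - p * \<theta> / (hdim TYPE('n) - 2) * (\<tau> * (\<tau> / sqrt (1 + \<tau>\<^sup>2)) / sqrt (1 + \<tau>\<^sup>2)))\<^sup>2 +
          (p * \<theta> / (hdim TYPE('n) - 2) * \<tau> * (1 - \<tau> * (\<tau> / sqrt (1 + \<tau>\<^sup>2)) / sqrt (1 + \<tau>\<^sup>2)))\<^sup>2 \<le> M\<^sup>2 * sqrt (1 + \<tau>\<^sup>2)"
        unfolding Q_def[symmetric] N_def[symmetric] a_def[symmetric] b_def[symmetric] koranyi_field_sq k_def[symmetric] .
    qed
    then show ?thesis by (simp add: R_def abs_minus_commute)
  qed
  show ?thesis
  proof (cases "2 * X \<le> Q\<^sup>2")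
    case True
    have ka: "2 * k \<le> a\<^sup>2"
    proof -
      have "2 * k * N\<^sup>2 \<le> a\<^sup>2 * N\<^sup>2" using True kX N by (simp add: a_def power_divide)
      then show ?thesis using N by simp
    qed
    have "ereal ((R / (p * a)) powr p) \<le> hardy_const (koranyi :: 'n heis \<Rightarrow> real) p \<theta>"
    proof (rule red)
      show "a > 0" using N by (simp add: a_def)
      show "(a - b)\<^sup>2 * x - k * x^3 \<le> a\<^sup>2" if "0 \<le> x" "x \<le> 1" for x
        unfolding abk by (rule cubic_le_left[OF that ka])
    qed
    moreover have "(R / (p * a)) powr p = \<bar>(Q - p * \<theta>) / p\<bar> powr p * \<bar>(Q - 2) / Q\<bar> powr p"
    proof -
      have "R / (p * a) = \<bar>(Q - p * \<theta>) / p\<bar> * \<bar>(Q - 2) / Q\<bar>"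
        using N p by (simp add: R_def a_def N_def[symmetric] abs_minus_commute field_simps)
      then show ?thesis by (simp only: powr_mult abs_ge_zero)
    qed
    ultimately show ?thesis unfolding if_P[OF mem[THEN iffD2, OF True]] by (simp only:)
  next
    case False
    then have X: "X > 0" using zero_le_power2[of Q] by linarith
    have R: "R > 0"
    proof (rule ccontr)
      assume "\<not> R > 0"
      then have "R = 0" by (simp add: R_def)
      then show False using XR X zero_le_power2[of Q] by simp
    qed
    have "k = X / N\<^sup>2" using kX N by (simp add: field_simps)
    then have k: "k > 0" using X N by simp
    \<comment> \<open>The critical point |a - b| / sqrt (3k) of the cubic, from which N cancels. The
      maximal value is 2 k y^3.\<close>
    define y where "y = R / sqrt (3 * X)"
    have y: "y > 0" using R X by (simp add: y_def)
    have y2: "3 * k * y\<^sup>2 = (a - b)\<^sup>2"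
    proof -
      have "3 * k * y\<^sup>2 * N\<^sup>2 = 3 * X * y\<^sup>2" using kX by (simp add: algebra_simps)
      also have "\<dots> = (a - b)\<^sup>2 * N\<^sup>2" unfolding abR y_def using X by (simp add: power_divide)
      finally show ?thesis using N by simp
    qed
    define M where "M = sqrt (2 * k * y^3)"
    have M: "M > 0" "M\<^sup>2 = 2 * k * y^3" using k y by (simp_all add: M_def)
    have "ereal ((R / (p * M)) powr p) \<le> hardy_const (koranyi :: 'n heis \<Rightarrow> real) p \<theta>"
      by (rule red[OF M(1)]) (use cubic_le_right[of _ y k] y k in \<open>simp add: M(2) y2\<close>)
    moreover have "(R / (p * M)) powr p = (3/2) powr (p/2) * (3 * X) powr (p/4) / R powr (p/2) * \<bar>N / p\<bar> powr p"
    proof -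
      \<comment> \<open>The p-th root of the asserted constant. Since M is itself a square root, the
        identity R/(pM) = c is checked on squares.\<close>
      define c where "c = (3/2) powr (1/2) * (3 * X) powr (1/4) / R powr (1/2) * (N / p)"
      have c0: "c > 0" using X R N p by (simp add: c_def)
      have c2: "c\<^sup>2 = 3/2 * sqrt (3 * X) / R * (N / p)\<^sup>2"
      proof -
        have "((3 * X) powr (1/4))\<^sup>2 = sqrt (3 * X)"
          using X by (simp add: powr_half_sqrt[symmetric] power2_eq_square powr_add[symmetric])
        then show ?thesis unfolding c_def power_mult_distrib power_divide
          using R by (simp add: powr_half_sqrt)
      qed
      have M2: "M\<^sup>2 = 2/3 * R^3 / (N\<^sup>2 * sqrt (3 * X))"
      proof -
        have "M\<^sup>2 * N\<^sup>2 = 2 * X * y^3" unfolding M(2) kX[symmetric] by simp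
        also have "y^3 = R^3 / (3 * X * sqrt (3 * X))"
          unfolding y_def power_divide using X by (simp add: power3_eq_cube)
        finally have eq: "M\<^sup>2 * N\<^sup>2 = 2/3 * R^3 / sqrt (3 * X)" using X by simp
        have "M\<^sup>2 = M\<^sup>2 * N\<^sup>2 / N\<^sup>2" using N by simp
        then show ?thesis unfolding eq by (simp add: mult.commute)
      qed
      have "(R / (p * M))\<^sup>2 = c\<^sup>2"
        unfolding power_divide power_mult_distrib M2 c2 using R N p X
        by (simp add: field_simps power2_eq_square power3_eq_cube)
      then have "R / (p * M) = c" using R p M c0 by (simp add: power2_eq_iff_nonneg)
      moreover have "c powr p = (3/2) powr (p/2) * (3 * X) powr (p/4) / R powr (p/2) * (N / p) powr p"
        unfolding c_def using X R N p by (simp add: powr_mult powr_divide powr_powr)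
      ultimately show ?thesis using N p by simp
    qed
    moreover have "3 * p * \<theta> * (p * \<theta> - 2 * Q) = 3 * X" by (simp add: X_def)
    moreover have "\<not> p * \<theta> \<in> {(1 - sqrt (3/2)) * Q .. (1 + sqrt (3/2)) * Q}" using False mem by blast
    ultimately show ?thesis unfolding R_def[symmetric] N_def[symmetric]
      by (simp only: if_False)
  qed
qed

section \<open>The Carnot-Caratheodory norm\<close>

lemma cc_profile: "homogeneous_profile cc_prof mu_inv (\<lambda>\<tau>. 1 / dmu (mu_inv \<tau>))"
  by (unfold_locales) (rule DERIV_cc_prof DERIV_mu_inv isCont_dmu_inv cc_prof_ge_1 cc_prof_ge_abs cc_prof_le)+

lemma g_raw_tendsto_0: "((g_raw Q p \<theta>) \<longlongrightarrow> (Q / (Q - 2))\<^sup>2) (at 0)"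
proof -
  have lim: "((\<lambda>\<nu>::real. (1 - cos \<nu>) / \<nu>\<^sup>2) \<longlongrightarrow> 1/2) (at 0)" "((\<lambda>\<nu>::real. (\<nu> - sin \<nu>) / \<nu>\<^sup>2) \<longlongrightarrow> 0) (at 0)"
    "((\<lambda>\<nu>::real. (1 - cos \<nu>) / \<nu>) \<longlongrightarrow> 0) (at 0)" by real_asymp+
  have "((g_raw Q p \<theta>) \<longlongrightarrow> 2 * (Q / (Q - 2))\<^sup>2 * (1/2) + (2 * p * \<theta> / (Q - 2))\<^sup>2 * 0\<^sup>2
      - 4 * p * \<theta> * Q / (Q - 2)\<^sup>2 * 0 * 0) (at 0)"
    unfolding g_raw_def[abs_def]
    by (intro tendsto_add tendsto_diff tendsto_mult tendsto_power tendsto_const lim)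
  then show ?thesis by simp
qed

lemma g_fun_0: "g_fun Q p \<theta> 0 = (Q / (Q - 2))\<^sup>2"
  using tendsto_Lim[OF _ g_raw_tendsto_0] by (simp add: g_fun_def)

lemma isCont_g_fun: "isCont (g_fun Q p \<theta>) \<nu>"
proof (cases "\<nu> = 0")
  case True
  have "((g_fun Q p \<theta>) \<longlongrightarrow> (Q / (Q - 2))\<^sup>2) (at 0)"
    by (rule Lim_transform_eventually[OF g_raw_tendsto_0[of Q p \<theta>]]) (auto simp: g_fun_def eventually_at_filter)
  then show ?thesis unfolding True isCont_def g_fun_0 .
next
  case False
  have "isCont (g_raw Q p \<theta>) \<nu>"
    unfolding g_raw_def[abs_def] divide_inverse using False by (intro continuous_intros) auto
  moreover have "eventually (\<lambda>\<nu>. g_raw Q p \<theta> \<nu> = g_fun Q p \<theta> \<nu>) (nhds \<nu>)"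
    using t1_space_nhds[OF False] by eventually_elim (simp add: g_fun_def)
  ultimately show ?thesis by (simp only: isCont_cong)
qed

lemma g_fun_le_g_sup: assumes "\<bar>\<nu>\<bar> \<le> 2 * pi" shows "g_fun Q p \<theta> \<nu> \<le> g_sup Q p \<theta>"
  unfolding g_sup_def
proof (rule cSUP_upper)
  have "compact (g_fun Q p \<theta> ` {-2*pi..2*pi})"
    by (intro compact_continuous_image continuous_at_imp_continuous_on) (auto simp: isCont_g_fun)
  then show "bdd_above (g_fun Q p \<theta> ` {-2*pi..2*pi})"
    by (intro bounded_imp_bdd_above compact_imp_bounded)
qed (use assms in auto)

text \<open>Here \<tau> = mu x, \<kappa> = x and \<phi> = (x/sin x)^2, so that \<tau>
  \<kappa>/\<phi> = e. Because mu x (1 - e) = e cot x, the two squares combine through 1 + cot^2 =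
  1/sin^2.\<close>

lemma cc_field_sq:
  assumes x: "\<bar>x\<bar> < pi" "x \<noteq> 0"
  defines "e \<equiv> (x - sin x * cos x) / x"
  shows "(a - b * (mu x * x / (xsin x)\<^sup>2))\<^sup>2 + (b * mu x * (1 - mu x * x / (xsin x)\<^sup>2))\<^sup>2
     = a\<^sup>2 - 2 * a * b * e + b\<^sup>2 * e\<^sup>2 / (sin x)\<^sup>2"
proof -
  have s: "sin x \<noteq> 0" using sin_neq_0 x by auto
  have 1: "mu x * x / (xsin x)\<^sup>2 = e"
    using s x by (simp add: mu_def xsin_def e_def power_divide power2_eq_square)
  have 2: "mu x * (1 - e) = e * (cos x / sin x)"
    using s x by (simp add: mu_def e_def field_simps power2_eq_square)
  have "(a - b * e)\<^sup>2 + (b * mu x * (1 - e))\<^sup>2 = (a - b * e)\<^sup>2 + (b * (e * (cos x / sin x)))\<^sup>2"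
    unfolding 2[symmetric] by (simp add: mult.assoc)
  also have "\<dots> = a\<^sup>2 - 2 * a * b * e + b\<^sup>2 * e\<^sup>2 * (1 + (cos x)\<^sup>2 / (sin x)\<^sup>2)"
    by (simp add: power2_eq_square algebra_simps)
  also have "1 + (cos x)\<^sup>2 / (sin x)\<^sup>2 = 1 / (sin x)\<^sup>2"
    unfolding cos_squared_eq using s by (simp add: field_simps)
  finally show ?thesis unfolding 1 by simp
qed

text \<open>With \<nu> = 2x the half-angle formulas 1 - cos \<nu> = 2 sin^2 x and \<nu> - sin \<nu>
  = 2 x e turn g into the expression of \<open>cc_field_sq\<close>, divided by (x/sin x)^2. At x = 0
  the continuous extension of g supplies the value.\<close>

lemma cc_field_sq_g_fun:
  assumes N: "N \<noteq> 0" and Q: "Q = N + 2" and x: "\<bar>x\<bar> < pi"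
  shows "(Q / N - p * \<theta> / N * (mu x * x / (xsin x)\<^sup>2))\<^sup>2 + (p * \<theta> / N * mu x * (1 - mu x * x / (xsin x)\<^sup>2))\<^sup>2
     = g_fun Q p \<theta> (2 * x) * (xsin x)\<^sup>2"
proof (cases "x = 0")
  case True
  then show ?thesis using Q by (simp add: g_fun_0 xsin_def)
next
  case False
  have s: "sin x \<noteq> 0" using sin_neq_0 x False by auto
  define e a b where "e = (x - sin x * cos x) / x" and "a = Q / N" and "b = p * \<theta> / N"
  have c2: "1 - cos (2 * x) = 2 * (sin x)\<^sup>2" unfolding cos_double_sin by simp
  have s2: "2 * x - sin (2 * x) = 2 * (x * e)" using False by (simp add: sin_double e_def)
  have "g_fun Q p \<theta> (2 * x) = 2 * a\<^sup>2 * (2 * (sin x)\<^sup>2 / (2 * x)\<^sup>2) + (2 * b)\<^sup>2 * (2 * (x * e) / (2 * x)\<^sup>2)\<^sup>2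
      - 4 * (a * b) * (2 * (x * e) / (2 * x)\<^sup>2) * (2 * (sin x)\<^sup>2 / (2 * x))"
    using False N unfolding g_fun_def g_raw_def c2 s2
    by (simp add: Q a_def b_def power2_eq_square)
  also have "\<dots> = (a\<^sup>2 - 2 * a * b * e + b\<^sup>2 * e\<^sup>2 / (sin x)\<^sup>2) * (sin x)\<^sup>2 / x\<^sup>2"
    using False s by (simp add: field_simps power2_eq_square)
  finally have "g_fun Q p \<theta> (2 * x) * (xsin x)\<^sup>2 = a\<^sup>2 - 2 * a * b * e + b\<^sup>2 * e\<^sup>2 / (sin x)\<^sup>2"
    using False s by (simp add: xsin_def power_divide)
  then show ?thesis using cc_field_sq[OF x False, of a b] by (simp add: a_def b_def e_def)
qed

text \<open>For a = Q/(Q-2) and b = p \<theta>/(Q-2) this says that g(2x) does not exceed g(0) =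
  a^2. After multiplication by sin^2 x it remains to bound (a^2 - 2abe) sin^2 x + b^2 e^2 by a^2
  x^2.\<close>

lemma cc_field_sq_le:
  assumes x: "\<bar>x\<bar> < pi" and b: "0 \<le> b" "4 * b \<le> 3 * a"
  shows "(a - b * (mu x * x / (xsin x)\<^sup>2))\<^sup>2 + (b * mu x * (1 - mu x * x / (xsin x)\<^sup>2))\<^sup>2 \<le> a\<^sup>2 * (xsin x)\<^sup>2"
proof (cases "x = 0")
  case True then show ?thesis by (simp add: xsin_def)
next
  case False
  have s: "sin x \<noteq> 0" using sin_neq_0 x False by auto
  define e z where "e = (x - sin x * cos x) / x" and "z = \<bar>x\<bar>"
  have z: "0 < z" "z < pi" using x False by (auto simp: z_def)
  have ez: "e = 1 - sin z * cos z / z" using False by (auto simp: e_def z_def abs_if diff_divide_distrib)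
  have sz: "(sin z)\<^sup>2 = (sin x)\<^sup>2" by (auto simp: z_def abs_if)
  have s1: "(sin x)\<^sup>2 \<le> 1" by (simp add: abs_square_le_1)
  have a: "a \<ge> 0" using b by linarith
  have e0: "e \<ge> 0"
  proof -
    have "sin (2 * z) \<le> 2 * z" using z by (intro sin_x_le_x) auto
    then have "sin z * cos z \<le> z" by (simp add: sin_double)
    then show ?thesis unfolding ez using z by (simp add: field_simps)
  qed
  have "(a\<^sup>2 - 2 * a * b * e) * (sin x)\<^sup>2 + b\<^sup>2 * e\<^sup>2 \<le> a\<^sup>2 * x\<^sup>2"
  \<comment> \<open>For |x| < pi/2 one has e \<le> 2 sin^2 x, since y cos y < sin y at y = 2|x|;
    then b^2 e^2 is absorbed by the mixed term 2abe sin^2 x. For larger |x| only e \<le> 1 +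
    1/(2|x|) \<le> 4/3 is available, which explains the ratio 3/4 in the hypothesis: it gives be
    \<le> a. The total 2 a^2 is then below a^2 x^2, because (3/2)^2 > 2.\<close>
  proof (cases "2 * z < pi")
    case True
    have "2 * z * cos (2 * z) < sin (2 * z)" using z True by (intro x_cos_less_sin) auto
    then have "z * (1 - 2 * (sin z)\<^sup>2) \<le> sin z * cos z" by (simp add: cos_double_sin sin_double)
    then have e2: "e \<le> 2 * (sin x)\<^sup>2" unfolding ez sz[symmetric] using z by (simp add: field_simps)
    have "b * e \<le> a * (2 * (sin x)\<^sup>2)" using e2 e0 a b by (intro mult_mono) auto
    then have "(b * e) * (b * e) \<le> (b * e) * (a * (2 * (sin x)\<^sup>2))" using b e0 by (intro mult_left_mono) auto
    then have "(a\<^sup>2 - 2 * a * b * e) * (sin x)\<^sup>2 + b\<^sup>2 * e\<^sup>2 \<le> a\<^sup>2 * (sin x)\<^sup>2"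
      by (simp add: power2_eq_square algebra_simps)
    also have "\<dots> \<le> a\<^sup>2 * x\<^sup>2"
    proof (rule mult_left_mono)
      have "sin z \<le> z" "0 \<le> sin z" using z by (auto intro: sin_x_le_x sin_ge_zero)
      then have "(sin z)\<^sup>2 \<le> z\<^sup>2" by (intro power_mono)
      then show "(sin x)\<^sup>2 \<le> x\<^sup>2" unfolding sz by (simp add: z_def)
    qed simp
    finally show ?thesis .
  next
    case False
    then have z32: "3 / 2 \<le> z" using pi_gt3 by linarith
    have "\<bar>sin (2 * z)\<bar> \<le> 1" by simp
    then have "- (1/2) \<le> sin z * cos z" unfolding sin_double by linarith
    then have "e \<le> 1 + (1/2) / z" unfolding ez using z divide_right_mono[of "- (1/2)" "sin z * cos z" z] by simp
    also have "(1/2) / z \<le> 1 / 3" using z32 by (simp add: field_simps)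
    finally have e43: "e \<le> 4 / 3" by simp
    have "b * e \<le> (3 / 4 * a) * (4 / 3)" using e43 e0 a b by (intro mult_mono) auto
    then have "b * e \<le> a" by simp
    then have "(b * e)\<^sup>2 \<le> a\<^sup>2" using b e0 by (intro power_mono) auto
    moreover have "(a\<^sup>2 - 2 * a * b * e) * (sin x)\<^sup>2 \<le> a\<^sup>2 * 1"
      using a b e0 s1 by (intro mult_mono) auto
    moreover have "a\<^sup>2 * 2 \<le> a\<^sup>2 * x\<^sup>2"
    proof (rule mult_left_mono)
      have "(3/2)\<^sup>2 \<le> z\<^sup>2" using z32 by (intro power_mono) auto
      then show "2 \<le> x\<^sup>2" by (simp add: z_def power2_eq_square)
    qed simp
    ultimately show ?thesis by (simp add: power_mult_distrib)
  qed
  then have "((a\<^sup>2 - 2 * a * b * e) * (sin x)\<^sup>2 + b\<^sup>2 * e\<^sup>2) / (sin x)\<^sup>2 \<le> a\<^sup>2 * x\<^sup>2 / (sin x)\<^sup>2"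
    by (rule divide_right_mono) simp
  then have "a\<^sup>2 - 2 * a * b * e + b\<^sup>2 * e\<^sup>2 / (sin x)\<^sup>2 \<le> a\<^sup>2 * (x / sin x)\<^sup>2"
    using s by (simp add: add_divide_distrib power_divide)
  moreover have "xsin x = x / sin x" using \<open>x \<noteq> 0\<close> by (simp add: xsin_def)
  ultimately show ?thesis
    unfolding cc_field_sq[OF x \<open>x \<noteq> 0\<close>] e_def[symmetric] by (simp only:)
qed

lemma cc_bound:
  fixes p \<theta> :: real
  assumes p: "p \<ge> 2"
  defines "Q \<equiv> hdim TYPE('n::finite)"
  shows "ereal (if \<theta> \<ge> 0 \<and> Q \<ge> 4 * p * \<theta> / (12 - pi^2)
                then ((Q - 2) / Q) powr p * \<bar>(Q - p * \<theta>) / p\<bar> powr p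
                else 1 / g_sup Q p \<theta> powr (p/2) * \<bar>(Q - p * \<theta>) / p\<bar> powr p)
           \<le> hardy_const (cc_dist :: 'n heis \<Rightarrow> real) p \<theta>"
proof -
  interpret homogeneous_profile cc_prof mu_inv "\<lambda>\<tau>. 1 / dmu (mu_inv \<tau>)" by (rule cc_profile)
  define N where "N = Q - 2"
  have N: "N > 0" "Q > 0" "Q = N + 2" by (simp_all add: N_def Q_def hdim_def add_pos_pos)
  have red: "ereal ((\<bar>Q - p * \<theta>\<bar> / (p * M)) powr p) \<le> hardy_const (cc_dist :: 'n heis \<Rightarrow> real) p \<theta>"
    if M: "M > 0" and f: "\<And>x. \<bar>x\<bar> < pi \<Longrightarrow> (Q / N - p * \<theta> / N * (mu x * x / (xsin x)\<^sup>2))\<^sup>2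
        + (p * \<theta> / N * mu x * (1 - mu x * x / (xsin x)\<^sup>2))\<^sup>2 \<le> M\<^sup>2 * (xsin x)\<^sup>2" for M
    unfolding Q_def
  proof (rule hardy_const_ge[OF p M cc_dist_eq], assumption)
    fix \<tau> :: real
    show "(hdim TYPE('n) / (hdim TYPE('n) - 2) - p * \<theta> / (hdim TYPE('n) - 2) * (\<tau> * mu_inv \<tau> / cc_prof \<tau>))\<^sup>2 +
        (p * \<theta> / (hdim TYPE('n) - 2) * \<tau> * (1 - \<tau> * mu_inv \<tau> / cc_prof \<tau>))\<^sup>2 \<le> M\<^sup>2 * cc_prof \<tau>"
      using f[OF mu_inv(1)[of \<tau>]] unfolding Q_def[symmetric] N_def[symmetric] cc_prof_eq mu_inv(2) .
  qed
  show ?thesis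
  proof (cases "\<theta> \<ge> 0 \<and> Q \<ge> 4 * p * \<theta> / (12 - pi^2)")
    case True
    \<comment> \<open>From pi > 3 one gets 12 - pi^2 \<le> 3, so the assumption on Q gives 4 p
      \<theta> \<le> 3 Q, that is, 4b \<le> 3a.\<close>
    have "9 \<le> pi\<^sup>2" using power_mono[of 3 pi 2] pi_gt3 by simp
    then have "Q * (12 - pi\<^sup>2) \<le> Q * 3" by (intro mult_left_mono) (use N in auto)
    moreover have "4 * p * \<theta> \<le> Q * (12 - pi\<^sup>2)"
      using True pi_squared_less_12 by (simp add: pos_divide_le_eq)
    ultimately have "4 * (p * \<theta>) \<le> 3 * Q" by linarith
    then have "4 * (p * \<theta>) / N \<le> 3 * Q / N" using N by (intro divide_right_mono) auto
    then have "ereal ((\<bar>Q - p * \<theta>\<bar> / (p * (Q / N))) powr p) \<le> hardy_const (cc_dist :: 'n heis \<Rightarrow> real) p \<theta>"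
      using N True p by (intro red cc_field_sq_le) auto
    moreover have "(\<bar>Q - p * \<theta>\<bar> / (p * (Q / N))) powr p = (N / Q) powr p * \<bar>(Q - p * \<theta>) / p\<bar> powr p"
    proof -
      have "\<bar>Q - p * \<theta>\<bar> / (p * (Q / N)) = (N / Q) * \<bar>(Q - p * \<theta>) / p\<bar>" using N p by (simp add: field_simps)
      moreover have "(N / Q * \<bar>(Q - p * \<theta>) / p\<bar>) powr p = (N / Q) powr p * \<bar>(Q - p * \<theta>) / p\<bar> powr p"
        by (rule powr_mult)
      ultimately show ?thesis by (simp only:)
    qed
    ultimately show ?thesis using True by (simp add: N_def)
  next
    case False
    \<comment> \<open>The supremum is positive because g(0) = (Q/(Q-2))^2 is. The parameters |x| <
      pi correspond to |\<nu>| < 2 pi, within the domain of g.\<close>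
    define M where "M = sqrt (g_sup Q p \<theta>)"
    have "(Q / (Q - 2))\<^sup>2 \<le> g_sup Q p \<theta>" using g_fun_le_g_sup[of 0 Q p \<theta>] by (simp only: g_fun_0) simp
    moreover have "(Q / (Q - 2))\<^sup>2 > 0" unfolding N_def[symmetric] using N(1,2) by simp
    ultimately have g: "g_sup Q p \<theta> > 0" by linarith
    have M: "M > 0" "M\<^sup>2 = g_sup Q p \<theta>" using g by (simp_all add: M_def)
    have "ereal ((\<bar>Q - p * \<theta>\<bar> / (p * M)) powr p) \<le> hardy_const (cc_dist :: 'n heis \<Rightarrow> real) p \<theta>"
    proof (rule red[OF M(1)])
      fix x :: real assume x: "\<bar>x\<bar> < pi"
      have "g_fun Q p \<theta> (2 * x) * (xsin x)\<^sup>2 \<le> M\<^sup>2 * (xsin x)\<^sup>2"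
        unfolding M(2) using x by (intro mult_right_mono g_fun_le_g_sup) auto
      then show "(Q / N - p * \<theta> / N * (mu x * x / (xsin x)\<^sup>2))\<^sup>2
        + (p * \<theta> / N * mu x * (1 - mu x * x / (xsin x)\<^sup>2))\<^sup>2 \<le> M\<^sup>2 * (xsin x)\<^sup>2"
        using cc_field_sq_g_fun[OF _ N(3) x] N(1) by simp
    qed
    moreover have "(\<bar>Q - p * \<theta>\<bar> / (p * M)) powr p = 1 / g_sup Q p \<theta> powr (p/2) * \<bar>(Q - p * \<theta>) / p\<bar> powr p"
    proof -
      have "M powr p = g_sup Q p \<theta> powr (p/2)"
      proof -
        have "M = g_sup Q p \<theta> powr (1/2)" using g by (simp add: M_def powr_half_sqrt)
        then show ?thesis by (simp add: powr_powr)
      qed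
      moreover have "\<bar>Q - p * \<theta>\<bar> / (p * M) = \<bar>(Q - p * \<theta>) / p\<bar> / M" using p by (simp add: field_simps)
      moreover have "(\<bar>(Q - p * \<theta>) / p\<bar> / M) powr p = \<bar>(Q - p * \<theta>) / p\<bar> powr p / M powr p"
        by (rule powr_divide)
      ultimately show ?thesis by (simp only: times_divide_eq_left mult_1_left)
    qed
    ultimately show ?thesis using False by (simp only: if_False)
  qed
qed

theorem theorem1p6:
  fixes p \<theta> :: real
  assumes "p \<ge> 2"
  defines "Q \<equiv> hdim TYPE('n::finite)"
  shows "(ereal (if p * \<theta> \<in> {(1 - sqrt (3/2)) * Q .. (1 + sqrt (3/2)) * Q}
                then \<bar>(Q - p * \<theta>) / p\<bar> powr p * \<bar>(Q - 2) / Q\<bar> powr p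
                else (3/2) powr (p/2) * (3 * p * \<theta> * (p * \<theta> - 2 * Q)) powr (p/4)
                       / \<bar>p * \<theta> - Q\<bar> powr (p/2) * \<bar>(Q - 2) / p\<bar> powr p)
           \<le> hardy_const (koranyi :: 'n heis \<Rightarrow> real) p \<theta>) \<and>
         (ereal (if \<theta> \<ge> 0 \<and> Q \<ge> 4 * p * \<theta> / (12 - pi^2)
                then ((Q - 2) / Q) powr p * \<bar>(Q - p * \<theta>) / p\<bar> powr p
                else 1 / g_sup Q p \<theta> powr (p/2) * \<bar>(Q - p * \<theta>) / p\<bar> powr p)
           \<le> hardy_const (cc_dist :: 'n heis \<Rightarrow> real) p \<theta>)"
  unfolding Q_def by (intro conjI koranyi_bound cc_bound assms)

end
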